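(* Let $\mathbb{F}=\mathbb{R}$ or $\mathbb{C}$. Then $GL(\mathbb{F}):=\{\langle A\rangle\in\Sigma : \mathrm{Dt}(\langle A\rangle)\ne0\}$, with the product $\ltimes$, is a bundled Lie group.
   Context: $\mathcal{M}_1=\bigcup_{n\ge1}\mathcal{M}_{n\times n}$ is the set of all square matrices over $\mathbb{F}$; $\otimes$ is the Kronecker product. $A\sim B$ means $A\otimes I_s=B\otimes I_t$ for some positive integers $s,t$; $\Sigma:=\mathcal{M}_1/\!\sim$ with classes $\langle A\rangle$. For $A\in\mathcal{M}_{n\times n}$, $\mathrm{Dt}(\langle A\rangle):=\mathrm{Dt}(A):=|\det A|^{1/n}$ (independent of the representative), so $GL(\mathbb{F})$ consists of classes of nonsingular matrices. For $A\in\mathcal{M}_{m\times m}$, $B\in\mathcal{M}_{n\times n}$, $t=\mathrm{lcm}(m,n)$: $\langle A\rangle\ltimes\langle B\rangle:=\langle(A\otimes I_{t/m})(B\otimes I_{t/n})\rangle$, which is well defined. $\Sigma$ has the topology $\mathcal{T}$ generated by the sub-basis of all sets $s_n(o):=\{\langle A\rangle:\langle A\rangle\cap o\ne\emptyset\}$, $n\ge1$, $o$ an open ball with rational center and radius in $\mathcal{M}_{n\times n}$ (regarded as a Euclidean space); $GL(\mathbb{F})$ is an open subset of $\Sigma$ with the induced topology. The natural simple coordinates are those of the leaves: a class is described by its representative in $\mathcal{M}_{n\times n}$. Bundled manifolds. In a topological space $M$, a nonempty open set $U$ is a simple coordinate chart of dimension $s$ if it is homeomorphic to an open subset of $\mathbb{R}^s$;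 a nonempty open set is a bundled coordinate chart if it is a finite intersection $\bigcap_iU_i$ of simple coordinate charts. Two bundled charts $\bigcap_iU_i$, $\bigcap_jV_j$ are analytically comparable if any $U_i$ and $V_j$ of equal dimension have analytic transition maps on $U_i\cap V_j$. $M$ is a bundled analytic manifold if (1) it is second countable and Hausdorff; (2) it has an open cover $\mathcal{C}$ by pairwise analytically comparable bundled coordinate charts; (3) every bundled coordinate chart comparable with all members of $\mathcal{C}$ belongs to $\mathcal{C}$. A topological space $G$ is a bundled Lie group if (1) it is a bundled analytic manifold; (2) it is a group; (3) the product $(A,B)\mapsto AB$ and the inverse $A\mapsto A^{-1}$ are analytic, meaning that they are analytic when expressed in simple (leaf) coordinates: for $\langle A\rangle,\langle B\rangle$ represented in $\mathcal{M}_{m\times m}$, $\mathcal{M}_{n\times n}$, the product is expressed in $\mathcal{M}_{t\times t}$, $t=\mathrm{lcm}(m,n)$, and the inverse in $\mathcal{M}_{m\times m}$. *)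

theory Defs
  imports
    "HOL-Analysis.Analysis"
    "HOL-Algebra.Group"
    "Jordan_Normal_Form.Determinant"
begin

section \<open>Equivalence classes of square matrices\<close>

text \<open>All of this is needed for real and for complex entries only; both types are instances of the
  classes \<^class>\<open>real_normed_field\<close> and \<^class>\<open>euclidean_space\<close>.\<close>

definition square_mats :: "'a mat set" where
  "square_mats = (\<Union>n\<in>{1..}. carrier_mat n n)"

definition kronecker :: "'a::semiring_1 mat \<Rightarrow> 'a mat \<Rightarrow> 'a mat" (infixl \<open>\<otimes>\<^sub>K\<close> 70) where
  "A \<otimes>\<^sub>K B = Matrix.mat (dim_row A * dim_row B) (dim_col A * dim_col B)
     (\<lambda>(i, j). A $$ (i div dim_row B, j div dim_col B) * B $$ (i mod dim_row B, j mod dim_col B))"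

definition mat_sim :: "('a::semiring_1 mat \<times> 'a mat) set" where
  "mat_sim = {(A, B). A \<in> square_mats \<and> B \<in> square_mats \<and>
     (\<exists>s t. 0 < s \<and> 0 < t \<and> A \<otimes>\<^sub>K 1\<^sub>m s = B \<otimes>\<^sub>K 1\<^sub>m t)}"

definition mat_class :: "'a::semiring_1 mat \<Rightarrow> 'a mat set" where
  "mat_class A = mat_sim `` {A}"

definition Sigma_space :: "'a::semiring_1 mat set set" where
  "Sigma_space = square_mats // mat_sim"

definition mat_Dt :: "'a::real_normed_field mat \<Rightarrow> real" where
  "mat_Dt A = root (dim_row A) (norm (Determinant.det A))"

text \<open>Functions on classes are given as the common value over all representatives.\<close>

definition Dt :: "'a::real_normed_field mat set \<Rightarrow> real" where
  "Dt X = the_elem (mat_Dt ` X)"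

definition mat_stp :: "'a::semiring_1 mat \<Rightarrow> 'a mat \<Rightarrow> 'a mat" (infixl \<open>\<ltimes>\<^sub>M\<close> 70) where
  "A \<ltimes>\<^sub>M B = (let m = dim_row A; n = dim_row B; t = lcm m n
     in (A \<otimes>\<^sub>K 1\<^sub>m (t div m)) * (B \<otimes>\<^sub>K 1\<^sub>m (t div n)))"

definition class_stp :: "'a::semiring_1 mat set \<Rightarrow> 'a mat set \<Rightarrow> 'a mat set" (infixl \<open>\<ltimes>\<close> 70) where
  "X \<ltimes> Y = the_elem ((\<lambda>(A, B). mat_class (A \<ltimes>\<^sub>M B)) ` (X \<times> Y))"

definition GL_classes :: "'a::real_normed_field mat set set" where
  "GL_classes = {X \<in> Sigma_space. Dt X \<noteq> 0}"

definition GL_group :: "'a::real_normed_field mat set monoid" where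
  "GL_group = \<lparr>carrier = GL_classes, mult = (\<ltimes>), one = mat_class (1\<^sub>m 1)\<rparr>"


section \<open>The topology on the set of classes\<close>

definition rational_mat :: "'a::euclidean_space mat \<Rightarrow> bool" where
  "rational_mat A \<longleftrightarrow> (\<forall>i<dim_row A. \<forall>j<dim_col A. \<forall>b\<in>Basis. A $$ (i, j) \<bullet> b \<in> \<rat>)"

definition mat_ball :: "nat \<Rightarrow> 'a::real_normed_field mat \<Rightarrow> real \<Rightarrow> 'a mat set" where
  "mat_ball n C r = {A \<in> carrier_mat n n.
     sqrt (\<Sum>i<n. \<Sum>j<n. (norm (A $$ (i, j) - C $$ (i, j)))\<^sup>2) < r}"

definition rational_balls :: "nat \<Rightarrow> 'a::{real_normed_field, euclidean_space} mat set set" where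
  "rational_balls n = {mat_ball n C r | C r. C \<in> carrier_mat n n \<and> rational_mat C \<and> r \<in> \<rat> \<and> 0 < r}"

definition classes_meeting :: "'a::semiring_1 mat set \<Rightarrow> 'a mat set set" where
  "classes_meeting S = {X \<in> Sigma_space. X \<inter> S \<noteq> {}}"

definition Sigma_topology :: "'a::{real_normed_field, euclidean_space} mat set topology" where
  "Sigma_topology = topology_generated_by (\<Union>n\<in>{1..}. classes_meeting ` rational_balls n)"

definition GL_topology :: "'a::{real_normed_field, euclidean_space} mat set topology" where
  "GL_topology = subtopology Sigma_topology GL_classes"


section \<open>Real analytic maps\<close>

text \<open>\<^term>\<open>Euclidean_space p\<close> consists of the sequences vanishing from index \<open>p\<close> on. Multi-indices
  in \<open>p\<close> variables are represented likewise, and \<^const>\<open>has_sum\<close> expresses unconditional (hence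
  absolute) convergence of the power series.\<close>

definition multi_indices :: "nat \<Rightarrow> (nat \<Rightarrow> nat) set" where
  "multi_indices p = {\<alpha>. \<forall>i\<ge>p. \<alpha> i = 0}"

definition real_analytic_on :: "nat \<Rightarrow> (nat \<Rightarrow> real) set \<Rightarrow> ((nat \<Rightarrow> real) \<Rightarrow> real) \<Rightarrow> bool" where
  "real_analytic_on p W f \<longleftrightarrow> openin (Euclidean_space p) W \<and>
     (\<forall>a\<in>W. \<exists>r>0. \<exists>c. \<forall>x\<in>W. (\<forall>i<p. \<bar>x i - a i\<bar> < r) \<longrightarrow>
        ((\<lambda>\<alpha>. c \<alpha> * (\<Prod>i<p. (x i - a i) ^ \<alpha> i)) has_sum f x) (multi_indices p))"

definition analytic_map ::
  "nat \<Rightarrow> (nat \<Rightarrow> real) set \<Rightarrow> nat \<Rightarrow> ((nat \<Rightarrow> real) \<Rightarrow> nat \<Rightarrow> real) \<Rightarrow> bool" where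
  "analytic_map p W q F \<longleftrightarrow> F \<in> W \<rightarrow> topspace (Euclidean_space q) \<and>
     (\<forall>j<q. real_analytic_on p W (\<lambda>x. F x j))"

text \<open>\<open>f\<close>, restricted to \<open>A\<close>, is analytic when expressed in coordinates \<open>\<phi>\<close> (with \<open>p\<close> components)
  on \<open>A\<close> and \<open>\<psi>\<close> (with \<open>q\<close> components) on the target.\<close>

definition analytic_in_coords ::
  "nat \<Rightarrow> ('a \<Rightarrow> nat \<Rightarrow> real) \<Rightarrow> 'a set \<Rightarrow> nat \<Rightarrow> ('b \<Rightarrow> nat \<Rightarrow> real) \<Rightarrow> ('a \<Rightarrow> 'b) \<Rightarrow> bool" where
  "analytic_in_coords p \<phi> A q \<psi> f \<longleftrightarrow>
     inj_on \<phi> A \<and> analytic_map p (\<phi> ` A) q (\<psi> \<circ> f \<circ> inv_into A \<phi>)"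


section \<open>Bundled manifolds\<close>

datatype 'p coords = Coords (cdom: "'p set") (cdim: nat) (cmap: "'p \<Rightarrow> nat \<Rightarrow> real")

definition simple_chart :: "'p topology \<Rightarrow> 'p coords \<Rightarrow> bool" where
  "simple_chart X U \<longleftrightarrow> openin X (cdom U) \<and> cdom U \<noteq> {} \<and>
     (\<exists>W. openin (Euclidean_space (cdim U)) W \<and>
       homeomorphic_map (subtopology X (cdom U)) (subtopology (Euclidean_space (cdim U)) W) (cmap U))"

text \<open>A bundled chart is given by the finite set of simple charts whose intersection it is.\<close>

definition bundle_dom :: "'p coords set \<Rightarrow> 'p set" where
  "bundle_dom b = (\<Inter>U\<in>b. cdom U)"

definition bundled_chart :: "'p topology \<Rightarrow> 'p coords set \<Rightarrow> bool" where
  "bundled_chart X b \<longleftrightarrow> finite b \<and> b \<noteq> {} \<and> (\<forall>U\<in>b. simple_chart X U) \<and> bundle_dom b \<noteq> {}"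

definition analytic_transition :: "'p coords \<Rightarrow> 'p coords \<Rightarrow> bool" where
  "analytic_transition U V \<longleftrightarrow>
     analytic_in_coords (cdim U) (cmap U) (cdom U \<inter> cdom V) (cdim V) (cmap V) id \<and>
     analytic_in_coords (cdim V) (cmap V) (cdom U \<inter> cdom V) (cdim U) (cmap U) id"

definition analytically_comparable :: "'p coords set \<Rightarrow> 'p coords set \<Rightarrow> bool" where
  "analytically_comparable b c \<longleftrightarrow>
     (\<forall>U\<in>b. \<forall>V\<in>c. cdim U = cdim V \<longrightarrow> analytic_transition U V)"

definition bundled_analytic_manifold :: "'p topology \<Rightarrow> 'p coords set set \<Rightarrow> bool" where
  "bundled_analytic_manifold X \<C> \<longleftrightarrow>
     second_countable X \<and> Hausdorff_space X \<and>
     (\<forall>b\<in>\<C>. bundled_chart X b) \<and>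
     (\<Union>b\<in>\<C>. bundle_dom b) = topspace X \<and>
     (\<forall>b\<in>\<C>. \<forall>c\<in>\<C>. analytically_comparable b c) \<and>
     (\<forall>b. bundled_chart X b \<and> (\<forall>c\<in>\<C>. analytically_comparable b c) \<longrightarrow> b \<in> \<C>)"


section \<open>Bundled Lie groups\<close>

text \<open>A system of leaf coordinates assigns to each \<open>n \<ge> 1\<close> a leaf together with coordinates on it. A
  leaf as a whole need not be a simple chart: in the matrix case, the leaf of a proper divisor of
  \<open>n\<close> is open in the leaf of \<open>n\<close>, whereas its image under the coordinates of the latter is not open.
  The leaf coordinates are natural simple coordinates of a bundled manifold if their restrictions
  that are simple charts belong to the structure and cover the space.\<close>

definition natural_coords ::
  "'p topology \<Rightarrow> 'p coords set set \<Rightarrow> (nat \<Rightarrow> 'p coords) \<Rightarrow> bool" where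
  "natural_coords X \<C> L \<longleftrightarrow>
     (\<forall>n\<ge>1. \<forall>U. U \<subseteq> cdom (L n) \<and> simple_chart X (Coords U (cdim (L n)) (cmap (L n))) \<longrightarrow>
        {Coords U (cdim (L n)) (cmap (L n))} \<in> \<C>) \<and>
     (\<forall>x\<in>topspace X. \<exists>n\<ge>1. \<exists>U. x \<in> U \<and> U \<subseteq> cdom (L n) \<and>
        simple_chart X (Coords U (cdim (L n)) (cmap (L n))))"

definition join_coords :: "'p coords \<Rightarrow> 'p coords \<Rightarrow> 'p \<times> 'p \<Rightarrow> nat \<Rightarrow> real" where
  "join_coords U V = (\<lambda>(x, y) i. if i < cdim U then cmap U x i else cmap V y (i - cdim U))"

definition analytic_product :: "('p, 'm) monoid_scheme \<Rightarrow> (nat \<Rightarrow> 'p coords) \<Rightarrow> bool" where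
  "analytic_product G L \<longleftrightarrow> (\<forall>m\<ge>1. \<forall>n\<ge>1.
     (\<lambda>(x, y). x \<otimes>\<^bsub>G\<^esub> y) \<in> cdom (L m) \<times> cdom (L n) \<rightarrow> cdom (L (lcm m n)) \<and>
     analytic_in_coords (cdim (L m) + cdim (L n)) (join_coords (L m) (L n))
       (cdom (L m) \<times> cdom (L n)) (cdim (L (lcm m n))) (cmap (L (lcm m n))) (\<lambda>(x, y). x \<otimes>\<^bsub>G\<^esub> y))"

definition analytic_inverse :: "('p, 'm) monoid_scheme \<Rightarrow> (nat \<Rightarrow> 'p coords) \<Rightarrow> bool" where
  "analytic_inverse G L \<longleftrightarrow> (\<forall>m\<ge>1.
     (\<lambda>x. inv\<^bsub>G\<^esub> x) \<in> cdom (L m) \<rightarrow> cdom (L m) \<and>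
     analytic_in_coords (cdim (L m)) (cmap (L m)) (cdom (L m)) (cdim (L m)) (cmap (L m)) (\<lambda>x. inv\<^bsub>G\<^esub> x))"

definition bundled_Lie_group ::
  "'p topology \<Rightarrow> ('p, 'm) monoid_scheme \<Rightarrow> (nat \<Rightarrow> 'p coords) \<Rightarrow> bool" where
  "bundled_Lie_group X G L \<longleftrightarrow>
     (\<exists>\<C>. bundled_analytic_manifold X \<C> \<and> natural_coords X \<C> L) \<and>
     group G \<and> carrier G = topspace X \<and>
     analytic_product G L \<and> analytic_inverse G L"


section \<open>Leaf coordinates of the general linear group\<close>

text \<open>The real coordinates of an \<open>n \<times> n\<close> matrix are the components of its entries, row by row, with
  respect to the standard basis of the scalars over the reals. The order in which
  \<^const>\<open>from_nat_into\<close> enumerates that basis is immaterial.\<close>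

definition mat_coords :: "nat \<Rightarrow> 'a::euclidean_space mat \<Rightarrow> nat \<Rightarrow> real" where
  "mat_coords n A k = (if k < n * n * DIM('a)
     then A $$ (k div DIM('a) div n, k div DIM('a) mod n) \<bullet> from_nat_into Basis (k mod DIM('a))
     else 0)"

text \<open>A class has at most one representative of each size.\<close>

definition representative :: "nat \<Rightarrow> 'a mat set \<Rightarrow> 'a mat" where
  "representative n X = the_elem (X \<inter> carrier_mat n n)"

definition GL_leaf :: "nat \<Rightarrow> 'a::{real_normed_field, euclidean_space} mat set coords" where
  "GL_leaf n = Coords {X \<in> GL_classes. X \<inter> carrier_mat n n \<noteq> {}} (n * n * DIM('a))
     (\<lambda>X. mat_coords n (representative n X))"

end

theory Submission
  imports Defs "HOL-Number_Theory.Cong" "HOL-Homology.Invariance_of_Domain"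
begin

text \<open>Every class contains a representative of minimal size \<open>n\<close>, and all its representatives are
  Kronecker multiples of it. A sub-basic set coming from \<open>m \<times> m\<close> matrices therefore meets the stratum of
  classes of minimal size \<open>n\<close> only if \<open>n\<close> divides \<open>m\<close>, and then in a Euclidean open set: the general
  linear group is the disjoint union of its strata, which are open and Euclidean of dimension
  proportional to \<open>n\<^sup>2\<close>. Hence the strata form an atlas. By invariance of dimension every simple chart
  meets only strata of its own dimension, so the bundled charts with analytic transitions to the
  strata form a maximal structure, pairwise comparability following from the composition of analytic
  maps. In leaf coordinates the product is polynomial and the inverse is given by Cramer's rule.\<close>

section \<open>Multivariate power series\<close>

text \<open>The topology mixes matrix sizes, and this shapes the charts. For n > 1 the n x n
  matrices whose classes meet a ball of 1 x 1 matrices are scalar, and they form no open set; so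
  leaf coordinates are not homeomorphisms on whole leaves, and matrices of the form
  \<open>B \<otimes>\<^sub>K 1\<^sub>m k\<close> with k > 1 have to be set apart. The minimal
  representative owes its uniqueness to one algebraic fact: scalar blocks of sizes p and q combine
  to scalar blocks of size lcm p q. The definition of analyticity only asks for convergent
  expansions near each point. Substitution calls for a quantitative form, so radius and majorant are
  carried along. The majorant of a function vanishing at the centre becomes arbitrarily small with
  the radius, which drives both composition and reciprocals. Coefficients lie in a Banach space so
  that real and complex entries obey the same rules; the passage to and from real coordinates is
  bounded linear. Product and inverse are treated on whole leaves through an explicit inverse of the
  coordinates, since a whole leaf need not be a chart.\<close>

definition mdegree :: "nat \<Rightarrow> (nat \<Rightarrow> nat) \<Rightarrow> nat" where
  "mdegree p \<alpha> = (\<Sum>i<p. \<alpha> i)"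

definition mpower :: "nat \<Rightarrow> (nat \<Rightarrow> real) \<Rightarrow> (nat \<Rightarrow> nat) \<Rightarrow> real" where
  "mpower p x \<alpha> = (\<Prod>i<p. x i ^ \<alpha> i)"

lemma mpower_const: "mpower p (\<lambda>_. r) \<alpha> = r ^ mdegree p \<alpha>"
  by (simp add: mpower_def mdegree_def power_sum)

lemma mpower_add: "mpower p x (\<lambda>i. \<alpha> i + \<beta> i) = mpower p x \<alpha> * mpower p x \<beta>"
  by (simp add: mpower_def power_add prod.distrib)

lemma mdegree_add: "mdegree p (\<lambda>i. \<alpha> i + \<beta> i) = mdegree p \<alpha> + mdegree p \<beta>"
  by (simp add: mdegree_def sum.distrib)

lemma abs_mpower_le:
  assumes "\<And>i. i < p \<Longrightarrow> \<bar>x i\<bar> \<le> r"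
  shows "\<bar>mpower p x \<alpha>\<bar> \<le> r ^ mdegree p \<alpha>"
proof -
  have "\<bar>mpower p x \<alpha>\<bar> = (\<Prod>i<p. \<bar>x i\<bar> ^ \<alpha> i)"
    by (simp add: mpower_def abs_prod power_abs)
  also have "\<dots> \<le> (\<Prod>i<p. r ^ \<alpha> i)"
    by (intro prod_mono) (auto intro: power_mono assms)
  finally show ?thesis by (simp add: mdegree_def power_sum)
qed

lemma mdegree_eq_0_iff:
  assumes "\<alpha> \<in> multi_indices p"
  shows "mdegree p \<alpha> = 0 \<longleftrightarrow> \<alpha> = (\<lambda>_. 0)"
proof -
  have "mdegree p \<alpha> = 0 \<longleftrightarrow> (\<forall>i<p. \<alpha> i = 0)" by (simp add: mdegree_def) auto
  moreover have "\<forall>i\<ge>p. \<alpha> i = 0" using assms by (simp add: multi_indices_def)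
  ultimately show ?thesis by (metis le_less_linear)
qed

text \<open>\<open>N\<close> bounds the majorant of the power series. Majorants are submultiplicative and countably
  subadditive, which is all that substitution needs.\<close>

definition has_power_series ::
  "nat \<Rightarrow> (nat \<Rightarrow> real) set \<Rightarrow> (nat \<Rightarrow> real) \<Rightarrow> real \<Rightarrow> real \<Rightarrow> ((nat \<Rightarrow> real) \<Rightarrow> 'b::banach) \<Rightarrow> bool" where
  "has_power_series p W a r N f \<longleftrightarrow> (\<exists>c.
     (\<lambda>\<alpha>. norm (c \<alpha>) * r ^ mdegree p \<alpha>) summable_on multi_indices p \<and>
     (\<Sum>\<^sub>\<infinity>\<alpha>\<in>multi_indices p. norm (c \<alpha>) * r ^ mdegree p \<alpha>) \<le> N \<and>
     (\<forall>x\<in>W. (\<forall>i<p. \<bar>x i - a i\<bar> \<le> r) \<longrightarrow>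
        ((\<lambda>\<alpha>. mpower p (\<lambda>i. x i - a i) \<alpha> *\<^sub>R c \<alpha>) has_sum f x) (multi_indices p)))"

lemma has_power_seriesE:
  assumes "has_power_series p W a r N f"
  obtains c where "(\<lambda>\<alpha>. norm (c \<alpha>) * r ^ mdegree p \<alpha>) summable_on multi_indices p"
    "(\<Sum>\<^sub>\<infinity>\<alpha>\<in>multi_indices p. norm (c \<alpha>) * r ^ mdegree p \<alpha>) \<le> N"
    "\<And>x. x \<in> W \<Longrightarrow> (\<And>i. i < p \<Longrightarrow> \<bar>x i - a i\<bar> \<le> r) \<Longrightarrow>
        ((\<lambda>\<alpha>. mpower p (\<lambda>i. x i - a i) \<alpha> *\<^sub>R c \<alpha>) has_sum f x) (multi_indices p)"
  using assms unfolding has_power_series_def by blast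

text \<open>A family of monomials with repeated exponents becomes a power series when its
  coefficients are added over each fibre of \<open>e\<close>. The triangle inequality keeps the
  majorant below \<open>M\<close>, and absolute summability permits the regrouping. The rules for
  constants, coordinates, sums and products all rest on this, each with its own index set.\<close>

lemma has_power_series_regroup:
  fixes k :: "'i \<Rightarrow> 'b::banach"
  assumes r: "0 < r" and e: "e \<in> I \<rightarrow> multi_indices p"
    and sumN: "((\<lambda>i. norm (k i) * r ^ mdegree p (e i)) has_sum M) I" and "M \<le> N"
    and f: "\<And>x. x \<in> W \<Longrightarrow> (\<And>i. i < p \<Longrightarrow> \<bar>x i - a i\<bar> \<le> r) \<Longrightarrow>
        ((\<lambda>i. mpower p (\<lambda>i. x i - a i) (e i) *\<^sub>R k i) has_sum f x) I"
  shows "has_power_series p W a r N f"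
proof -
  define F where "F \<gamma> = {i \<in> I. e i = \<gamma>}" for \<gamma>
  define S where "S = Sigma (multi_indices p) F"
  \<comment> \<open>The fibres over multi-indices partition \<open>I\<close>, so a sum over
    \<open>I\<close> is an iterated sum.\<close>
  have bij: "bij_betw snd S I"
    using e by (auto simp: S_def F_def bij_betw_def inj_on_def image_iff)
  have eS: "e (snd z) = fst z" if "z \<in> S" for z using that by (auto simp: S_def F_def)
  define c where "c \<gamma> = infsum k (F \<gamma>)" for \<gamma>
  have knorm: "(\<lambda>i. norm (k i)) summable_on F \<gamma>" for \<gamma>
  proof -
    have "(\<lambda>i. norm (k i) * r ^ mdegree p (e i)) summable_on F \<gamma>"
      by (rule summable_on_subset[OF has_sum_imp_summable[OF sumN]]) (auto simp: F_def)
    then have "(\<lambda>i. norm (k i) * r ^ mdegree p \<gamma>) summable_on F \<gamma>"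
      by (rule summable_on_cong[THEN iffD1, rotated]) (auto simp: F_def)
    \<comment> \<open>On one fibre the factor \<open>r ^ mdegree p \<gamma>\<close> is constant and,
      as \<open>r > 0\<close>, can be divided out.\<close>
    from summable_on_cmult_left[OF this, of "inverse (r ^ mdegree p \<gamma>)"]
    show ?thesis using r by (simp add: field_simps)
  qed
  then have kF: "(k has_sum c \<gamma>) (F \<gamma>)" for \<gamma>
    unfolding c_def using abs_summable_summable by (intro has_sum_infsum) blast
  have s1: "((\<lambda>z. norm (k (snd z)) * r ^ mdegree p (fst z)) has_sum M) S"
    using sumN unfolding has_sum_reindex_bij_betw[OF bij, symmetric]
    by (rule has_sum_cong[THEN iffD1, rotated]) (simp add: eS)
  have s2: "((\<lambda>\<gamma>. infsum (\<lambda>i. norm (k i)) (F \<gamma>) * r ^ mdegree p \<gamma>) has_sum M) (multi_indices p)"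
    by (rule has_sum_SigmaD[OF s1[unfolded S_def]]) (auto intro!: has_sum_cmult_left has_sum_infsum knorm)
  have le: "norm (c \<gamma>) * r ^ mdegree p \<gamma> \<le> infsum (\<lambda>i. norm (k i)) (F \<gamma>) * r ^ mdegree p \<gamma>" for \<gamma>
    unfolding c_def by (intro mult_right_mono norm_infsum_bound knorm) (use r in auto)
  have sc: "(\<lambda>\<gamma>. norm (c \<gamma>) * r ^ mdegree p \<gamma>) summable_on multi_indices p"
    by (rule summable_on_comparison_test[OF has_sum_imp_summable[OF s2] le]) (use r in auto)
  have "(\<Sum>\<^sub>\<infinity>\<gamma>\<in>multi_indices p. norm (c \<gamma>) * r ^ mdegree p \<gamma>) \<le> M"
    by (rule has_sum_mono[OF has_sum_infsum[OF sc] s2 le])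
  moreover have "((\<lambda>\<alpha>. mpower p (\<lambda>i. x i - a i) \<alpha> *\<^sub>R c \<alpha>) has_sum f x) (multi_indices p)"
    if x: "x \<in> W" "\<And>i. i < p \<Longrightarrow> \<bar>x i - a i\<bar> \<le> r" for x
  proof -
    have "((\<lambda>z. mpower p (\<lambda>i. x i - a i) (fst z) *\<^sub>R k (snd z)) has_sum f x) S"
      using f[OF x(1), OF x(2)] unfolding has_sum_reindex_bij_betw[OF bij, symmetric]
      by (rule has_sum_cong[THEN iffD1, rotated]) (auto simp: eS)
    then show ?thesis unfolding S_def
      by (rule has_sum_SigmaD) (auto intro!: has_sum_scaleR kF)
  qed
  ultimately show ?thesis using sc \<open>M \<le> N\<close> unfolding has_power_series_def by (intro exI[of _ c]) auto
qed

text \<open>The monomials of all \<open>f j\<close> together form one family over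
  \<open>J \<times> multi_indices p\<close>, absolutely summable because the majorants are. Infinite
  \<open>J\<close> is what geometric series and substitution call for.\<close>

lemma has_power_series_sum:
  assumes r: "0 < r" and hps: "\<And>j. j \<in> J \<Longrightarrow> has_power_series p W a r (N j) (f j)"
    and N: "(N has_sum M) J"
    and g: "\<And>x. x \<in> W \<Longrightarrow> (\<And>i. i < p \<Longrightarrow> \<bar>x i - a i\<bar> \<le> r) \<Longrightarrow> ((\<lambda>j. f j x) has_sum g x) J"
  shows "has_power_series p W a r M g"
proof -
  let ?I = "multi_indices p"
  have "\<forall>j. \<exists>c. j \<in> J \<longrightarrow> (\<lambda>\<alpha>. norm (c \<alpha>) * r ^ mdegree p \<alpha>) summable_on ?I \<and>
      (\<Sum>\<^sub>\<infinity>\<alpha>\<in>?I. norm (c \<alpha>) * r ^ mdegree p \<alpha>) \<le> N j \<and>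
      (\<forall>x\<in>W. (\<forall>i<p. \<bar>x i - a i\<bar> \<le> r) \<longrightarrow>
        ((\<lambda>\<alpha>. mpower p (\<lambda>i. x i - a i) \<alpha> *\<^sub>R c \<alpha>) has_sum f j x) ?I)"
    using hps unfolding has_power_series_def by blast
  then obtain c where "\<forall>j. j \<in> J \<longrightarrow> (\<lambda>\<alpha>. norm (c j \<alpha>) * r ^ mdegree p \<alpha>) summable_on ?I \<and>
      (\<Sum>\<^sub>\<infinity>\<alpha>\<in>?I. norm (c j \<alpha>) * r ^ mdegree p \<alpha>) \<le> N j \<and>
      (\<forall>x\<in>W. (\<forall>i<p. \<bar>x i - a i\<bar> \<le> r) \<longrightarrow>
        ((\<lambda>\<alpha>. mpower p (\<lambda>i. x i - a i) \<alpha> *\<^sub>R c j \<alpha>) has_sum f j x) ?I)"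
    by (rule choice[THEN exE])
  then have c1: "\<And>j. j \<in> J \<Longrightarrow> (\<lambda>\<alpha>. norm (c j \<alpha>) * r ^ mdegree p \<alpha>) summable_on ?I"
    and c2: "\<And>j. j \<in> J \<Longrightarrow> (\<Sum>\<^sub>\<infinity>\<alpha>\<in>?I. norm (c j \<alpha>) * r ^ mdegree p \<alpha>) \<le> N j"
    and c3: "\<And>j x. j \<in> J \<Longrightarrow> x \<in> W \<Longrightarrow> (\<And>i. i < p \<Longrightarrow> \<bar>x i - a i\<bar> \<le> r) \<Longrightarrow>
        ((\<lambda>\<alpha>. mpower p (\<lambda>i. x i - a i) \<alpha> *\<^sub>R c j \<alpha>) has_sum f j x) ?I"
    by blast+
  have gs: "(\<lambda>j. \<Sum>\<^sub>\<infinity>\<alpha>\<in>?I. norm (c j \<alpha>) * r ^ mdegree p \<alpha>) summable_on J"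
    by (rule summable_on_comparison_test[OF has_sum_imp_summable[OF N] c2])
       (use r in \<open>auto intro!: infsum_nonneg\<close>)
  have S: "(\<lambda>z. norm (c (fst z) (snd z)) * r ^ mdegree p (snd z)) summable_on (J \<times> ?I)"
    by (rule summable_on_SigmaI[OF _ gs]) (use r in \<open>auto intro!: has_sum_infsum c1\<close>)
  have le: "(\<Sum>\<^sub>\<infinity>z\<in>J \<times> ?I. norm (c (fst z) (snd z)) * r ^ mdegree p (snd z)) \<le> M"
  proof (rule has_sum_mono[OF _ N c2])
    show "((\<lambda>j. \<Sum>\<^sub>\<infinity>\<alpha>\<in>?I. norm (c j \<alpha>) * r ^ mdegree p \<alpha>) has_sum
        (\<Sum>\<^sub>\<infinity>z\<in>J \<times> ?I. norm (c (fst z) (snd z)) * r ^ mdegree p (snd z))) J"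
      by (rule has_sum_SigmaD[OF has_sum_infsum[OF S]]) (auto intro!: has_sum_infsum c1)
  qed
  show ?thesis
  proof (rule has_power_series_regroup[OF r _ has_sum_infsum[OF S] le])
    show "snd \<in> J \<times> ?I \<rightarrow> ?I" by auto
    fix x assume x: "x \<in> W" "\<And>i. i < p \<Longrightarrow> \<bar>x i - a i\<bar> \<le> r"
    have "(\<lambda>z. mpower p (\<lambda>i. x i - a i) (snd z) *\<^sub>R c (fst z) (snd z)) summable_on (J \<times> ?I)"
      by (rule abs_summable_summable, rule Infinite_Sum.abs_summable_on_comparison_test'[OF S])
         (auto intro!: mult_left_mono abs_mpower_le x simp: mult.commute)
    then show "((\<lambda>z. mpower p (\<lambda>i. x i - a i) (snd z) *\<^sub>R c (fst z) (snd z)) has_sum g x) (J \<times> ?I)"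
      by (intro has_sum_SigmaI[OF _ g[OF x(1), OF x(2)]]) (auto intro!: c3 x)
  qed
qed

lemma has_power_series_const:
  assumes "0 < r" shows "has_power_series p W a r (norm k) (\<lambda>_. k)"
proof (rule has_power_series_regroup[OF assms, of "\<lambda>_ _. 0" "{()}" _ "\<lambda>_. k"])
  show "((\<lambda>i. norm k * r ^ mdegree p (\<lambda>_. 0)) has_sum norm k) {()}"
    by (rule has_sum_finiteI) (auto simp: mdegree_def)
qed (auto simp: multi_indices_def mpower_def intro!: has_sum_finiteI)

lemma has_power_series_coordinate:
  assumes "0 < r" "j < p" shows "has_power_series p W a r r (\<lambda>x. x j - a j)"
proof -
  let ?\<delta> = "\<lambda>i. if i = j then 1 else 0 :: nat"
  have "mdegree p ?\<delta> = 1" using assms by (simp add: mdegree_def)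
  moreover have "mpower p x ?\<delta> = x j" for x
  proof -
    have "mpower p x ?\<delta> = (\<Prod>i<p. if i = j then x i else 1)"
      unfolding mpower_def by (intro prod.cong) auto
    then show ?thesis using assms by simp
  qed
  ultimately show ?thesis
    using assms
    by (intro has_power_series_regroup[of _ "\<lambda>_. ?\<delta>" "{()}" _ "\<lambda>_. 1" r])
       (auto simp: multi_indices_def intro!: has_sum_finiteI)
qed

lemma has_power_series_majorant_nonneg:
  fixes f :: "_ \<Rightarrow> 'b::banach"
  assumes "has_power_series p W a r N f" "0 < r" shows "0 \<le> N"
proof -
  obtain c :: "_ \<Rightarrow> 'b" where "(\<Sum>\<^sub>\<infinity>\<alpha>\<in>multi_indices p. norm (c \<alpha>) * r ^ mdegree p \<alpha>) \<le> N"
    using has_power_seriesE[OF assms(1)] by metis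
  moreover have "0 \<le> (\<Sum>\<^sub>\<infinity>\<alpha>\<in>multi_indices p. norm (c \<alpha>) * r ^ mdegree p \<alpha>)"
    using assms(2) by (intro infsum_nonneg) auto
  ultimately show ?thesis by linarith
qed

text \<open>A Cauchy product in two stages: multiplying \<open>g\<close> by a single term of
  \<open>f\<close> shifts the exponents and scales the majorant, and the results are then summed
  over the terms of \<open>f\<close>.\<close>

lemma has_power_series_mult:
  fixes f g :: "_ \<Rightarrow> 'b::{banach, real_normed_algebra}"
  assumes r: "0 < r" and f: "has_power_series p W a r M f" and g: "has_power_series p W a r N g"
  shows "has_power_series p W a r (M * N) (\<lambda>x. f x * g x)"
proof -
  let ?I = "multi_indices p"
  obtain c where c: "(\<lambda>\<alpha>. norm (c \<alpha>) * r ^ mdegree p \<alpha>) summable_on ?I"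
    "(\<Sum>\<^sub>\<infinity>\<alpha>\<in>?I. norm (c \<alpha>) * r ^ mdegree p \<alpha>) \<le> M"
    "\<And>x. x \<in> W \<Longrightarrow> (\<And>i. i < p \<Longrightarrow> \<bar>x i - a i\<bar> \<le> r) \<Longrightarrow>
        ((\<lambda>\<alpha>. mpower p (\<lambda>i. x i - a i) \<alpha> *\<^sub>R c \<alpha>) has_sum f x) ?I"
    using has_power_seriesE[OF f] by blast
  obtain d where d: "(\<lambda>\<alpha>. norm (d \<alpha>) * r ^ mdegree p \<alpha>) summable_on ?I"
    "(\<Sum>\<^sub>\<infinity>\<alpha>\<in>?I. norm (d \<alpha>) * r ^ mdegree p \<alpha>) \<le> N"
    "\<And>x. x \<in> W \<Longrightarrow> (\<And>i. i < p \<Longrightarrow> \<bar>x i - a i\<bar> \<le> r) \<Longrightarrow>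
        ((\<lambda>\<alpha>. mpower p (\<lambda>i. x i - a i) \<alpha> *\<^sub>R d \<alpha>) has_sum g x) ?I"
    using has_power_seriesE[OF g] by blast
  let ?M = "\<Sum>\<^sub>\<infinity>\<alpha>\<in>?I. norm (c \<alpha>) * r ^ mdegree p \<alpha>"
  have N0: "0 \<le> N" using has_power_series_majorant_nonneg[OF g r] .
  have mono: "has_power_series p W a r (norm (c \<alpha>) * r ^ mdegree p \<alpha> * N)
      (\<lambda>x. mpower p (\<lambda>i. x i - a i) \<alpha> *\<^sub>R c \<alpha> * g x)" if \<alpha>: "\<alpha> \<in> ?I" for \<alpha>
  proof -
    let ?h = "\<lambda>\<beta>. norm (c \<alpha> * d \<beta>) * r ^ mdegree p (\<lambda>i. \<alpha> i + \<beta> i)"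
    let ?q = "\<lambda>\<beta>. norm (c \<alpha>) * r ^ mdegree p \<alpha> * (norm (d \<beta>) * r ^ mdegree p \<beta>)"
    have le: "?h \<beta> \<le> ?q \<beta>" for \<beta>
      using mult_right_mono[OF norm_mult_ineq[of "c \<alpha>" "d \<beta>"], of "r ^ mdegree p \<alpha> * r ^ mdegree p \<beta>"] r
      by (simp add: mdegree_add power_add mult_ac)
    have q: "(?q has_sum norm (c \<alpha>) * r ^ mdegree p \<alpha> * (\<Sum>\<^sub>\<infinity>\<alpha>\<in>?I. norm (d \<alpha>) * r ^ mdegree p \<alpha>)) ?I"
      by (intro has_sum_cmult_right has_sum_infsum d)
    have h: "?h summable_on ?I"
      by (rule summable_on_comparison_test[OF has_sum_imp_summable[OF q] le]) (use r in auto)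
    show ?thesis
    proof (rule has_power_series_regroup[OF r _ has_sum_infsum[OF h]])
      show "(\<lambda>\<beta> i. \<alpha> i + \<beta> i) \<in> ?I \<rightarrow> ?I" using \<alpha> by (auto simp: multi_indices_def)
      have "infsum ?h ?I \<le> norm (c \<alpha>) * r ^ mdegree p \<alpha> * (\<Sum>\<^sub>\<infinity>\<alpha>\<in>?I. norm (d \<alpha>) * r ^ mdegree p \<alpha>)"
        by (rule has_sum_mono[OF has_sum_infsum[OF h] q le])
      also have "\<dots> \<le> norm (c \<alpha>) * r ^ mdegree p \<alpha> * N"
        by (intro mult_left_mono d) (use r in auto)
      finally show "infsum ?h ?I \<le> norm (c \<alpha>) * r ^ mdegree p \<alpha> * N" .
      fix x assume x: "x \<in> W" "\<And>i. i < p \<Longrightarrow> \<bar>x i - a i\<bar> \<le> r"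
      have "((\<lambda>\<beta>. mpower p (\<lambda>i. x i - a i) \<alpha> *\<^sub>R c \<alpha> * (mpower p (\<lambda>i. x i - a i) \<beta> *\<^sub>R d \<beta>))
          has_sum mpower p (\<lambda>i. x i - a i) \<alpha> *\<^sub>R c \<alpha> * g x) ?I"
        by (intro has_sum_cmult_right d x)
      then show "((\<lambda>\<beta>. mpower p (\<lambda>i. x i - a i) (\<lambda>i. \<alpha> i + \<beta> i) *\<^sub>R (c \<alpha> * d \<beta>))
          has_sum mpower p (\<lambda>i. x i - a i) \<alpha> *\<^sub>R c \<alpha> * g x) ?I"
        by (simp add: mpower_add mult_ac)
    qed
  qed
  have "has_power_series p W a r (?M * N) (\<lambda>x. f x * g x)"
    by (rule has_power_series_sum[OF r mono])
      (assumption | rule has_sum_cmult_left[OF has_sum_infsum[OF c(1)]] has_sum_cmult_left[OF c(3)] | blast)+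
  \<comment> \<open>\<open>?M\<close> is the exact majorant of the chosen expansion of
    \<open>f\<close>; replacing it by the bound \<open>M\<close> uses that \<open>N\<close> is
    nonnegative.\<close>
  moreover have "?M * N \<le> M * N" using c(2) N0 by (rule mult_right_mono)
  ultimately show ?thesis unfolding has_power_series_def by (meson order_trans)
qed

lemma has_power_series_add:
  assumes r: "0 < r" and "has_power_series p W a r M f" "has_power_series p W a r N g"
  shows "has_power_series p W a r (M + N) (\<lambda>x. f x + g x)"
  \<comment> \<open>A binary sum is a sum over the two elements of \<open>bool\<close>.\<close>
  by (rule has_power_series_sum[OF r, of "UNIV::bool set" _ _ _ "\<lambda>b. if b then M else N" "\<lambda>b. if b then f else g"])
     (use assms in \<open>auto intro!: has_sum_finiteI simp: UNIV_bool\<close>)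

lemma has_power_series_shrink:
  assumes "has_power_series p W a r N f" "0 < r'" "r' \<le> r"
  shows "has_power_series p W a r' N f"
proof -
  let ?I = "multi_indices p"
  obtain c where c: "(\<lambda>\<alpha>. norm (c \<alpha>) * r ^ mdegree p \<alpha>) summable_on ?I"
    "(\<Sum>\<^sub>\<infinity>\<alpha>\<in>?I. norm (c \<alpha>) * r ^ mdegree p \<alpha>) \<le> N"
    "\<And>x. x \<in> W \<Longrightarrow> (\<And>i. i < p \<Longrightarrow> \<bar>x i - a i\<bar> \<le> r) \<Longrightarrow>
        ((\<lambda>\<alpha>. mpower p (\<lambda>i. x i - a i) \<alpha> *\<^sub>R c \<alpha>) has_sum f x) ?I"
    using has_power_seriesE[OF assms(1)] by blast
  have le: "norm (c \<alpha>) * r' ^ mdegree p \<alpha> \<le> norm (c \<alpha>) * r ^ mdegree p \<alpha>" for \<alpha>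
    by (intro mult_left_mono power_mono) (use assms in auto)
  have s: "(\<lambda>\<alpha>. norm (c \<alpha>) * r' ^ mdegree p \<alpha>) summable_on ?I"
    by (rule summable_on_comparison_test[OF c(1) le]) (use assms in auto)
  show ?thesis unfolding has_power_series_def
    using s c(2,3) infsum_mono[OF s c(1) le] assms(3) by (intro exI[of _ c]) force
qed

text \<open>Without a constant term every monomial contains at least one factor of the radius, so
  shrinking \<open>r\<close> to \<open>r'\<close> multiplies the majorant by at most
  \<open>r' / r\<close>. This makes the majorant as small as reciprocals and substitution
  demand.\<close>

lemma has_power_series_vanishing:
  assumes f: "has_power_series p W a r N f" and r: "0 < r" and a: "a \<in> W" "f a = 0" and "0 < \<epsilon>"
  obtains r' where "0 < r'" "r' \<le> r" "has_power_series p W a r' \<epsilon> f"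
proof -
  let ?I = "multi_indices p"
  obtain c where c: "(\<lambda>\<alpha>. norm (c \<alpha>) * r ^ mdegree p \<alpha>) summable_on ?I"
    "(\<Sum>\<^sub>\<infinity>\<alpha>\<in>?I. norm (c \<alpha>) * r ^ mdegree p \<alpha>) \<le> N"
    "\<And>x. x \<in> W \<Longrightarrow> (\<And>i. i < p \<Longrightarrow> \<bar>x i - a i\<bar> \<le> r) \<Longrightarrow>
        ((\<lambda>\<alpha>. mpower p (\<lambda>i. x i - a i) \<alpha> *\<^sub>R c \<alpha>) has_sum f x) ?I"
    using has_power_seriesE[OF f] by blast
  have z: "(\<lambda>_. 0) \<in> ?I" by (simp add: multi_indices_def)
  have mp: "mpower p (\<lambda>i. 0) \<alpha> = 0" if "\<alpha> \<in> ?I" "\<alpha> \<noteq> (\<lambda>_. 0)" for \<alpha>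
    using that mdegree_eq_0_iff[of \<alpha> p] by (simp add: mpower_const)
  \<comment> \<open>At the centre only the constant term survives; \<open>a \<in> W\<close>
    guarantees that the expansion holds there.\<close>
  have "((\<lambda>\<alpha>. mpower p (\<lambda>i. 0) \<alpha> *\<^sub>R c \<alpha>) has_sum f a) ?I" using c(3)[of a] a r by simp
  moreover have "((\<lambda>\<alpha>. mpower p (\<lambda>i. 0) \<alpha> *\<^sub>R c \<alpha>) has_sum c (\<lambda>_. 0)) ?I"
    by (rule has_sum_finite_neutralI[of "{\<lambda>_. 0}"]) (use z mp in \<open>auto simp: mpower_def\<close>)
  ultimately have c0: "c (\<lambda>_. 0) = 0" using a has_sum_unique by metis
  \<comment> \<open>Chosen so that \<open>r' / r * N \<le> \<epsilon>\<close>; the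
    \<open>+ 1\<close> keeps the denominator positive when \<open>N = 0\<close>.\<close>
  define r' where "r' = min r (r * \<epsilon> / (N + 1))"
  have N: "0 \<le> N" using has_power_series_majorant_nonneg[OF f r] .
  have r': "0 < r'" "r' \<le> r" using r N \<open>0 < \<epsilon>\<close> by (auto simp: r'_def)
  have le: "norm (c \<alpha>) * r' ^ mdegree p \<alpha> \<le> r' / r * (norm (c \<alpha>) * r ^ mdegree p \<alpha>)" if "\<alpha> \<in> ?I" for \<alpha>
  proof (cases "mdegree p \<alpha>")
    case 0 then show ?thesis using mdegree_eq_0_iff[OF that] c0 by simp
  next
    case (Suc n)
    have "r' * (norm (c \<alpha>) * r' ^ n) \<le> r' * (norm (c \<alpha>) * r ^ n)"
      by (intro mult_left_mono power_mono) (use r' in auto)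
    then show ?thesis using r unfolding Suc by (simp add: mult_ac)
  qed
  have s0: "((\<lambda>\<alpha>. r' / r * (norm (c \<alpha>) * r ^ mdegree p \<alpha>)) has_sum
      r' / r * (\<Sum>\<^sub>\<infinity>\<alpha>\<in>?I. norm (c \<alpha>) * r ^ mdegree p \<alpha>)) ?I"
    by (intro has_sum_cmult_right has_sum_infsum c)
  have s: "(\<lambda>\<alpha>. norm (c \<alpha>) * r' ^ mdegree p \<alpha>) summable_on ?I"
    by (rule summable_on_comparison_test[OF has_sum_imp_summable[OF s0] le]) (use r' in auto)
  have "(\<Sum>\<^sub>\<infinity>\<alpha>\<in>?I. norm (c \<alpha>) * r' ^ mdegree p \<alpha>) \<le> r' / r * (\<Sum>\<^sub>\<infinity>\<alpha>\<in>?I. norm (c \<alpha>) * r ^ mdegree p \<alpha>)"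
    by (rule has_sum_mono[OF has_sum_infsum[OF s] s0 le])
  also have "\<dots> \<le> r' / r * N" using c(2) r r' by (intro mult_left_mono) auto
  also have "\<dots> \<le> \<epsilon>"
  proof -
    have "r' * (N + 1) \<le> r * \<epsilon>" using N r \<open>0 < \<epsilon>\<close>
      by (simp add: r'_def pos_le_divide_eq[symmetric])
    then have "r' * N \<le> r * \<epsilon>" using r' by (simp add: algebra_simps)
    then show ?thesis using r by (simp add: field_simps)
  qed
  finally have "has_power_series p W a r' \<epsilon> f"
    unfolding has_power_series_def using s c(3) r'(2) by (intro exI[of _ c]) force
  with r' show ?thesis using that by blast
qed

section \<open>Box neighbourhoods in Euclidean spaces of sequences\<close>

lemma openin_Euclidean_space_iff:
  "openin (Euclidean_space p) W \<longleftrightarrow> (\<exists>T. open T \<and> W = T \<inter> topspace (Euclidean_space p))"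
  by (simp add: Euclidean_space_def openin_subtopology euclidean_product_topology)

text \<open>A basic open set of the product topology restricts only finitely many coordinates, so
  one width serves for all of them.\<close>

lemma open_contains_box:
  fixes T :: "('i \<Rightarrow> real) set"
  assumes "open T" "a \<in> T"
  obtains r where "0 < r" "\<And>x. (\<And>i. \<bar>x i - a i\<bar> < r) \<Longrightarrow> x \<in> T"
proof -
  have "openin (powertop_real UNIV) T" using assms by (simp add: euclidean_product_topology)
  then obtain X where X: "a \<in> (\<Pi>\<^sub>E i\<in>UNIV. X i)" "\<And>i. open (X i)" "finite {i. X i \<noteq> UNIV}"
    "(\<Pi>\<^sub>E i\<in>UNIV. X i) \<subseteq> T"
    using product_topology_open_contains_basis[of "\<lambda>_. euclideanreal" UNIV T a] assms(2) by auto
  have "\<exists>e>0. \<forall>y. \<bar>y - a i\<bar> < e \<longrightarrow> y \<in> X i" for i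
    using X(1) X(2)[of i, unfolded open_dist] by (auto simp: PiE_iff dist_real_def)
  then obtain e where e: "\<And>i. e i > 0" "\<And>i y. \<bar>y - a i\<bar> < e i \<Longrightarrow> y \<in> X i" by metis
  \<comment> \<open>\<open>insert 1\<close> keeps the minimum defined when no coordinate is
    restricted.\<close>
  define r where "r = Min (insert 1 (e ` {i. X i \<noteq> UNIV}))"
  have "0 < r" using X(3) e(1) by (simp add: r_def)
  moreover have "x \<in> T" if x: "\<And>i. \<bar>x i - a i\<bar> < r" for x
  proof -
    have "x i \<in> X i" for i
    proof (cases "X i = UNIV")
      case False
      then have "r \<le> e i" using X(3) by (simp add: r_def)
      then show ?thesis using e(2) x[of i] by (meson less_le_trans)
    qed auto
    then show ?thesis using X(4) by (auto simp: PiE_iff)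
  qed
  ultimately show ?thesis using that by blast
qed

text \<open>Both points vanish from index \<open>p\<close> on, so bounds on the first
  \<open>p\<close> differences control all of them.\<close>

lemma openin_Euclidean_space_contains_box:
  assumes "openin (Euclidean_space p) W" "a \<in> W"
  obtains r where "0 < r"
    "\<And>x. x \<in> topspace (Euclidean_space p) \<Longrightarrow> (\<And>i. i < p \<Longrightarrow> \<bar>x i - a i\<bar> < r) \<Longrightarrow> x \<in> W"
proof -
  obtain T where T: "open T" "W = T \<inter> topspace (Euclidean_space p)"
    using assms(1) openin_Euclidean_space_iff by blast
  obtain r where r: "0 < r" "\<And>x. (\<And>i. \<bar>x i - a i\<bar> < r) \<Longrightarrow> x \<in> T"
    using open_contains_box[OF T(1), of a] T(2) assms(2) by blast
  show ?thesis
  proof (rule that[OF r(1)])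
    fix x assume x: "x \<in> topspace (Euclidean_space p)" "\<And>i. i < p \<Longrightarrow> \<bar>x i - a i\<bar> < r"
    have "\<bar>x i - a i\<bar> < r" for i
      using x assms(2) r(1) T(2) by (cases "i < p") (auto simp: topspace_Euclidean_space)
    then show "x \<in> W" using r(2) x(1) T(2) by blast
  qed
qed

text \<open>On the closed box every monomial is at most \<open>r ^ mdegree p \<alpha>\<close>. The
  bound keeps an inner function within the box of an outer series, and the ratio of a geometric
  series below one.\<close>

lemma has_power_series_norm_le:
  fixes f :: "_ \<Rightarrow> 'b::banach"
  assumes f: "has_power_series p W a r N f" and "x \<in> W" "\<And>i. i < p \<Longrightarrow> \<bar>x i - a i\<bar> \<le> r"
  shows "norm (f x) \<le> N"
proof -
  let ?I = "multi_indices p"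
  obtain c where c: "(\<lambda>\<alpha>. norm (c \<alpha>) * r ^ mdegree p \<alpha>) summable_on ?I"
    "(\<Sum>\<^sub>\<infinity>\<alpha>\<in>?I. norm (c \<alpha>) * r ^ mdegree p \<alpha>) \<le> N"
    "\<And>x. x \<in> W \<Longrightarrow> (\<And>i. i < p \<Longrightarrow> \<bar>x i - a i\<bar> \<le> r) \<Longrightarrow>
        ((\<lambda>\<alpha>. mpower p (\<lambda>i. x i - a i) \<alpha> *\<^sub>R c \<alpha>) has_sum f x) ?I"
    using has_power_seriesE[OF f] by blast
  have le: "norm (mpower p (\<lambda>i. x i - a i) \<alpha> *\<^sub>R c \<alpha>) \<le> norm (c \<alpha>) * r ^ mdegree p \<alpha>" for \<alpha>
    using assms(3) by (auto intro!: mult_left_mono abs_mpower_le simp: mult.commute)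
  have s: "(\<lambda>\<alpha>. norm (mpower p (\<lambda>i. x i - a i) \<alpha> *\<^sub>R c \<alpha>)) summable_on ?I"
    by (rule summable_on_comparison_test[OF c(1) le]) simp
  have "norm (f x) = norm (\<Sum>\<^sub>\<infinity>\<alpha>\<in>?I. mpower p (\<lambda>i. x i - a i) \<alpha> *\<^sub>R c \<alpha>)"
    using infsumI[OF c(3)[OF assms(2), OF assms(3)]] by simp
  also have "\<dots> \<le> (\<Sum>\<^sub>\<infinity>\<alpha>\<in>?I. norm (mpower p (\<lambda>i. x i - a i) \<alpha> *\<^sub>R c \<alpha>))"
    by (rule norm_infsum_bound[OF s])
  also have "\<dots> \<le> (\<Sum>\<^sub>\<infinity>\<alpha>\<in>?I. norm (c \<alpha>) * r ^ mdegree p \<alpha>)"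
    by (rule infsum_mono[OF s c(1) le])
  finally show ?thesis using c(2) by linarith
qed

text \<open>The map is applied to the coefficients. This serves to pass between field entries and
  their real components.\<close>

lemma has_power_series_bounded_linear:
  assumes f: "has_power_series p W a r N f" and h: "bounded_linear h" and r: "0 < r"
  shows "\<exists>M. has_power_series p W a r M (\<lambda>x. h (f x))"
proof -
  let ?I = "multi_indices p"
  interpret h: bounded_linear h by fact
  obtain c where c: "(\<lambda>\<alpha>. norm (c \<alpha>) * r ^ mdegree p \<alpha>) summable_on ?I"
    "\<And>x. x \<in> W \<Longrightarrow> (\<And>i. i < p \<Longrightarrow> \<bar>x i - a i\<bar> \<le> r) \<Longrightarrow>
        ((\<lambda>\<alpha>. mpower p (\<lambda>i. x i - a i) \<alpha> *\<^sub>R c \<alpha>) has_sum f x) ?I"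
    using has_power_seriesE[OF f] by blast
  obtain K where K: "\<And>x. norm (h x) \<le> norm x * K" using h.bounded by blast
  have "(\<lambda>\<alpha>. norm (h (c \<alpha>)) * r ^ mdegree p \<alpha>) summable_on ?I"
  proof (rule summable_on_comparison_test[OF summable_on_cmult_left[OF c(1), of K]])
    show "norm (h (c \<alpha>)) * r ^ mdegree p \<alpha> \<le> norm (c \<alpha>) * r ^ mdegree p \<alpha> * K" for \<alpha>
      using mult_right_mono[OF K[of "c \<alpha>"], of "r ^ mdegree p \<alpha>"] r by (simp add: mult_ac)
  qed (use r in auto)
  moreover have "((\<lambda>\<alpha>. mpower p (\<lambda>i. x i - a i) \<alpha> *\<^sub>R h (c \<alpha>)) has_sum h (f x)) ?I"
    if "x \<in> W" "\<forall>i<p. \<bar>x i - a i\<bar> \<le> r" for x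
    using has_sum_bounded_linear[OF h c(2)[of x]] that by (simp add: h.scaleR)
  ultimately show ?thesis unfolding has_power_series_def
    by (intro exI[of _ "\<Sum>\<^sub>\<infinity>\<alpha>\<in>?I. norm (h (c \<alpha>)) * r ^ mdegree p \<alpha>"] exI[of _ "\<lambda>\<alpha>. h (c \<alpha>)"]) blast
qed

text \<open>Radius and majorant are hidden so that the closure rules compose freely. Neither
  openness of \<open>W\<close> nor \<open>a \<in> W\<close> is built in.\<close>

definition power_series_at ::
  "nat \<Rightarrow> (nat \<Rightarrow> real) set \<Rightarrow> (nat \<Rightarrow> real) \<Rightarrow> ((nat \<Rightarrow> real) \<Rightarrow> 'b::banach) \<Rightarrow> bool" where
  "power_series_at p W a f \<longleftrightarrow> (\<exists>r>0. \<exists>N. has_power_series p W a r N f)"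

lemma power_series_at_bounded_linear:
  "power_series_at p W a f \<Longrightarrow> bounded_linear h \<Longrightarrow> power_series_at p W a (\<lambda>x. h (f x))"
  unfolding power_series_at_def using has_power_series_bounded_linear by metis

lemma power_series_at_const: "power_series_at p W a (\<lambda>_. k)"
  unfolding power_series_at_def
  by (intro exI[of _ 1] exI[of _ "norm k"] conjI has_power_series_const) simp_all

lemma power_series_at_add:
  assumes "power_series_at p W a f" "power_series_at p W a g"
  shows "power_series_at p W a (\<lambda>x. f x + g x)"
proof -
  obtain r M s N where h: "0 < r" "has_power_series p W a r M f" "0 < s" "has_power_series p W a s N g"
    using assms unfolding power_series_at_def by blast
  have "has_power_series p W a (min r s) (M + N) (\<lambda>x. f x + g x)"
    by (intro has_power_series_add has_power_series_shrink[OF h(2)] has_power_series_shrink[OF h(4)])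
       (use h in auto)
  then show ?thesis unfolding power_series_at_def using h by (metis min_less_iff_conj)
qed

lemma power_series_at_mult:
  fixes f g :: "_ \<Rightarrow> 'b::{banach, real_normed_algebra}"
  assumes "power_series_at p W a f" "power_series_at p W a g"
  shows "power_series_at p W a (\<lambda>x. f x * g x)"
proof -
  obtain r M s N where h: "0 < r" "has_power_series p W a r M f" "0 < s" "has_power_series p W a s N g"
    using assms unfolding power_series_at_def by blast
  have "has_power_series p W a (min r s) (M * N) (\<lambda>x. f x * g x)"
    by (intro has_power_series_mult has_power_series_shrink[OF h(2)] has_power_series_shrink[OF h(4)])
       (use h in auto)
  then show ?thesis unfolding power_series_at_def using h by (metis min_less_iff_conj)
qed

lemma power_series_at_coordinate:
  assumes "i < p" shows "power_series_at p W a (\<lambda>x. x i)"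
proof -
  have "power_series_at p W a (\<lambda>x. (x i - a i) + a i)"
    by (intro power_series_at_add power_series_at_const, unfold power_series_at_def)
       (intro exI[of _ 1] conjI has_power_series_coordinate assms; simp)
  then show ?thesis by simp
qed

lemma power_series_at_sum:
  "(\<And>j. j \<in> J \<Longrightarrow> power_series_at p W a (f j)) \<Longrightarrow> power_series_at p W a (\<lambda>x. \<Sum>j\<in>J. f j x)"
  by (induction J rule: infinite_finite_induct) (simp_all add: power_series_at_const power_series_at_add)

lemma power_series_at_prod:
  fixes f :: "'j \<Rightarrow> _ \<Rightarrow> 'b::{banach, real_normed_field}"
  shows "(\<And>j. j \<in> J \<Longrightarrow> power_series_at p W a (f j)) \<Longrightarrow> power_series_at p W a (\<lambda>x. \<Prod>j\<in>J. f j x)"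
  by (induction J rule: infinite_finite_induct) (simp_all add: power_series_at_const power_series_at_mult)

text \<open>Geometric series: with \<open>u = 1 - f / f a\<close>, which vanishes at
  \<open>a\<close>, the reciprocal is \<open>inverse (1 - u) * inverse (f a)\<close>, and on a small
  box \<open>u\<close> has majorant \<open>1/2\<close>.\<close>

lemma power_series_at_inverse:
  fixes f :: "_ \<Rightarrow> 'b::{banach, real_normed_field}"
  assumes f: "power_series_at p W a f" and a: "a \<in> W" "f a \<noteq> 0"
  shows "power_series_at p W a (\<lambda>x. inverse (f x))"
proof -
  \<comment> \<open>Written with sums and products only, so that the closure rules apply as they
    stand.\<close>
  define u where "u x = 1 + f x * (- inverse (f a))" for x
  have "power_series_at p W a u"
    unfolding u_def by (intro power_series_at_add power_series_at_mult power_series_at_const f)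
  then obtain r0 M where r0: "0 < r0" "has_power_series p W a r0 M u"
    unfolding power_series_at_def by blast
  have "u a = 0" using a by (simp add: u_def)
  then obtain r where r: "0 < r" and u: "has_power_series p W a r (1/2) u"
    using has_power_series_vanishing[OF r0(2,1) a(1), of "1/2"] by auto
  have pow: "has_power_series p W a r ((1/2) ^ k) (\<lambda>x. u x ^ k)" for k
  proof (induction k)
    case 0 then show ?case using has_power_series_const[OF r, of p W a "1::'b"] by simp
  next
    case (Suc k) then show ?case using has_power_series_mult[OF r u] by simp
  qed
  have geo: "((\<lambda>k. z ^ k) has_sum inverse (1 - z)) UNIV" if "norm z < 1" for z :: "'c::{banach, real_normed_field}"
    using that by (intro norm_summable_imp_has_sum)
      (auto simp: norm_power intro: summable_geometric geometric_sums[of z, unfolded divide_inverse, simplified])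
  have "has_power_series p W a r (inverse (1 - 1/2)) (\<lambda>x. inverse (1 - u x))"
  proof (rule has_power_series_sum[OF r pow])
    show "((\<lambda>k. (1/2 :: real) ^ k) has_sum inverse (1 - 1/2)) UNIV" by (rule geo) simp
    show "((\<lambda>k. u x ^ k) has_sum inverse (1 - u x)) UNIV"
      if "x \<in> W" "\<And>i. i < p \<Longrightarrow> \<bar>x i - a i\<bar> \<le> r" for x
      by (rule geo) (use has_power_series_norm_le[OF u that(1), OF that(2)] in linarith)
  qed
  then have "power_series_at p W a (\<lambda>x. inverse (1 - u x) * inverse (f a))"
    using r power_series_at_def by (intro power_series_at_mult power_series_at_const) blast
  moreover have "inverse (1 - u x) * inverse (f a) = inverse (f x)" for x
    using a(2) by (simp add: u_def field_simps)
  ultimately show ?thesis by simp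
qed

section \<open>Comparison with real analyticity, and substitution\<close>

lemma real_analytic_onI:
  assumes "openin (Euclidean_space p) W" "\<And>a. a \<in> W \<Longrightarrow> power_series_at p W a f"
  shows "real_analytic_on p W f"
proof -
  have "\<exists>r>0. \<exists>c. \<forall>x\<in>W. (\<forall>i<p. \<bar>x i - a i\<bar> < r) \<longrightarrow>
        ((\<lambda>\<alpha>. c \<alpha> * (\<Prod>i<p. (x i - a i) ^ \<alpha> i)) has_sum f x) (multi_indices p)" if a: "a \<in> W" for a
  proof -
    obtain r N where r: "0 < r" "has_power_series p W a r N f"
      using assms(2)[OF a] by (auto simp: power_series_at_def)
    obtain c where "\<And>x. x \<in> W \<Longrightarrow> (\<And>i. i < p \<Longrightarrow> \<bar>x i - a i\<bar> \<le> r) \<Longrightarrow>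
        ((\<lambda>\<alpha>. mpower p (\<lambda>i. x i - a i) \<alpha> *\<^sub>R c \<alpha>) has_sum f x) (multi_indices p)"
      using has_power_seriesE[OF r(2)] by metis
    then show ?thesis using r(1) by (intro exI[of _ r] exI[of _ c] conjI) (force simp: mpower_def mult.commute)+
  qed
  then show ?thesis using assms(1) by (simp add: real_analytic_on_def)
qed

text \<open>The definition yields convergence but no majorant. Evaluation at the corner
  \<open>a + (r, ..., r)\<close> supplies one: there each monomial equals
  \<open>r ^ mdegree p \<alpha>\<close>, and an unconditionally convergent real series converges
  absolutely.\<close>

lemma real_analytic_on_imp_has_power_series:
  assumes f: "real_analytic_on p W f" and a: "a \<in> W"
  obtains r N where "0 < r" "has_power_series p W a r N f"
proof -
  have W: "openin (Euclidean_space p) W" using f by (simp add: real_analytic_on_def)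
  obtain s where s: "0 < s"
    "\<And>x. x \<in> topspace (Euclidean_space p) \<Longrightarrow> (\<And>i. i < p \<Longrightarrow> \<bar>x i - a i\<bar> < s) \<Longrightarrow> x \<in> W"
    using openin_Euclidean_space_contains_box[OF W a] by blast
  obtain t c where t: "0 < t" and c: "\<forall>x\<in>W. (\<forall>i<p. \<bar>x i - a i\<bar> < t) \<longrightarrow>
        ((\<lambda>\<alpha>. c \<alpha> * (\<Prod>i<p. (x i - a i) ^ \<alpha> i)) has_sum f x) (multi_indices p)"
    using f a unfolding real_analytic_on_def by blast
  \<comment> \<open>Halving puts the corner strictly inside both boxes: it lies in \<open>W\<close>,
    and the expansion holds there.\<close>
  define r where "r = min s t / 2"
  have r: "0 < r" "r < s" "r < t" using s t by (auto simp: r_def)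
  have sub: "a \<in> topspace (Euclidean_space p)" using W a openin_subset by blast
  define x where "x i = (if i < p then a i + r else 0)" for i
  have "x \<in> W" using r sub by (intro s(2)) (auto simp: x_def topspace_Euclidean_space)
  then have "((\<lambda>\<alpha>. c \<alpha> * (\<Prod>i<p. (x i - a i) ^ \<alpha> i)) has_sum f x) (multi_indices p)"
    using c[THEN bspec, of x] r by (simp add: x_def)
  then have "(\<lambda>\<alpha>. c \<alpha> * r ^ mdegree p \<alpha>) summable_on multi_indices p"
    by (simp add: x_def mdegree_def power_sum has_sum_imp_summable)
  then have "(\<lambda>\<alpha>. norm (c \<alpha>) * r ^ mdegree p \<alpha>) summable_on multi_indices p"
    using r by (subst (asm) summable_on_iff_abs_summable_on_real) (simp add: abs_mult)
  moreover have "((\<lambda>\<alpha>. mpower p (\<lambda>i. x i - a i) \<alpha> *\<^sub>R c \<alpha>) has_sum f x) (multi_indices p)"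
    if "x \<in> W" "\<forall>i<p. \<bar>x i - a i\<bar> \<le> r" for x
    using c that r(3) by (force simp: mpower_def mult.commute)
  ultimately have "has_power_series p W a r (\<Sum>\<^sub>\<infinity>\<alpha>\<in>multi_indices p. norm (c \<alpha>) * r ^ mdegree p \<alpha>) f"
    unfolding has_power_series_def by blast
  then show ?thesis using that r by blast
qed

text \<open>Each \<open>F x i - F a i\<close> vanishes at \<open>a\<close>, so its majorant can be
  brought down to the radius \<open>s\<close> of the outer expansion. The term with exponent
  \<open>\<beta>\<close> then has majorant \<open>norm (c \<beta>) * s ^ mdegree q \<beta>\<close>,
  and these are summable.\<close>

lemma power_series_at_compose:
  assumes F: "\<And>i. i < q \<Longrightarrow> power_series_at p W a (\<lambda>x. F x i)" and a: "a \<in> W"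
    and FW: "\<And>x. x \<in> W \<Longrightarrow> F x \<in> V" and g: "real_analytic_on q V g"
  shows "power_series_at p W a (\<lambda>x. g (F x))"
proof -
  let ?J = "multi_indices q"
  obtain s N where s: "0 < s" "has_power_series q V (F a) s N g"
    using real_analytic_on_imp_has_power_series[OF g FW[OF a]] by blast
  obtain c where c: "(\<lambda>\<beta>. norm (c \<beta>) * s ^ mdegree q \<beta>) summable_on ?J"
    "\<And>y. y \<in> V \<Longrightarrow> (\<And>i. i < q \<Longrightarrow> \<bar>y i - F a i\<bar> \<le> s) \<Longrightarrow>
        ((\<lambda>\<beta>. mpower q (\<lambda>i. y i - F a i) \<beta> *\<^sub>R c \<beta>) has_sum g y) ?J"
    using has_power_seriesE[OF s(2)] by blast
  have "\<forall>i. \<exists>r>0. i < q \<longrightarrow> has_power_series p W a r s (\<lambda>x. F x i + - F a i)"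
  proof
    fix i
    show "\<exists>r>0. i < q \<longrightarrow> has_power_series p W a r s (\<lambda>x. F x i + - F a i)"
    proof (cases "i < q")
      case True
      then have "power_series_at p W a (\<lambda>x. F x i + - F a i)"
        by (intro power_series_at_add F power_series_at_const)
      then obtain r0 M where r0: "0 < r0" "has_power_series p W a r0 M (\<lambda>x. F x i + - F a i)"
        unfolding power_series_at_def by blast
      show ?thesis
        by (rule has_power_series_vanishing[OF r0(2,1) a _ s(1)]) (simp, blast)
    qed (auto intro: exI[of _ 1])
  qed
  then obtain r' where r': "\<And>i. r' i > 0" "\<And>i. i < q \<Longrightarrow> has_power_series p W a (r' i) s (\<lambda>x. F x i + - F a i)"
    by metis
  \<comment> \<open>A common radius for all inner functions; \<open>insert 1\<close> covers
    \<open>q = 0\<close>.\<close>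
  define r where "r = Min (insert 1 (r' ` {..<q}))"
  have r: "0 < r" using r'(1) by (simp add: r_def)
  have Fi: "has_power_series p W a r s (\<lambda>x. F x i - F a i)" if "i < q" for i
    using has_power_series_shrink[OF r'(2)[OF that] r] that by (simp add: r_def)
  have pow: "has_power_series p W a r (s ^ k) (\<lambda>x. (F x i - F a i) ^ k)" if "i < q" for i k
  proof (induction k)
    case 0 then show ?case using has_power_series_const[OF r, of p W a "1::real"] by simp
  next
    case (Suc k) then show ?case using has_power_series_mult[OF r Fi[OF that]] by simp
  qed
  \<comment> \<open>Induction on the number of variables taken into account, each contributing one
    more factor.\<close>
  have mono: "has_power_series p W a r (s ^ mdegree k \<beta>) (\<lambda>x. mpower k (\<lambda>i. F x i - F a i) \<beta>)" if "k \<le> q" for k \<beta>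
    using that
  proof (induction k)
    case 0
    then show ?case using has_power_series_const[OF r, of p W a "1::real"] by (simp add: mpower_def mdegree_def)
  next
    case (Suc k)
    then show ?case using has_power_series_mult[OF r Suc.IH pow[of k "\<beta> k"]]
      by (simp add: mpower_def mdegree_def power_add)
  qed
  have "has_power_series p W a r (\<Sum>\<^sub>\<infinity>\<beta>\<in>?J. norm (c \<beta>) * s ^ mdegree q \<beta>) (\<lambda>x. g (F x))"
  proof (rule has_power_series_sum[OF r])
    show "has_power_series p W a r (norm (c \<beta>) * s ^ mdegree q \<beta>)
        (\<lambda>x. c \<beta> * mpower q (\<lambda>i. F x i - F a i) \<beta>)" for \<beta>
      by (intro has_power_series_mult[OF r has_power_series_const[OF r]] mono) simp
    show "((\<lambda>\<beta>. norm (c \<beta>) * s ^ mdegree q \<beta>) has_sum (\<Sum>\<^sub>\<infinity>\<beta>\<in>?J. norm (c \<beta>) * s ^ mdegree q \<beta>)) ?J"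
      by (rule has_sum_infsum[OF c(1)])
    fix x assume x: "x \<in> W" "\<And>i. i < p \<Longrightarrow> \<bar>x i - a i\<bar> \<le> r"
    have "\<bar>F x i - F a i\<bar> \<le> s" if "i < q" for i
      using has_power_series_norm_le[OF Fi[OF that] x(1), OF x(2)] by simp
    from c(2)[OF FW[OF x(1)], OF this]
    show "((\<lambda>\<beta>. c \<beta> * mpower q (\<lambda>i. F x i - F a i) \<beta>) has_sum g (F x)) ?J"
      by (simp add: mult.commute)
  qed
  then show ?thesis using r unfolding power_series_at_def by blast
qed

lemma real_analytic_on_imp_power_series_at:
  "real_analytic_on p W f \<Longrightarrow> a \<in> W \<Longrightarrow> power_series_at p W a f"
  unfolding power_series_at_def
  by (erule real_analytic_on_imp_has_power_series, assumption) blast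

lemma real_analytic_on_cong:
  assumes "real_analytic_on p W f" "\<And>x. x \<in> W \<Longrightarrow> f x = g x"
  shows "real_analytic_on p W g"
  using assms unfolding real_analytic_on_def by simp

lemma power_series_at_det:
  fixes A :: "_ \<Rightarrow> 'b::{banach, real_normed_field} mat"
  assumes "\<And>x. A x \<in> carrier_mat n n"
    and "\<And>i j. i < n \<Longrightarrow> j < n \<Longrightarrow> power_series_at p W a (\<lambda>x. A x $$ (i, j))"
  shows "power_series_at p W a (\<lambda>x. Determinant.det (A x))"
  unfolding det_def'[OF assms(1)]
  by (intro power_series_at_sum power_series_at_mult power_series_at_const power_series_at_prod assms)
     (auto simp: permutes_in_image)

section \<open>Kronecker products with identity matrices\<close>

lemma kronecker_one_carrier [simp]:
  "A \<in> carrier_mat m n \<Longrightarrow> A \<otimes>\<^sub>K 1\<^sub>m k \<in> carrier_mat (m * k) (n * k)"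
  by (auto simp: kronecker_def)

lemma kronecker_one_index:
  assumes "A \<in> carrier_mat m n" "i < m * k" "j < n * k"
  shows "(A \<otimes>\<^sub>K 1\<^sub>m k) $$ (i, j) = (if i mod k = j mod k then A $$ (i div k, j div k) else 0)"
proof -
  have "0 < k" using assms by (cases k) auto
  then show ?thesis using assms by (simp add: kronecker_def)
qed

lemma kronecker_one_assoc:
  assumes A: "A \<in> carrier_mat m n"
  shows "(A \<otimes>\<^sub>K 1\<^sub>m j) \<otimes>\<^sub>K 1\<^sub>m k = A \<otimes>\<^sub>K 1\<^sub>m (j * k)"
proof (rule eq_matI)
  have c: "A \<otimes>\<^sub>K 1\<^sub>m j \<in> carrier_mat (m * j) (n * j)" "A \<otimes>\<^sub>K 1\<^sub>m (j * k) \<in> carrier_mat (m * (j * k)) (n * (j * k))"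
    using A by simp_all
  show "dim_row (A \<otimes>\<^sub>K 1\<^sub>m j \<otimes>\<^sub>K 1\<^sub>m k) = dim_row (A \<otimes>\<^sub>K 1\<^sub>m (j * k))"
    "dim_col (A \<otimes>\<^sub>K 1\<^sub>m j \<otimes>\<^sub>K 1\<^sub>m k) = dim_col (A \<otimes>\<^sub>K 1\<^sub>m (j * k))"
    by (simp_all add: kronecker_def)
  fix i l assume "i < dim_row (A \<otimes>\<^sub>K 1\<^sub>m (j * k))" "l < dim_col (A \<otimes>\<^sub>K 1\<^sub>m (j * k))"
  then have il: "i < m * j * k" "l < n * j * k" using c(2) by (auto simp: mult.assoc)
  then have il': "i div k < m * j" "l div k < n * j"
    by (auto simp: less_mult_imp_div_less)
  \<comment> \<open>Mixed radix: the remainder modulo \<open>j * k\<close> encodes the pair of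
    remainders \<open>i mod k\<close> and \<open>i div k mod j\<close>.\<close>
  have "i mod (j * k) = l mod (j * k) \<longleftrightarrow> i mod k = l mod k \<and> i div k mod j = l div k mod j"
  proof -
    have k: "0 < k" using il by (cases k) auto
    have "i mod (k * j) = l mod (k * j) \<longleftrightarrow> i mod k = l mod k \<and> i div k mod j = l div k mod j"
      unfolding mod_mult2_eq
    proof
      assume h: "k * (i div k mod j) + i mod k = k * (l div k mod j) + l mod k"
      from arg_cong[OF h, of "\<lambda>x. x mod k"] arg_cong[OF h, of "\<lambda>x. x div k"] k
      show "i mod k = l mod k \<and> i div k mod j = l div k mod j" by simp
    qed simp
    then show ?thesis by (simp add: mult.commute)
  qed
  then show "(A \<otimes>\<^sub>K 1\<^sub>m j \<otimes>\<^sub>K 1\<^sub>m k) $$ (i, l) = (A \<otimes>\<^sub>K 1\<^sub>m (j * k)) $$ (i, l)"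
    using il il' by (simp add: kronecker_one_index[OF c(1)] kronecker_one_index[OF A] mult.assoc
        div_mult2_eq[symmetric] mult.commute[of k])
qed

lemma kronecker_one_1 [simp]: "A \<otimes>\<^sub>K 1\<^sub>m 1 = A"
  by (rule eq_matI) (auto simp: kronecker_def)

text \<open>The entries of \<open>A\<close> reappear at the positions whose two indices are
  divisible by \<open>k\<close>. This is the cancellation law behind the comparison of
  representatives.\<close>

lemma kronecker_one_inject:
  assumes "A \<in> carrier_mat m n" "B \<in> carrier_mat m n" "0 < k" "A \<otimes>\<^sub>K 1\<^sub>m k = B \<otimes>\<^sub>K 1\<^sub>m k"
  shows "A = B"
proof (rule eq_matI)
  fix i j assume "i < dim_row B" "j < dim_col B"
  then have ij: "i < m" "j < n" using assms by auto
  then have lt: "i * k < m * k" "j * k < n * k" using \<open>0 < k\<close> by auto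
  show "A $$ (i, j) = B $$ (i, j)"
    using arg_cong[OF assms(4), of "\<lambda>M. M $$ (i * k, j * k)"] \<open>0 < k\<close>
    by (simp add: kronecker_one_index[OF assms(1) lt] kronecker_one_index[OF assms(2) lt])
qed (use assms in auto)

lemma kronecker_one_mult:
  assumes A: "A \<in> carrier_mat n n" and B: "B \<in> carrier_mat n n"
  shows "(A * B) \<otimes>\<^sub>K 1\<^sub>m k = (A \<otimes>\<^sub>K 1\<^sub>m k) * (B \<otimes>\<^sub>K 1\<^sub>m k)"
proof (rule eq_matI)
  have AB: "A * B \<in> carrier_mat n n" using assms by simp
  have cA: "A \<otimes>\<^sub>K 1\<^sub>m k \<in> carrier_mat (n * k) (n * k)" and cB: "B \<otimes>\<^sub>K 1\<^sub>m k \<in> carrier_mat (n * k) (n * k)"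
    using assms by simp_all
  show "dim_row (A * B \<otimes>\<^sub>K 1\<^sub>m k) = dim_row ((A \<otimes>\<^sub>K 1\<^sub>m k) * (B \<otimes>\<^sub>K 1\<^sub>m k))"
    "dim_col (A * B \<otimes>\<^sub>K 1\<^sub>m k) = dim_col ((A \<otimes>\<^sub>K 1\<^sub>m k) * (B \<otimes>\<^sub>K 1\<^sub>m k))"
    by (simp_all add: kronecker_def)
  fix i j assume "i < dim_row ((A \<otimes>\<^sub>K 1\<^sub>m k) * (B \<otimes>\<^sub>K 1\<^sub>m k))" "j < dim_col ((A \<otimes>\<^sub>K 1\<^sub>m k) * (B \<otimes>\<^sub>K 1\<^sub>m k))"
  then have ij: "i < n * k" "j < n * k" using cA cB by auto
  then have k: "0 < k" by (cases k) auto
  have ij': "i div k < n" "j div k < n" using ij by (auto simp: less_mult_imp_div_less)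
  have "((A \<otimes>\<^sub>K 1\<^sub>m k) * (B \<otimes>\<^sub>K 1\<^sub>m k)) $$ (i, j) =
      (\<Sum>l<n * k. (A \<otimes>\<^sub>K 1\<^sub>m k) $$ (i, l) * (B \<otimes>\<^sub>K 1\<^sub>m k) $$ (l, j))"
    using ij cA cB by (simp add: scalar_prod_def lessThan_atLeast0)
  also have "\<dots> = (\<Sum>l<n * k. if l mod k = i mod k \<and> i mod k = j mod k
      then A $$ (i div k, l div k) * B $$ (l div k, j div k) else 0)"
    using ij by (intro sum.cong) (auto simp: kronecker_one_index[OF A] kronecker_one_index[OF B])
  also have "\<dots> = (if i mod k = j mod k then (\<Sum>l<n. A $$ (i div k, l) * B $$ (l, j div k)) else 0)"
  proof (cases "i mod k = j mod k")
    case True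
    \<comment> \<open>Only the indices \<open>l\<close> in the residue class of \<open>i\<close>
      modulo \<open>k\<close> contribute, one for each block; \<open>l div k\<close> names the
      block.\<close>
    have "(\<Sum>l<n. A $$ (i div k, l) * B $$ (l, j div k)) =
        (\<Sum>l\<in>{l. l < n * k \<and> l mod k = i mod k}. A $$ (i div k, l div k) * B $$ (l div k, j div k))"
    proof (rule sum.reindex_bij_witness[of _ "\<lambda>l. l div k" "\<lambda>l. l * k + i mod k"])
      fix l assume "l \<in> {..<n}"
      then have "l * k + i mod k < Suc l * k" "Suc l * k \<le> n * k"
        using mod_less_divisor[OF k, of i] by (simp, auto simp del: mult_Suc intro: mult_le_mono1)
      then have "l * k + i mod k < n * k" by (rule less_le_trans)
      then show "l * k + i mod k \<in> {l. l < n * k \<and> l mod k = i mod k}" by simp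
    next
      fix l assume "l \<in> {l. l < n * k \<and> l mod k = i mod k}"
      then show "l div k * k + i mod k = l" using div_mult_mod_eq[of l k] by simp
    qed (use k in \<open>auto simp: less_mult_imp_div_less\<close>)
    then show ?thesis using True
      by (simp add: sum.inter_filter[symmetric, of "{..<n * k}", simplified])
  qed auto
  also have "\<dots> = (A * B \<otimes>\<^sub>K 1\<^sub>m k) $$ (i, j)"
    using ij' A B by (simp add: kronecker_one_index[OF AB ij] scalar_prod_def lessThan_atLeast0)
  finally show "(A * B \<otimes>\<^sub>K 1\<^sub>m k) $$ (i, j) = ((A \<otimes>\<^sub>K 1\<^sub>m k) * (B \<otimes>\<^sub>K 1\<^sub>m k)) $$ (i, j)" by simp
qed

lemma kronecker_one_one: "1\<^sub>m n \<otimes>\<^sub>K 1\<^sub>m k = (1\<^sub>m (n * k) :: 'a::semiring_1 mat)"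
proof (rule eq_matI)
  fix i j assume "i < dim_row (1\<^sub>m (n * k) :: 'a mat)" "j < dim_col (1\<^sub>m (n * k) :: 'a mat)"
  then have ij: "i < n * k" "j < n * k" by auto
  have "i = j \<longleftrightarrow> i mod k = j mod k \<and> i div k = j div k" by (metis div_mult_mod_eq)
  then show "(1\<^sub>m n \<otimes>\<^sub>K 1\<^sub>m k) $$ (i, j) = (1\<^sub>m (n * k) :: 'a mat) $$ (i, j)"
    using ij by (auto simp: kronecker_one_index[OF one_carrier_mat ij] less_mult_imp_div_less)
qed (simp_all add: kronecker_def)

section \<open>Determinants of Kronecker products\<close>

lemma det_reindex:
  fixes B :: "'a::comm_ring_1 mat"
  assumes B: "B \<in> carrier_mat n n" and \<sigma>: "\<sigma> permutes {0..<n}"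
  shows "Determinant.det (Matrix.mat n n (\<lambda>(i, j). B $$ (\<sigma> i, \<sigma> j))) = Determinant.det B"
proof -
  define C where "C = Matrix.mat n n (\<lambda>(i, j). B $$ (\<sigma> i, j))"
  have C: "C \<in> carrier_mat n n" by (simp add: C_def)
  have \<sigma>lt: "\<sigma> i < n" if "i < n" for i using permutes_in_image[OF \<sigma>, of i] that by simp
  have "Matrix.mat n n (\<lambda>(i, j). B $$ (\<sigma> i, \<sigma> j)) =
      transpose_mat (Matrix.mat n n (\<lambda>(i, j). transpose_mat C $$ (\<sigma> i, j)))"
    by (rule eq_matI) (auto simp: C_def \<sigma>lt)
  \<comment> \<open>Rows are permuted twice, once after transposition so that columns move; each
    time the sign of \<open>\<sigma>\<close> appears, and its square is \<open>1\<close>.\<close>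
  also have "Determinant.det \<dots> = signof \<sigma> * Determinant.det C"
    using C by (subst det_transpose[of _ n]) (simp_all add: det_permute_rows[of _ n, OF _ \<sigma>] det_transpose[OF C])
  also have "\<dots> = Determinant.det B"
    unfolding C_def det_permute_rows[OF B \<sigma>] by (simp add: sign_def)
  finally show ?thesis .
qed

text \<open>In this order of the factors the product is block diagonal, and one block is split off
  at a time.\<close>

lemma det_one_kronecker:
  fixes A :: "'a::idom mat"
  assumes A: "A \<in> carrier_mat n n"
  shows "Determinant.det (1\<^sub>m k \<otimes>\<^sub>K A) = Determinant.det A ^ k"
proof (induction k)
  case 0
  have "1\<^sub>m 0 \<otimes>\<^sub>K A \<in> carrier_mat 0 0" by (auto simp: kronecker_def)
  then show ?case by simp
next
  case (Suc k)
  have "1\<^sub>m (Suc k) \<otimes>\<^sub>K A = four_block_mat A (0\<^sub>m n (k * n)) (0\<^sub>m (k * n) n) (1\<^sub>m k \<otimes>\<^sub>K A)" (is "_ = ?R")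
  proof (rule eq_matI)
    show "dim_row (1\<^sub>m (Suc k) \<otimes>\<^sub>K A) = dim_row ?R" "dim_col (1\<^sub>m (Suc k) \<otimes>\<^sub>K A) = dim_col ?R"
      using A by (auto simp: kronecker_def)
    fix i j assume "i < dim_row ?R" "j < dim_col ?R"
    then have ij: "i < n + k * n" "j < n + k * n" using A by (auto simp: kronecker_def)
    then have n: "0 < n" by (cases n) auto
    have small: "i div n = 0 \<longleftrightarrow> i < n" for i using n by (simp add: div_eq_0_iff)
    have big: "(i - n) div n = i div n - 1" "(i - n) mod n = i mod n" if "\<not> i < n" for i
      using that n by (auto simp: le_div_geq le_mod_geq)
    have pos: "i div n \<ge> 1" if "\<not> i < n" for i using that small[of i] by linarith
    have bd: "i div n < Suc k" "j div n < Suc k"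
      using ij by (auto intro!: less_mult_imp_div_less)
    show "(1\<^sub>m (Suc k) \<otimes>\<^sub>K A) $$ (i, j) = ?R $$ (i, j)"
      using A ij n bd pos[of i] pos[of j] small[of i] small[of j]
      by (auto simp: kronecker_def big)
  qed
  moreover have "1\<^sub>m k \<otimes>\<^sub>K A \<in> carrier_mat (k * n) (k * n)" using A by (auto simp: kronecker_def)
  ultimately show ?case using Suc A
    by (simp add: det_four_block_mat_lower_left_zero[OF A, of _ "k * n"])
qed

text \<open>Exchanging the two factors is a simultaneous permutation of rows and columns; it
  preserves the determinant and leads to the block diagonal case.\<close>

lemma det_kronecker_one:
  fixes A :: "'a::idom mat"
  assumes A: "A \<in> carrier_mat n n"
  shows "Determinant.det (A \<otimes>\<^sub>K 1\<^sub>m k) = Determinant.det A ^ k"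
proof -
  \<comment> \<open>The perfect shuffle: an index with quotient \<open>a\<close> and remainder
    \<open>b\<close> modulo \<open>k\<close> goes to \<open>b * n + a\<close>. Outside the range it
    is the identity, as \<open>permutes\<close> requires.\<close>
  define \<sigma> where "\<sigma> i = (if i < n * k then (i mod k) * n + i div k else i)" for i
  have pos: "0 < n \<and> 0 < k" if "i < n * k" for i using that by (cases n; cases k) auto
  have lt: "(i mod k) * n + i div k < k * n" if "i < n * k" for i
  proof -
    have "i div k < n" "i mod k < k" using that pos[OF that] by (auto simp: less_mult_imp_div_less)
    then have "(i mod k) * n + i div k < Suc (i mod k) * n" "Suc (i mod k) * n \<le> k * n"
      by (simp, intro mult_le_mono1) simp
    then show ?thesis by linarith
  qed
  have dm: "\<sigma> i div n = i mod k" "\<sigma> i mod n = i div k" if "i < n * k" for i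
    using that pos[OF that] by (auto simp: \<sigma>_def less_mult_imp_div_less)
  have \<sigma>lt: "\<sigma> i < n * k" if "i < n * k" for i using lt[OF that] that by (simp add: \<sigma>_def mult.commute)
  have inj: "inj_on \<sigma> {0..<n * k}"
    by (rule inj_onI) (metis dm atLeastLessThan_iff div_mult_mod_eq)
  have "\<sigma> permutes {0..<n * k}"
  proof (rule bij_imp_permutes)
    show "bij_betw \<sigma> {0..<n * k} {0..<n * k}"
      using inj endo_inj_surj[OF _ _ inj] \<sigma>lt by (simp add: bij_betw_def image_subset_iff)
  qed (simp add: \<sigma>_def)
  moreover have "1\<^sub>m k \<otimes>\<^sub>K A \<in> carrier_mat (n * k) (n * k)" using A by (auto simp: kronecker_def mult.commute)
  moreover have "A \<otimes>\<^sub>K 1\<^sub>m k = Matrix.mat (n * k) (n * k) (\<lambda>(i, j). (1\<^sub>m k \<otimes>\<^sub>K A) $$ (\<sigma> i, \<sigma> j))"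
  proof (rule eq_matI)
    fix i j assume "i < dim_row (Matrix.mat (n * k) (n * k) (\<lambda>(i, j). (1\<^sub>m k \<otimes>\<^sub>K A) $$ (\<sigma> i, \<sigma> j)))"
      "j < dim_col (Matrix.mat (n * k) (n * k) (\<lambda>(i, j). (1\<^sub>m k \<otimes>\<^sub>K A) $$ (\<sigma> i, \<sigma> j)))"
    then have ij: "i < n * k" "j < n * k" by auto
    have "(1\<^sub>m k \<otimes>\<^sub>K A) $$ (\<sigma> i, \<sigma> j) = (1\<^sub>m k :: 'a mat) $$ (i mod k, j mod k) * A $$ (i div k, j div k)"
      using A \<sigma>lt[OF ij(1)] \<sigma>lt[OF ij(2)] dm[OF ij(1)] dm[OF ij(2)]
      by (simp add: kronecker_def mult.commute[of n])
    then show "(A \<otimes>\<^sub>K 1\<^sub>m k) $$ (i, j) =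
        Matrix.mat (n * k) (n * k) (\<lambda>(i, j). (1\<^sub>m k \<otimes>\<^sub>K A) $$ (\<sigma> i, \<sigma> j)) $$ (i, j)"
      using ij pos[OF ij(1)] by (simp add: kronecker_one_index[OF A])
  qed (use A in \<open>auto simp: kronecker_def\<close>)
  ultimately show ?thesis using det_reindex det_one_kronecker[OF A] by metis
qed

section \<open>Matrices made of scalar blocks\<close>

definition scalar_blocks :: "nat \<Rightarrow> 'a::semiring_1 mat \<Rightarrow> bool" where
  "scalar_blocks k M \<longleftrightarrow> (\<forall>i<dim_row M. \<forall>j<dim_col M. M $$ (i, j) =
     (if i mod k = j mod k then M $$ (i div k * k, j div k * k) else 0))"

lemma div_mult_less: "0 < k \<Longrightarrow> i < m \<Longrightarrow> i div k * k < (m::nat)"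
  by (meson div_times_less_eq_dividend le_less_trans)

text \<open>The matrix \<open>A\<close> collects the upper left entries of the blocks. The entrywise
  form is the one to work with: its negation is visibly an open condition, and two block sizes can
  be compared entry by entry.\<close>

lemma scalar_blocks_iff:
  assumes M: "M \<in> carrier_mat (m * k) (n * k)" and k: "0 < k"
  shows "scalar_blocks k M \<longleftrightarrow> (\<exists>A\<in>carrier_mat m n. M = A \<otimes>\<^sub>K 1\<^sub>m k)"
proof
  assume sb: "scalar_blocks k M"
  define A where "A = Matrix.mat m n (\<lambda>(a, b). M $$ (a * k, b * k))"
  have A: "A \<in> carrier_mat m n" by (simp add: A_def)
  have "M = A \<otimes>\<^sub>K 1\<^sub>m k"
  proof (rule eq_matI)
    fix i j assume "i < dim_row (A \<otimes>\<^sub>K 1\<^sub>m k)" "j < dim_col (A \<otimes>\<^sub>K 1\<^sub>m k)"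
    then have ij: "i < m * k" "j < n * k" by (auto simp: kronecker_def A_def)
    then show "M $$ (i, j) = (A \<otimes>\<^sub>K 1\<^sub>m k) $$ (i, j)"
      using sb M unfolding kronecker_one_index[OF A ij] scalar_blocks_def
      by (simp add: A_def less_mult_imp_div_less)
  qed (use M in \<open>auto simp: kronecker_def A_def\<close>)
  then show "\<exists>A\<in>carrier_mat m n. M = A \<otimes>\<^sub>K 1\<^sub>m k" using A by blast
next
  assume "\<exists>A\<in>carrier_mat m n. M = A \<otimes>\<^sub>K 1\<^sub>m k"
  then obtain A where A: "A \<in> carrier_mat m n" "M = A \<otimes>\<^sub>K 1\<^sub>m k" by blast
  show "scalar_blocks k M" unfolding scalar_blocks_def
  proof (intro allI impI)
    fix i j assume "i < dim_row M" "j < dim_col M"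
    then have ij: "i < m * k" "j < n * k" using M by auto
    show "M $$ (i, j) = (if i mod k = j mod k then M $$ (i div k * k, j div k * k) else 0)"
      unfolding A(2) kronecker_one_index[OF A(1) ij]
        kronecker_one_index[OF A(1) div_mult_less[OF k ij(1)] div_mult_less[OF k ij(2)]]
      using k by simp
  qed
qed

lemma mod_eq_Suc_pred:
  assumes k: "0 < k" and x: "x mod k = Suc r"
  shows "(x - 1) div k = x div k \<and> (x - 1) mod k = r"
proof -
  have "x - 1 = x div k * k + r" using x div_mult_mod_eq[of x k] by linarith
  moreover have "r < k" using mod_less_divisor[OF k, of x] x by linarith
  ultimately show ?thesis using k by simp
qed

text \<open>A nonzero remainder keeps the preceding position on the diagonal in the same scalar
  block, whose diagonal is constant.\<close>

lemma scalar_blocks_step: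
  assumes sb: "scalar_blocks k M" and k: "0 < k" and ij: "i < dim_row M" "j < dim_col M" "i mod k = j mod k" "i mod k \<noteq> 0"
  shows "M $$ (i, j) = M $$ (i - 1, j - 1)"
proof -
  have step: "(i - 1) div k = i div k \<and> (i - 1) mod k = i mod k - 1" if "i mod k \<noteq> 0" for i
    using that mod_eq_Suc_pred[OF k, of i "i mod k - 1"] by simp
  have base: "M $$ (x, y) = M $$ (x div k * k, y div k * k)"
    if "x < dim_row M" "y < dim_col M" "x mod k = y mod k" for x y
    using sb that unfolding scalar_blocks_def by simp
  have "M $$ (i, j) = M $$ (i div k * k, j div k * k)" by (rule base) (use ij in auto)
  moreover have "M $$ (i - 1, j - 1) = M $$ ((i - 1) div k * k, (j - 1) div k * k)"
    by (rule base) (use ij step[of i] step[of j] in auto)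
  ultimately show ?thesis using step[of i] step[of j] ij by simp
qed

text \<open>Along a diagonal that is congruent modulo both numbers, an entry can differ from its predecessor
  only at an index divisible by both.\<close>

lemma scalar_blocks_lcm:
  assumes p: "scalar_blocks p M" "0 < p" and q: "scalar_blocks q M" "0 < q"
  shows "scalar_blocks (lcm p q) M"
proof -
  let ?l = "lcm p q"
  have l: "0 < ?l" using assms by (simp add: lcm_pos_nat)
  \<comment> \<open>Induction on the common remainder, the distance to the corner of the block; each
    step moves up the diagonal by one.\<close>
  have down: "M $$ (i, j) = M $$ (i div ?l * ?l, j div ?l * ?l)"
    if "i < dim_row M" "j < dim_col M" "i mod ?l = j mod ?l" "i mod ?l = r" for i j r
    using that
  proof (induction r arbitrary: i j)
    case 0
    then show ?case by (simp flip: minus_mod_eq_div_mult)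
  next
    case (Suc r)
    have eq: "i mod p = j mod p" "i mod q = j mod q"
      using Suc.prems(3) by (metis dvd_lcm1 mod_mod_cancel, metis dvd_lcm2 mod_mod_cancel)
    \<comment> \<open>A nonzero remainder modulo the least common multiple rules out divisibility by
      both numbers, so one of the two block structures permits the step.\<close>
    have "\<not> (p dvd i \<and> q dvd i)"
      using Suc.prems(4) by (metis lcm_least dvd_imp_mod_0 nat.distinct(1))
    then have "i mod p \<noteq> 0 \<or> i mod q \<noteq> 0" by (auto simp: dvd_eq_mod_eq_0)
    then have "M $$ (i, j) = M $$ (i - 1, j - 1)"
      using scalar_blocks_step[OF p, of i j] scalar_blocks_step[OF q, of i j] eq Suc.prems by auto
    then show ?case
      using Suc.IH[of "i - 1" "j - 1"] mod_eq_Suc_pred[OF l, of i r] mod_eq_Suc_pred[OF l, of j r] Suc.prems by simp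
  qed
  show ?thesis unfolding scalar_blocks_def
  proof (intro allI impI)
    fix i j assume ij: "i < dim_row M" "j < dim_col M"
    show "M $$ (i, j) = (if i mod ?l = j mod ?l then M $$ (i div ?l * ?l, j div ?l * ?l) else 0)"
    proof (cases "i mod ?l = j mod ?l")
      case True then show ?thesis using down ij by simp
    next
      case False
      \<comment> \<open>Congruence modulo both numbers would give congruence modulo their least
        common multiple.\<close>
      then have "i mod p \<noteq> j mod p \<or> i mod q \<noteq> j mod q"
        using cong_cong_lcm_nat[of i j p q] by (auto simp: cong_def)
      then show ?thesis using False p q ij unfolding scalar_blocks_def by metis
    qed
  qed
qed

section \<open>Classes of square matrices and their group\<close>

lemma square_mats_iff: "A \<in> square_mats \<longleftrightarrow> (\<exists>n>0. A \<in> carrier_mat n n)"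
  by (auto simp: square_mats_def Suc_le_eq)

lemma square_matsI: "A \<in> carrier_mat n n \<Longrightarrow> 0 < n \<Longrightarrow> A \<in> square_mats"
  by (auto simp: square_mats_iff)

text \<open>Indexed by the target size instead of the multiplier, so that representatives of
  different sizes can be compared at a common multiple. It has its intended meaning when the size of
  \<open>A\<close> divides \<open>N\<close>.\<close>

definition lift_mat :: "nat \<Rightarrow> 'a::semiring_1 mat \<Rightarrow> 'a mat" where
  "lift_mat N A = A \<otimes>\<^sub>K 1\<^sub>m (N div dim_row A)"

lemma lift_mat_carrier:
  "A \<in> carrier_mat n n \<Longrightarrow> n dvd N \<Longrightarrow> lift_mat N A \<in> carrier_mat N N"
  using kronecker_one_carrier[of A n n "N div n"] by (auto simp: lift_mat_def)

lemma lift_mat_same: "A \<in> carrier_mat n n \<Longrightarrow> 0 < n \<Longrightarrow> lift_mat n A = A"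
  unfolding lift_mat_def using kronecker_one_1[of A] by simp

lemma lift_mat_lift_mat:
  assumes "A \<in> carrier_mat n n" "n dvd M" "M dvd N" "0 < M"
  shows "lift_mat N (lift_mat M A) = lift_mat N A"
proof -
  have d: "dim_row A = n" "dim_row (lift_mat M A) = M" using assms lift_mat_carrier[OF assms(1,2)] by auto
  have "0 < n" using assms(2,4) by (auto intro: gr0I)
  then have "M div n * (N div M) = N div n" using assms by (auto elim!: dvdE)
  then show ?thesis unfolding lift_mat_def[of N] d
    unfolding lift_mat_def d kronecker_one_assoc[OF assms(1)] by simp
qed

lemma lift_mat_mult:
  assumes "A \<in> carrier_mat n n" "B \<in> carrier_mat n n"
  shows "lift_mat N (A * B) = lift_mat N A * lift_mat N B"
  using kronecker_one_mult[OF assms] assms by (simp add: lift_mat_def)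

lemma mat_simI:
  assumes "A \<in> carrier_mat m m" "B \<in> carrier_mat n n" "m dvd N" "n dvd N" "0 < N" "lift_mat N A = lift_mat N B"
  shows "(A, B) \<in> mat_sim"
proof -
  have "0 < m" "0 < n" "0 < N div m" "0 < N div n"
    using assms by (auto intro!: gr0I simp: dvd_div_eq_0_iff)
  then show ?thesis using assms by (auto simp: mat_sim_def lift_mat_def intro: square_matsI)
qed

text \<open>Equivalence provides equality at one unknown size; multiplying up and cancelling
  transfers it to every common multiple \<open>N\<close> of the two sizes. Together with
  \<open>mat_simI\<close> this reduces questions on classes to matrices of one size.\<close>

lemma mat_simD:
  assumes "(A, B) \<in> mat_sim" "A \<in> carrier_mat m m" "B \<in> carrier_mat n n" "m dvd N" "n dvd N"
  shows "lift_mat N A = lift_mat N B"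
proof (cases "N = 0")
  case True
  then show ?thesis using assms by (auto simp: lift_mat_def kronecker_def)
next
  case False
  obtain s t where st: "0 < s" "0 < t" "A \<otimes>\<^sub>K 1\<^sub>m s = B \<otimes>\<^sub>K 1\<^sub>m t"
    using assms(1) by (auto simp: mat_sim_def)
  have mn: "m * s = n * t"
    using arg_cong[OF st(3), of dim_row] assms by (simp add: kronecker_def)
  have c: "A \<otimes>\<^sub>K 1\<^sub>m (N div m) \<in> carrier_mat N N" "B \<otimes>\<^sub>K 1\<^sub>m (N div n) \<in> carrier_mat N N"
    using assms kronecker_one_carrier by (metis dvd_mult_div_cancel)+
  have pos: "0 < m" "0 < n" using False assms by (auto intro!: gr0I)
  \<comment> \<open>Both lifts are multiplied by the identity of size \<open>m * s = n * t\<close>;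
    reassociation then brings out the given equality, and the extra factor is cancelled at the
    end.\<close>
  have "N div m * (m * s) = s * N" "N div n * (n * t) = t * N"
    using assms(4,5) pos by (auto elim!: dvdE)
  have "(A \<otimes>\<^sub>K 1\<^sub>m (N div m)) \<otimes>\<^sub>K 1\<^sub>m (m * s) = A \<otimes>\<^sub>K 1\<^sub>m (s * N)"
    unfolding kronecker_one_assoc[OF assms(2)] \<open>N div m * (m * s) = s * N\<close> ..
  also have "\<dots> = (A \<otimes>\<^sub>K 1\<^sub>m s) \<otimes>\<^sub>K 1\<^sub>m N" by (simp add: kronecker_one_assoc[OF assms(2)])
  also have "\<dots> = (B \<otimes>\<^sub>K 1\<^sub>m t) \<otimes>\<^sub>K 1\<^sub>m N" using st by simp
  also have "\<dots> = B \<otimes>\<^sub>K 1\<^sub>m (t * N)" by (simp add: kronecker_one_assoc[OF assms(3)])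
  also have "\<dots> = (B \<otimes>\<^sub>K 1\<^sub>m (N div n)) \<otimes>\<^sub>K 1\<^sub>m (m * s)"
    unfolding kronecker_one_assoc[OF assms(3)] mn \<open>N div n * (n * t) = t * N\<close> ..
  finally have "A \<otimes>\<^sub>K 1\<^sub>m (N div m) = B \<otimes>\<^sub>K 1\<^sub>m (N div n)"
    by (rule kronecker_one_inject[OF c, rotated]) (use pos st in simp)
  then show ?thesis using assms by (simp add: lift_mat_def)
qed

lemma equiv_mat_sim: "equiv square_mats (mat_sim :: ('a::semiring_1 mat \<times> 'a mat) set)"
proof (rule equivI)
  show "mat_sim \<subseteq> square_mats \<times> square_mats" by (auto simp: mat_sim_def)
  show "refl_on square_mats (mat_sim :: ('a mat \<times> 'a mat) set)"
    unfolding refl_on_def mat_sim_def by (auto intro: exI[of _ 1])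
  show "sym (mat_sim :: ('a mat \<times> 'a mat) set)"
    unfolding sym_def mat_sim_def by auto metis
  show "trans (mat_sim :: ('a mat \<times> 'a mat) set)"
  proof (rule transI)
    fix A B C :: "'a mat" assume h: "(A, B) \<in> mat_sim" "(B, C) \<in> mat_sim"
    then obtain l m n where c: "A \<in> carrier_mat l l" "B \<in> carrier_mat m m" "C \<in> carrier_mat n n"
      and pos: "0 < l" "0 < m" "0 < n" by (auto simp: mat_sim_def square_mats_iff)
    have "lift_mat (l * m * n) A = lift_mat (l * m * n) C"
      using mat_simD[OF h(1) c(1,2)] mat_simD[OF h(2) c(2,3)] by simp
    then show "(A, C) \<in> mat_sim" using mat_simI[OF c(1,3), of "l * m * n"] pos by simp
  qed
qed

lemma mat_class_eq_iff:
  "A \<in> square_mats \<Longrightarrow> B \<in> square_mats \<Longrightarrow> mat_class A = mat_class B \<longleftrightarrow> (A, B) \<in> mat_sim"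
  unfolding mat_class_def using eq_equiv_class_iff[OF equiv_mat_sim] by blast

lemma mem_mat_class_iff: "B \<in> mat_class A \<longleftrightarrow> (A, B) \<in> mat_sim"
  by (simp add: mat_class_def)

lemma mat_class_memI: "A \<in> square_mats \<Longrightarrow> A \<in> mat_class A"
  unfolding mat_class_def using equiv_class_self[OF equiv_mat_sim] by blast

lemma mat_class_mem_eq: "B \<in> mat_class A \<Longrightarrow> mat_class B = mat_class A"
  unfolding mat_class_def using equiv_class_eq[OF equiv_mat_sim] by blast

lemma mat_class_in_Sigma: "A \<in> square_mats \<Longrightarrow> mat_class A \<in> Sigma_space"
  unfolding mat_class_def Sigma_space_def by (rule quotientI)

lemma Sigma_spaceE:
  assumes "X \<in> Sigma_space"
  obtains A n where "0 < n" "A \<in> carrier_mat n n" "X = mat_class A"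
  using assms unfolding Sigma_space_def mat_class_def by (auto elim!: quotientE simp: square_mats_iff)

lemma Sigma_space_eq_mat_class:
  assumes "X \<in> Sigma_space" "A \<in> X"
  shows "A \<in> square_mats" "X = mat_class A"
proof -
  obtain B where B: "X = mat_class B" using assms(1) by (elim Sigma_spaceE)
  then have "(B, A) \<in> mat_sim" using assms(2) by (simp add: mem_mat_class_iff)
  then show "A \<in> square_mats" by (auto simp: mat_sim_def)
  show "X = mat_class A" using B assms(2) mat_class_mem_eq by metis
qed

lemma mat_class_lift_mat:
  assumes "A \<in> carrier_mat n n" "n dvd N" "0 < N"
  shows "mat_class (lift_mat N A) = mat_class A"
proof -
  have c: "lift_mat N A \<in> carrier_mat N N" using assms by (simp add: lift_mat_carrier)
  have n: "0 < n" using assms by (auto intro: gr0I)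
  have "(lift_mat N A, A) \<in> mat_sim"
    by (rule mat_simI[OF c assms(1)]) (use assms c in \<open>auto simp: lift_mat_same\<close>)
  then show ?thesis using mat_class_eq_iff c assms n by (metis square_matsI)
qed

lemma mat_class_inject:
  assumes "A \<in> carrier_mat n n" "B \<in> carrier_mat n n" "0 < n" "mat_class A = mat_class B"
  shows "A = B"
proof -
  have "(A, B) \<in> mat_sim" using assms mat_class_eq_iff by (metis square_matsI)
  then show ?thesis using mat_simD[of A B n n n] assms by (simp add: lift_mat_same)
qed

lemma representative_mat_class:
  assumes "A \<in> carrier_mat n n" "0 < n"
  shows "representative n (mat_class A) = A"
proof -
  have "B = A" if "B \<in> mat_class A" "B \<in> carrier_mat n n" for B
    using mat_class_inject[OF that(2) assms mat_class_mem_eq[OF that(1)]] .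
  then have "mat_class A \<inter> carrier_mat n n = {A}"
    using assms mat_class_memI[OF square_matsI[OF assms]] by blast
  then show ?thesis by (simp add: representative_def)
qed

text \<open>Representatives of two classes can be lifted to the product of their sizes, so pairs of
  classes are handled through matrices of equal size.\<close>

lemma Sigma_space_common_size:
  assumes "X \<in> Sigma_space" "Y \<in> Sigma_space"
  obtains N A B where "0 < N" "A \<in> carrier_mat N N" "B \<in> carrier_mat N N" "X = mat_class A" "Y = mat_class B"
proof -
  obtain A m where A: "0 < m" "A \<in> carrier_mat m m" "X = mat_class A" using assms(1) by (elim Sigma_spaceE)
  obtain B n where B: "0 < n" "B \<in> carrier_mat n n" "Y = mat_class B" using assms(2) by (elim Sigma_spaceE)
  show ?thesis
    by (rule that[of "m * n" "lift_mat (m * n) A" "lift_mat (m * n) B"])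
      (use A B in \<open>simp_all add: lift_mat_carrier mat_class_lift_mat\<close>)
qed

text \<open>At a common size the product of classes is the ordinary matrix product. Independence of
  the representatives, required to evaluate \<open>the_elem\<close>, is checked after lifting
  everything to size \<open>lcm m n * N\<close>.\<close>

lemma class_stp_mat_class:
  assumes A: "A \<in> carrier_mat N N" and B: "B \<in> carrier_mat N N" and N: "0 < N"
  shows "mat_class A \<ltimes> mat_class B = mat_class (A * B)"
proof -
  have "mat_class (A' \<ltimes>\<^sub>M B') = mat_class (A * B)" if h: "A' \<in> mat_class A" "B' \<in> mat_class B" for A' B'
  proof -
    have sim: "(A, A') \<in> mat_sim" "(B, B') \<in> mat_sim" using h by (simp_all add: mem_mat_class_iff)
    then obtain m n where c: "A' \<in> carrier_mat m m" "B' \<in> carrier_mat n n" and pos: "0 < m" "0 < n"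
      by (auto simp: mat_sim_def square_mats_iff)
    let ?t = "lcm m n"
    have t: "0 < ?t" using pos by (simp add: lcm_pos_nat)
    have eq: "A' \<ltimes>\<^sub>M B' = lift_mat ?t A' * lift_mat ?t B'"
      using c by (simp add: mat_stp_def Let_def lift_mat_def)
    have c': "lift_mat ?t A' \<in> carrier_mat ?t ?t" "lift_mat ?t B' \<in> carrier_mat ?t ?t"
      using c by (simp_all add: lift_mat_carrier)
    have "mat_class (A' \<ltimes>\<^sub>M B') = mat_class (lift_mat (?t * N) (lift_mat ?t A' * lift_mat ?t B'))"
      unfolding eq by (rule mat_class_lift_mat[symmetric, of _ ?t]) (use c' t N in auto)
    also have "lift_mat (?t * N) (lift_mat ?t A' * lift_mat ?t B') = lift_mat (?t * N) A' * lift_mat (?t * N) B'"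
      unfolding lift_mat_mult[OF c'] using c t by (simp add: lift_mat_lift_mat)
    also have "\<dots> = lift_mat (?t * N) A * lift_mat (?t * N) B"
      using mat_simD[OF sim(1) A c(1), of "?t * N"] mat_simD[OF sim(2) B c(2), of "?t * N"] by simp
    also have "\<dots> = lift_mat (?t * N) (A * B)" by (simp add: lift_mat_mult[OF A B])
    also have "mat_class \<dots> = mat_class (A * B)"
      by (rule mat_class_lift_mat[of _ N]) (use A B t N in auto)
    finally show ?thesis .
  qed
  moreover have "(A, B) \<in> mat_class A \<times> mat_class B"
    using A B N by (auto intro!: mat_class_memI square_matsI)
  ultimately show ?thesis unfolding class_stp_def
    by (intro the_elem_image_unique) auto
qed

lemma det_lift_mat:
  fixes A :: "'a::idom mat"
  shows "A \<in> carrier_mat n n \<Longrightarrow> Determinant.det (lift_mat N A) = Determinant.det A ^ (N div n)"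
  by (auto simp: lift_mat_def det_kronecker_one)

lemma mat_Dt_lift_mat:
  fixes A :: "'a::real_normed_field mat"
  assumes A: "A \<in> carrier_mat n n" and N: "n dvd N" "0 < N"
  shows "mat_Dt (lift_mat N A) = mat_Dt A"
proof -
  obtain k where k: "N = n * k" using N by blast
  have pos: "0 < n" "0 < k" using N k by auto
  have "mat_Dt (lift_mat N A) = root (n * k) (norm (Determinant.det A) ^ k)"
    using A lift_mat_carrier[OF A N(1)] pos by (simp add: mat_Dt_def det_lift_mat[OF A] norm_power k)
  also have "\<dots> = mat_Dt A"
    using A pos by (simp add: mat_Dt_def real_root_mult_exp real_root_power_cancel)
  finally show ?thesis .
qed

text \<open>Shows in passing that \<open>mat_Dt\<close> is constant on a class, by comparing two
  representatives at the product of their sizes. From here on membership is a statement on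
  determinants.\<close>

lemma mat_class_in_GL_iff:
  fixes A :: "'a::real_normed_field mat"
  assumes A: "A \<in> carrier_mat n n" and n: "0 < n"
  shows "mat_class A \<in> GL_classes \<longleftrightarrow> Determinant.det A \<noteq> 0"
proof -
  have "mat_Dt B = mat_Dt A" if "B \<in> mat_class A" for B
  proof -
    have sim: "(A, B) \<in> mat_sim" using that by (simp add: mem_mat_class_iff)
    then obtain m where B: "B \<in> carrier_mat m m" "0 < m" by (auto simp: mat_sim_def square_mats_iff)
    have "mat_Dt B = mat_Dt (lift_mat (n * m) B)" using mat_Dt_lift_mat[OF B(1), of "n * m"] B n by simp
    also have "\<dots> = mat_Dt A" using mat_Dt_lift_mat[OF A, of "n * m"] mat_simD[OF sim A B(1), of "n * m"] B n by simp
    finally show ?thesis .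
  qed
  then have "Dt (mat_class A) = mat_Dt A" unfolding Dt_def
    using mat_class_memI[OF square_matsI[OF A n]]
    by (intro the_elem_image_unique) (blast | metis)+
  then show ?thesis
    using A n mat_class_in_Sigma[OF square_matsI[OF A n]]
    by (simp add: GL_classes_def mat_Dt_def)
qed

lemma GL_classesE:
  fixes X :: "'a::real_normed_field mat set"
  assumes "X \<in> GL_classes"
  obtains A n where "0 < n" "A \<in> carrier_mat n n" "Determinant.det A \<noteq> 0" "X = mat_class A"
proof -
  have "X \<in> Sigma_space" using assms by (simp add: GL_classes_def)
  then obtain A n where "0 < n" "A \<in> carrier_mat n n" "X = mat_class A" by (elim Sigma_spaceE)
  then show ?thesis using that mat_class_in_GL_iff assms by metis
qed

section \<open>Inverses and the group structure\<close>

definition mat_inverse_adj :: "'a::field mat \<Rightarrow> 'a mat" where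
  "mat_inverse_adj A = inverse (Determinant.det A) \<cdot>\<^sub>m adj_mat A"

lemma mat_inverse_adj:
  assumes A: "A \<in> carrier_mat n n" and d: "Determinant.det A \<noteq> 0"
  shows "mat_inverse_adj A \<in> carrier_mat n n" "mat_inverse_adj A * A = 1\<^sub>m n"
    "Determinant.det (mat_inverse_adj A) \<noteq> 0"
proof -
  show c: "mat_inverse_adj A \<in> carrier_mat n n" using adj_mat(1)[OF A] by (simp add: mat_inverse_adj_def)
  show e: "mat_inverse_adj A * A = 1\<^sub>m n"
    unfolding mat_inverse_adj_def mult_smult_assoc_mat[OF adj_mat(1)[OF A] A] adj_mat(3)[OF A]
    by (rule eq_matI) (use d in auto)
  show "Determinant.det (mat_inverse_adj A) \<noteq> 0"
    using arg_cong[OF e, of Determinant.det] det_mult[OF c A] by auto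
qed

text \<open>The unit has a representative of every size, so it can be multiplied with a class at the
  size of a given representative.\<close>

lemma mat_class_one: "0 < n \<Longrightarrow> mat_class (1\<^sub>m n) = mat_class (1\<^sub>m 1 :: 'a::semiring_1 mat)"
  using mat_class_lift_mat[of "1\<^sub>m 1 :: 'a mat" 1 n] kronecker_one_one[of 1 n, where 'a = 'a]
  by (simp add: lift_mat_def)

lemma GL_group_simps [simp]:
  "carrier GL_group = GL_classes" "mult GL_group = (\<ltimes>)" "one GL_group = mat_class (1\<^sub>m 1)"
  by (simp_all add: GL_group_def)

lemma GL_left_inverse:
  fixes A :: "'a::real_normed_field mat"
  assumes "A \<in> carrier_mat n n" "0 < n" "Determinant.det A \<noteq> 0"
  shows "mat_class (mat_inverse_adj A) \<ltimes> mat_class A = mat_class (1\<^sub>m 1)"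
  using class_stp_mat_class[OF mat_inverse_adj(1)[OF assms(1,3)] assms(1,2)] mat_class_one[OF assms(2), where 'a = 'a]
  by (simp add: mat_inverse_adj(2)[OF assms(1,3)])

lemma group_GL_group: "group (GL_group :: 'a::real_normed_field mat set monoid)"
proof (rule groupI)
  fix X Y :: "'a mat set" assume XY: "X \<in> carrier GL_group" "Y \<in> carrier GL_group"
  then have "X \<in> Sigma_space" "Y \<in> Sigma_space" by (auto simp: GL_classes_def)
  then obtain N A B where N: "0 < N" and AB: "A \<in> carrier_mat N N" "B \<in> carrier_mat N N"
    "X = mat_class A" "Y = mat_class B" using Sigma_space_common_size[of X Y] by metis
  then have "Determinant.det (A * B) \<noteq> 0"
    using XY by (simp add: mat_class_in_GL_iff[OF _ N] det_mult)
  then show "X \<otimes>\<^bsub>GL_group\<^esub> Y \<in> carrier GL_group"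
    using AB N by (simp add: class_stp_mat_class mat_class_in_GL_iff[of _ N])
next
  show "\<one>\<^bsub>GL_group\<^esub> \<in> carrier (GL_group :: 'a mat set monoid)"
    by (simp add: mat_class_in_GL_iff[of _ 1])
next
  fix X Y Z :: "'a mat set"
  assume "X \<in> carrier GL_group" "Y \<in> carrier GL_group" "Z \<in> carrier GL_group"
  then have XYZ: "X \<in> Sigma_space" "Y \<in> Sigma_space" "Z \<in> Sigma_space" by (auto simp: GL_classes_def)
  obtain M A B where M: "0 < M" "A \<in> carrier_mat M M" "B \<in> carrier_mat M M" "X = mat_class A" "Y = mat_class B"
    using Sigma_space_common_size[OF XYZ(1,2)] .
  obtain n C where n: "0 < n" "C \<in> carrier_mat n n" "Z = mat_class C" using XYZ(3) by (elim Sigma_spaceE)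
  let ?N = "M * n"
  have N: "0 < ?N" using M n by simp
  define A' B' C' where d: "A' = lift_mat ?N A" "B' = lift_mat ?N B" "C' = lift_mat ?N C"
  have c: "A' \<in> carrier_mat ?N ?N" "B' \<in> carrier_mat ?N ?N" "C' \<in> carrier_mat ?N ?N"
    using M n by (simp_all add: d lift_mat_carrier)
  have "X = mat_class A'" "Y = mat_class B'" "Z = mat_class C'"
    using M n by (simp_all add: d mat_class_lift_mat)
  then show "X \<otimes>\<^bsub>GL_group\<^esub> Y \<otimes>\<^bsub>GL_group\<^esub> Z = X \<otimes>\<^bsub>GL_group\<^esub> (Y \<otimes>\<^bsub>GL_group\<^esub> Z)"
    using c N by (simp add: class_stp_mat_class[of _ ?N])
next
  fix X :: "'a mat set" assume "X \<in> carrier GL_group"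
  then obtain A n where A: "0 < n" "A \<in> carrier_mat n n" "Determinant.det A \<noteq> 0" "X = mat_class A"
    by (auto elim: GL_classesE)
  show "\<one>\<^bsub>GL_group\<^esub> \<otimes>\<^bsub>GL_group\<^esub> X = X"
    using A class_stp_mat_class[of "1\<^sub>m n" n A] mat_class_one[OF A(1), where 'a = 'a] by simp
  show "\<exists>Y\<in>carrier GL_group. Y \<otimes>\<^bsub>GL_group\<^esub> X = \<one>\<^bsub>GL_group\<^esub>"
    using A GL_left_inverse[of A n] mat_inverse_adj[OF A(2,3)]
    by (intro bexI[of _ "mat_class (mat_inverse_adj A)"]) (simp_all add: mat_class_in_GL_iff[OF _ A(1)])
qed

lemma GL_group_inverse:
  fixes A :: "'a::real_normed_field mat"
  assumes A: "A \<in> carrier_mat n n" "0 < n" "Determinant.det A \<noteq> 0"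
  shows "inv\<^bsub>GL_group\<^esub> (mat_class A) = mat_class (mat_inverse_adj A)"
proof (rule group.inv_equality[OF group_GL_group])
  show "mat_class (mat_inverse_adj A) \<otimes>\<^bsub>GL_group\<^esub> mat_class A = \<one>\<^bsub>GL_group\<^esub>"
    using GL_left_inverse[OF A] by simp
qed (use assms mat_inverse_adj[OF A(1,3)] in \<open>simp_all add: mat_class_in_GL_iff[OF _ A(2)]\<close>)

text \<open>No factorisation \<open>A = B \<otimes>\<^sub>K 1\<^sub>m k\<close> with
  \<open>k > 1\<close>. Stated through \<open>scalar_blocks\<close> so that, at a fixed positive
  size, it is a finite conjunction of open conditions on the entries.\<close>

definition irreducible_mat :: "'a::semiring_1 mat \<Rightarrow> bool" where
  "irreducible_mat A \<longleftrightarrow> (\<forall>k. 1 < k \<and> k dvd dim_row A \<longrightarrow> \<not> scalar_blocks k A)"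

text \<open>A reducible matrix can be stripped of a factor \<open>1\<^sub>m k\<close>, which makes
  it strictly smaller without leaving its class.\<close>

lemma mat_class_irreducible:
  assumes A: "A \<in> carrier_mat n n" "0 < n"
  obtains d B where "0 < d" "B \<in> carrier_mat d d" "irreducible_mat B" "mat_class B = mat_class A"
proof -
  have "\<exists>d B. 0 < d \<and> B \<in> carrier_mat d d \<and> irreducible_mat B \<and> mat_class B = mat_class A"
    using A
  proof (induction n arbitrary: A rule: less_induct)
    case (less n)
    show ?case
    proof (cases "irreducible_mat A")
      case False
      then obtain k where k: "1 < k" "k dvd n" "scalar_blocks k A"
        using less.prems by (auto simp: irreducible_mat_def)
      then obtain m where m: "n = m * k" by (metis dvd_div_mult_self)
      then obtain B where B: "B \<in> carrier_mat m m" "A = B \<otimes>\<^sub>K 1\<^sub>m k"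
        using scalar_blocks_iff[of A m k m] k less.prems by auto
      have m0: "0 < m" "m < n" using m k less.prems by auto
      have "A = lift_mat n B" using B m m0 by (simp add: lift_mat_def)
      then have "mat_class A = mat_class B" using mat_class_lift_mat[OF B(1), of n] m less.prems by simp
      then show ?thesis using less.IH[OF m0(2) B(1) m0(1)] by simp
    qed (use less.prems in blast)
  qed
  then show ?thesis using that by blast
qed

text \<open>At the common size \<open>m * p = n * q\<close> the lift consists of scalar blocks of
  sizes \<open>p\<close> and \<open>q\<close>, hence of size \<open>lcm p q\<close>. Cancelling
  \<open>q\<close> exhibits \<open>B\<close> as a product with an identity of size
  \<open>lcm p q div q\<close>. Irreducibility makes this number \<open>1\<close>, so
  \<open>p\<close> divides \<open>q\<close>, and cancelling \<open>p\<close> writes \<open>A\<close>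
  as a lift of \<open>B\<close>.\<close>

lemma irreducible_mat_sim:
  assumes B: "B \<in> carrier_mat n n" "0 < n" "irreducible_mat B"
    and A: "A \<in> carrier_mat m m" and sim: "(A, B) \<in> mat_sim"
  shows "n dvd m \<and> A = lift_mat m B"
proof -
  have m: "0 < m" using sim A by (auto simp: mat_sim_def square_mats_iff)
  let ?N = "lcm m n"
  have N: "0 < ?N" using m B by (simp add: lcm_pos_nat)
  obtain p q where p: "?N = m * p" and q: "?N = n * q" by (meson dvd_def dvd_lcm1 dvd_lcm2)
  have pq: "0 < p" "0 < q" using N p q by (metis gr0I mult_0_right less_irrefl)+
  define M where "M = lift_mat ?N A"
  have MB': "M = lift_mat ?N B" unfolding M_def by (rule mat_simD[OF sim A B(1)]) auto
  have "?N div m = p" "?N div n = q" using p q m B(2) by (metis nonzero_mult_div_cancel_left less_irrefl)+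
  then have MA: "M = A \<otimes>\<^sub>K 1\<^sub>m p" and MB: "M = B \<otimes>\<^sub>K 1\<^sub>m q"
    using A B MB' by (simp_all add: M_def lift_mat_def)
  have Mc: "M \<in> carrier_mat ?N ?N" unfolding M_def by (rule lift_mat_carrier[OF A]) simp
  have "scalar_blocks p M"
    using scalar_blocks_iff[of M m p m] Mc[unfolded p] pq(1) MA A by blast
  moreover have "scalar_blocks q M"
    using scalar_blocks_iff[of M n q n] Mc[unfolded q] pq(2) MB B(1) by blast
  ultimately have sb: "scalar_blocks (lcm p q) M" using pq by (rule_tac scalar_blocks_lcm) auto
  have "lcm p q dvd ?N" using p q by (metis dvd_triv_right lcm_least)
  then obtain g where g: "?N = g * lcm p q" by (metis dvd_div_mult_self)
  obtain \<Lambda> where \<Lambda>: "\<Lambda> \<in> carrier_mat g g" "M = \<Lambda> \<otimes>\<^sub>K 1\<^sub>m (lcm p q)"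
    using scalar_blocks_iff[of M g "lcm p q" g] sb Mc g pq by (auto simp: lcm_pos_nat)
  obtain k where k: "lcm p q = k * q" by (metis dvd_lcm2 dvd_div_mult_self)
  have gk: "n = g * k" using g q k pq by (metis mult.assoc mult_cancel2 less_irrefl)
  have "(\<Lambda> \<otimes>\<^sub>K 1\<^sub>m k) \<otimes>\<^sub>K 1\<^sub>m q = B \<otimes>\<^sub>K 1\<^sub>m q"
    using \<Lambda> MB k by (simp add: kronecker_one_assoc)
  then have BL: "\<Lambda> \<otimes>\<^sub>K 1\<^sub>m k = B"
    by (rule kronecker_one_inject[OF _ _ pq(2), of _ n n, rotated 2]) (use \<Lambda> gk B in auto)
  have k0: "0 < k" using gk B by (auto intro: gr0I)
  then have "scalar_blocks k B" using scalar_blocks_iff[of B g k g] \<Lambda> BL B gk by auto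
  moreover have "k dvd dim_row B" using B gk by auto
  ultimately have "\<not> 1 < k" using B(3) unfolding irreducible_mat_def by blast
  then have "k = 1" using k0 by linarith
  then have "p dvd q" using k by (metis dvd_lcm1 mult_1)
  then obtain c where c: "q = p * c" by blast
  have "m * p = n * q" unfolding p[symmetric] by (rule q)
  then have "m * p = (n * c) * p" unfolding c by (simp only: mult.assoc mult.commute[of p])
  then have m_eq: "m = n * c" using pq(1) by (simp only: mult_cancel2) auto
  have "A \<otimes>\<^sub>K 1\<^sub>m p = (B \<otimes>\<^sub>K 1\<^sub>m c) \<otimes>\<^sub>K 1\<^sub>m p"
    using MA MB c B by (simp add: kronecker_one_assoc mult.commute)
  then have "A = B \<otimes>\<^sub>K 1\<^sub>m c"
    by (rule kronecker_one_inject[OF _ _ pq(1), of _ m m, rotated 2]) (use A B m_eq in auto)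
  then show ?thesis using m_eq B by (auto simp: lift_mat_def)
qed

section \<open>The topology of the space of classes\<close>

text \<open>Inverse to \<open>mat_coords n\<close>, but defined on all sequences and reading only
  the first \<open>n * n * DIM('a)\<close> terms. Continuity can thus be argued on
  \<open>UNIV\<close> in the product topology.\<close>

definition mat_of_coords :: "nat \<Rightarrow> (nat \<Rightarrow> real) \<Rightarrow> 'a::euclidean_space mat" where
  "mat_of_coords n x = Matrix.mat n n (\<lambda>(i, j).
     \<Sum>d<DIM('a). x ((i * n + j) * DIM('a) + d) *\<^sub>R from_nat_into Basis d)"

lemma mat_of_coords_carrier [simp]: "mat_of_coords n x \<in> carrier_mat n n"
  by (simp add: mat_of_coords_def)

lemma mat_of_coords_dim [simp]: "dim_row (mat_of_coords n x) = n" "dim_col (mat_of_coords n x) = n"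
  by (simp_all add: mat_of_coords_def)

lemma mat_of_coords_index:
  "i < n \<Longrightarrow> j < n \<Longrightarrow> mat_of_coords n x $$ (i, j) =
    (\<Sum>d<DIM('a). x ((i * n + j) * DIM('a) + d) *\<^sub>R (from_nat_into Basis d :: 'a::euclidean_space))"
  by (simp add: mat_of_coords_def)

lemma bij_from_nat_into_Basis:
  "bij_betw (from_nat_into Basis) {..<DIM('a)} (Basis :: 'a::euclidean_space set)"
  by (rule bij_betw_from_nat_into_finite) simp

lemma from_nat_into_Basis [simp]: "from_nat_into Basis d \<in> (Basis :: 'a::euclidean_space set)"
  by (rule from_nat_into) simp

lemma inner_from_nat_into_Basis:
  assumes "d < DIM('a)" "e < DIM('a)"
  shows "(from_nat_into Basis d :: 'a::euclidean_space) \<bullet> from_nat_into Basis e = (if d = e then 1 else 0)"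
  using assms bij_betw_imp_inj_on[OF bij_from_nat_into_Basis[where 'a = 'a]]
  by (auto simp: inner_Basis inj_on_def)

lemma mat_coords_in_topspace [simp]:
  "mat_coords n (A :: 'a::euclidean_space mat) \<in> topspace (Euclidean_space (n * n * DIM('a)))"
  by (simp add: topspace_Euclidean_space mat_coords_def)

lemma mat_index_less: "i < n \<Longrightarrow> j < n \<Longrightarrow> d < D \<Longrightarrow> (i * n + j) * D + d < n * n * (D::nat)"
proof -
  assume h: "i < n" "j < n" "d < D"
  have "i * n + j < Suc i * n" using h by simp
  also have "\<dots> \<le> n * n" using h by (intro mult_le_mono1) simp
  finally have "Suc (i * n + j) * D \<le> n * n * D" by (intro mult_le_mono1) simp
  then show ?thesis using h by simp
qed

lemma mat_coords_index:
  assumes "i < n" "j < n" "d < DIM('a)"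
  shows "mat_coords n (A :: 'a::euclidean_space mat) ((i * n + j) * DIM('a) + d) =
    A $$ (i, j) \<bullet> from_nat_into Basis d"
  using assms mat_index_less[OF assms] by (simp add: mat_coords_def)

text \<open>Agreement is demanded only on the coordinates that are read, so that the lemma also
  serves for joined coordinate vectors and for finite lists of rationals.\<close>

lemma mat_of_coords_mat_coords:
  fixes A :: "'a::euclidean_space mat"
  assumes A: "A \<in> carrier_mat n n" and x: "\<And>k. k < n * n * DIM('a) \<Longrightarrow> x k = mat_coords n A k"
  shows "mat_of_coords n x = A"
proof (rule eq_matI)
  fix i j assume "i < dim_row A" "j < dim_col A"
  then have ij: "i < n" "j < n" using A by auto
  have "(mat_of_coords n x :: 'a mat) $$ (i, j) =
      (\<Sum>d<DIM('a). (A $$ (i, j) \<bullet> from_nat_into Basis d) *\<^sub>R from_nat_into Basis d)"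
    unfolding mat_of_coords_index[OF ij]
    by (intro sum.cong) (simp_all add: x mat_index_less[OF ij] mat_coords_index[OF ij])
  also have "\<dots> = (\<Sum>b\<in>Basis. (A $$ (i, j) \<bullet> b) *\<^sub>R b)"
    by (rule sum.reindex_bij_betw[OF bij_from_nat_into_Basis])
  finally show "mat_of_coords n x $$ (i, j) = A $$ (i, j)" by (simp add: euclidean_representation)
qed (use A in auto)

lemma mat_coords_mat_of_coords:
  fixes n :: nat
  assumes x: "x \<in> topspace (Euclidean_space (n * n * DIM('a)))"
  shows "mat_coords n (mat_of_coords n x :: 'a::euclidean_space mat) = x"
proof
  fix k show "mat_coords n (mat_of_coords n x :: 'a mat) k = x k"
  proof (cases "k < n * n * DIM('a)")
    case False
    then show ?thesis using x by (simp add: mat_coords_def topspace_Euclidean_space)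
  next
    case True
    define i j d where ijd: "i = k div DIM('a) div n" "j = k div DIM('a) mod n" "d = k mod DIM('a)"
    have n: "0 < n" using True by (cases n) auto
    have "k div DIM('a) < n * n" using True by (rule less_mult_imp_div_less)
    then have lt: "i < n" "j < n" "d < DIM('a)" using n by (auto simp: ijd less_mult_imp_div_less)
    have k: "k = (i * n + j) * DIM('a) + d" by (simp add: ijd)
    have "mat_coords n (mat_of_coords n x :: 'a mat) k =
        (\<Sum>e<DIM('a). x ((i * n + j) * DIM('a) + e) * ((from_nat_into Basis e :: 'a) \<bullet> from_nat_into Basis d))"
      unfolding k mat_coords_index[OF lt] mat_of_coords_index[OF lt(1,2)] by (simp add: inner_sum_left)
    also have "\<dots> = (\<Sum>e<DIM('a). if e = d then x ((i * n + j) * DIM('a) + e) else 0)"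
      using lt by (intro sum.cong) (auto simp: inner_from_nat_into_Basis)
    also have "\<dots> = x k" using lt by (simp add: k)
    finally show ?thesis .
  qed
qed

lemma mat_coords_image:
  "mat_coords n ` {A \<in> carrier_mat n n. P A} =
    {x \<in> topspace (Euclidean_space (n * n * DIM('a))). P (mat_of_coords n x :: 'a::euclidean_space mat)}"
proof (intro equalityI subsetI)
  fix x assume "x \<in> mat_coords n ` {A \<in> carrier_mat n n. P A}"
  then obtain A :: "'a mat" where A: "A \<in> carrier_mat n n" "P A" "x = mat_coords n A" by blast
  then have "mat_of_coords n x = A" using mat_of_coords_mat_coords by blast
  then show "x \<in> {x \<in> topspace (Euclidean_space (n * n * DIM('a))). P (mat_of_coords n x :: 'a mat)}"
    using A by simp
next
  fix x assume x: "x \<in> {x \<in> topspace (Euclidean_space (n * n * DIM('a))). P (mat_of_coords n x :: 'a mat)}"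
  then show "x \<in> mat_coords n ` {A \<in> carrier_mat n n. P A}"
    using mat_coords_mat_of_coords[where 'a = 'a, of x n] by (intro image_eqI[of _ _ "mat_of_coords n x"]) auto
qed

lemma mat_coords_inject:
  "A \<in> carrier_mat n n \<Longrightarrow> B \<in> carrier_mat n n \<Longrightarrow> mat_coords n A = mat_coords n B \<Longrightarrow> A = B"
  using mat_of_coords_mat_coords by metis

text \<open>Openness is expressed in the same Euclidean space that is the target of the
  charts.\<close>

definition open_mats :: "nat \<Rightarrow> 'a::euclidean_space mat set \<Rightarrow> bool" where
  "open_mats n S \<longleftrightarrow> S \<subseteq> carrier_mat n n \<and> openin (Euclidean_space (n * n * DIM('a))) (mat_coords n ` S)"

lemma open_matsI:
  assumes "open {x. P (mat_of_coords n x :: 'a::euclidean_space mat)}"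
  shows "open_mats n {A \<in> carrier_mat n n. P A}"
  using assms unfolding open_mats_def mat_coords_image openin_Euclidean_space_iff by auto

lemma open_mats_Int: "open_mats n S \<Longrightarrow> open_mats n T \<Longrightarrow> open_mats n (S \<inter> T)"
  unfolding open_mats_def
  by (subst inj_on_image_Int[of _ "carrier_mat n n"]) (auto intro: inj_onI mat_coords_inject)

lemma open_mats_Union: "(\<And>S. S \<in> K \<Longrightarrow> open_mats n S) \<Longrightarrow> open_mats n (\<Union>K)"
  unfolding open_mats_def image_Union by (auto intro: openin_Union)

lemma open_mats_empty: "open_mats n {}"
  by (simp add: open_mats_def)

lemma continuous_on_mat_of_coords:
  assumes "i < n" "j < n"
  shows "continuous_on UNIV (\<lambda>x. (mat_of_coords n x :: 'a::euclidean_space mat) $$ (i, j))"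
  unfolding mat_of_coords_index[OF assms]
  by (intro continuous_on_sum continuous_on_scaleR continuous_on_const continuous_on_product_coordinates)

lemma open_mats_carrier: "open_mats n (carrier_mat n n :: 'a::euclidean_space mat set)"
  using open_matsI[of "\<lambda>_ :: 'a mat. True" n] by simp

lemma open_mats_det:
  "open_mats n {A \<in> carrier_mat n n. Determinant.det A \<noteq> (0 :: 'a::{real_normed_field, euclidean_space})}"
proof (rule open_matsI)
  have "continuous_on UNIV (\<lambda>x. Determinant.det (mat_of_coords n x :: 'a mat))"
    unfolding det_def'[OF mat_of_coords_carrier]
    by (intro continuous_on_sum continuous_on_mult continuous_on_const continuous_on_prod continuous_on_mat_of_coords)
      (auto simp: permutes_in_image)
  then show "open {x. Determinant.det (mat_of_coords n x :: 'a mat) \<noteq> 0}"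
    by (intro open_Collect_neq continuous_on_const)
qed

text \<open>Having scalar blocks of size \<open>k\<close> is a finite system of equations between
  continuous entries, so its failure is open; and a positive \<open>n\<close> has only finitely many
  divisors.\<close>

lemma open_mats_irreducible:
  assumes n: "0 < n"
  shows "open_mats n {A \<in> carrier_mat n n. irreducible_mat (A :: 'a::{real_normed_field, euclidean_space} mat)}"
proof (rule open_matsI)
  have "open {x. \<not> scalar_blocks k (mat_of_coords n x :: 'a mat)}" if "1 < k" for k
  proof -
    have div: "i div k * k < n" if "i < n" for i using div_mult_less[OF _ that] \<open>1 < k\<close> by simp
    have eq: "{x. \<not> scalar_blocks k (mat_of_coords n x :: 'a mat)} = (\<Union>i\<in>{..<n}. \<Union>j\<in>{..<n}.
        {x. (mat_of_coords n x :: 'a mat) $$ (i, j) \<noteq> (if i mod k = j mod k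
          then (mat_of_coords n x :: 'a mat) $$ (i div k * k, j div k * k) else 0)})"
      unfolding scalar_blocks_def by (auto simp del: mod_mod_trivial)
    show ?thesis unfolding eq
    proof (intro open_UN ballI open_Collect_neq)
      fix i j assume ij: "i \<in> {..<n}" "j \<in> {..<n}"
      then show "continuous_on UNIV (\<lambda>x. (mat_of_coords n x :: 'a mat) $$ (i, j))"
        by (intro continuous_on_mat_of_coords) auto
      show "continuous_on UNIV (\<lambda>x. if i mod k = j mod k
          then (mat_of_coords n x :: 'a mat) $$ (i div k * k, j div k * k) else 0)"
        using ij div by (cases "i mod k = j mod k") (auto intro: continuous_on_mat_of_coords)
    qed
  qed
  then have "open (\<Inter>k\<in>{k. 1 < k \<and> k dvd n}. {x. \<not> scalar_blocks k (mat_of_coords n x :: 'a mat)})"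
    using n by (intro open_INT) auto
  moreover have "{x. irreducible_mat (mat_of_coords n x :: 'a mat)} =
      (\<Inter>k\<in>{k. 1 < k \<and> k dvd n}. {x. \<not> scalar_blocks k (mat_of_coords n x :: 'a mat)})"
    by (auto simp: irreducible_mat_def)
  ultimately show "open {x. irreducible_mat (mat_of_coords n x :: 'a mat)}" by simp
qed

text \<open>Every entry of the lift is an entry of \<open>A\<close> or zero, so lifting is
  continuous. For \<open>m = n\<close> this is the openness of balls.\<close>

lemma open_mats_lift_ball:
  fixes C :: "'a::{real_normed_field, euclidean_space} mat"
  assumes n: "0 < n" "n dvd m"
  shows "open_mats n {A \<in> carrier_mat n n. lift_mat m A \<in> mat_ball m C r}"
proof (rule open_matsI)
  obtain k where k: "m = n * k" using n by blast
  have lift: "lift_mat m (mat_of_coords n x) = (mat_of_coords n x :: 'a mat) \<otimes>\<^sub>K 1\<^sub>m k" for x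
    using n k by (simp add: lift_mat_def)
  have cont: "continuous_on UNIV (\<lambda>x. lift_mat m (mat_of_coords n x :: 'a mat) $$ (i, j))"
    if "i < m" "j < m" for i j
  proof -
    have ij: "i < n * k" "j < n * k" using that k by auto
    show ?thesis
      unfolding lift kronecker_one_index[OF mat_of_coords_carrier ij]
      using ij by (cases "i mod k = j mod k") (auto intro: continuous_on_mat_of_coords simp: less_mult_imp_div_less)
  qed
  have "{x. lift_mat m (mat_of_coords n x :: 'a mat) \<in> mat_ball m C r} =
      {x. sqrt (\<Sum>i<m. \<Sum>j<m. (norm (lift_mat m (mat_of_coords n x) $$ (i, j) - C $$ (i, j)))\<^sup>2) < r}"
    using lift_mat_carrier[OF mat_of_coords_carrier n(2)] by (auto simp: mat_ball_def)
  moreover have "open \<dots>"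
    by (intro open_Collect_less continuous_on_real_sqrt continuous_on_sum continuous_on_power
        continuous_on_norm continuous_on_diff continuous_on_const) (auto intro: cont)
  ultimately show "open {x. lift_mat m (mat_of_coords n x :: 'a mat) \<in> mat_ball m C r}" by simp
qed

lemma mat_ball_coord_bound:
  fixes A C :: "'a::{real_normed_field, euclidean_space} mat"
  assumes "A \<in> mat_ball n C r" "k < n * n * DIM('a)"
  shows "\<bar>mat_coords n A k - mat_coords n C k\<bar> < r"
proof -
  define i j d where ijd: "i = k div DIM('a) div n" "j = k div DIM('a) mod n" "d = k mod DIM('a)"
  have n: "0 < n" using assms by (cases n) auto
  have "k div DIM('a) < n * n" using assms(2) by (rule less_mult_imp_div_less)
  then have lt: "i < n" "j < n" using n by (auto simp: ijd less_mult_imp_div_less)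
  have "\<bar>mat_coords n A k - mat_coords n C k\<bar> = \<bar>(A $$ (i, j) - C $$ (i, j)) \<bullet> from_nat_into Basis d\<bar>"
    using assms(2) by (simp add: mat_coords_def ijd inner_diff_left)
  also have "\<dots> \<le> norm (A $$ (i, j) - C $$ (i, j))" by (rule Basis_le_norm) simp
  also have "\<dots> = sqrt ((norm (A $$ (i, j) - C $$ (i, j)))\<^sup>2)" by simp
  also have "\<dots> \<le> sqrt (\<Sum>i<n. \<Sum>j<n. (norm (A $$ (i, j) - C $$ (i, j)))\<^sup>2)"
  proof (rule real_sqrt_le_mono)
    have "(norm (A $$ (i, j) - C $$ (i, j)))\<^sup>2 \<le> (\<Sum>j<n. (norm (A $$ (i, j) - C $$ (i, j)))\<^sup>2)"
      using lt by (intro member_le_sum[of j]) auto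
    also have "\<dots> \<le> (\<Sum>i<n. \<Sum>j<n. (norm (A $$ (i, j) - C $$ (i, j)))\<^sup>2)"
      using lt by (intro member_le_sum[of i]) (auto intro: sum_nonneg)
    finally show "(norm (A $$ (i, j) - C $$ (i, j)))\<^sup>2 \<le> (\<Sum>i<n. \<Sum>j<n. (norm (A $$ (i, j) - C $$ (i, j)))\<^sup>2)" .
  qed
  also have "\<dots> < r" using assms(1) by (simp add: mat_ball_def)
  finally show ?thesis .
qed

lemma mat_ball_commute: "A \<in> carrier_mat n n \<Longrightarrow> C \<in> mat_ball n A r \<Longrightarrow> A \<in> mat_ball n C r"
  by (simp add: mat_ball_def norm_minus_commute)

text \<open>The rational centre is taken close to \<open>A\<close> instead of at \<open>A\<close>,
  while the ball about it must still contain \<open>A\<close>; so the radius is fixed before the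
  centre.\<close>

lemma rational_ball_between:
  fixes A :: "'a::{real_normed_field, euclidean_space} mat"
  assumes S: "open_mats n S" and A: "A \<in> S" and n: "0 < n"
  obtains B where "B \<in> rational_balls n" "A \<in> B" "B \<subseteq> S"
proof -
  let ?p = "n * n * DIM('a)"
  have Ac: "A \<in> carrier_mat n n" using S A by (auto simp: open_mats_def)
  obtain r where r: "0 < r" "\<And>x. x \<in> topspace (Euclidean_space ?p) \<Longrightarrow>
      (\<And>i. i < ?p \<Longrightarrow> \<bar>x i - mat_coords n A i\<bar> < r) \<Longrightarrow> x \<in> mat_coords n ` S"
    using openin_Euclidean_space_contains_box[of ?p "mat_coords n ` S" "mat_coords n A"] S A
    by (auto simp: open_mats_def)
  \<comment> \<open>Half of \<open>r\<close>, because a point of the new ball differs from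
    \<open>A\<close> in two steps, through the centre, each below \<open>q\<close> in every
    coordinate.\<close>
  obtain q where q: "q \<in> \<rat>" "0 < q" "q < r / 2" using Rats_dense_in_real[of 0 "r/2"] r(1) by auto
  have "open_mats n {C \<in> carrier_mat n n. lift_mat n C \<in> mat_ball n A q}"
    by (rule open_mats_lift_ball) (use n in auto)
  moreover have "{C \<in> carrier_mat n n. lift_mat n C \<in> mat_ball n A q} = mat_ball n A q"
    using n by (auto simp: lift_mat_same mat_ball_def)
  ultimately have op: "open_mats n (mat_ball n A q)" by simp
  have "A \<in> mat_ball n A q" using Ac q by (simp add: mat_ball_def)
  then obtain s where s: "0 < s" "\<And>x. x \<in> topspace (Euclidean_space ?p) \<Longrightarrow>
      (\<And>i. i < ?p \<Longrightarrow> \<bar>x i - mat_coords n A i\<bar> < s) \<Longrightarrow> x \<in> mat_coords n ` mat_ball n A q"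
    using openin_Euclidean_space_contains_box[of ?p "mat_coords n ` mat_ball n A q" "mat_coords n A"] op
    by (auto simp: open_mats_def)
  have "\<exists>y\<in>\<rat>. mat_coords n A i < y \<and> y < mat_coords n A i + s" for i
    using Rats_dense_in_real[of "mat_coords n A i" "mat_coords n A i + s"] s(1) by auto
  then obtain y where y: "\<And>i. y i \<in> \<rat>" "\<And>i. mat_coords n A i < y i" "\<And>i. y i < mat_coords n A i + s" by metis
  \<comment> \<open>Rational in the coordinates of the matrix and zero beyond, so that it lies in
    the Euclidean space.\<close>
  define c where "c i = (if i < ?p then y i else 0)" for i
  have ct: "c \<in> topspace (Euclidean_space ?p)" by (simp add: c_def topspace_Euclidean_space)
  have "\<bar>c i - mat_coords n A i\<bar> < s" if "i < ?p" for i
    using y(2,3)[of i] that by (simp add: c_def abs_if)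
  from s(2)[OF ct this] obtain C where C: "C \<in> mat_ball n A q" "c = mat_coords n C" by blast
  have Cc: "C \<in> carrier_mat n n" using C by (simp add: mat_ball_def)
  have rat: "rational_mat C" unfolding rational_mat_def
  proof (intro allI impI ballI)
    fix i j and b :: 'a assume ijb: "i < dim_row C" "j < dim_col C" "b \<in> Basis"
    then obtain d where d: "d < DIM('a)" "b = from_nat_into Basis d"
      using bij_from_nat_into_Basis[where 'a = 'a] by (auto simp: bij_betw_def)
    have ij: "i < n" "j < n" using ijb Cc by auto
    have "C $$ (i, j) \<bullet> b = c ((i * n + j) * DIM('a) + d)"
      using mat_coords_index[OF ij d(1), of C] by (simp add: C(2) d(2))
    then show "C $$ (i, j) \<bullet> b \<in> \<rat>" using y(1) by (simp add: c_def)
  qed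
  have sub: "mat_ball n C q \<subseteq> S"
  proof
    fix B assume B: "B \<in> mat_ball n C q"
    have "\<bar>mat_coords n B i - mat_coords n A i\<bar> < r" if "i < ?p" for i
      using mat_ball_coord_bound[OF B that] mat_ball_coord_bound[OF C(1) that] q(3) by linarith
    from r(2)[OF mat_coords_in_topspace this] obtain B' where "B' \<in> S" "mat_coords n B = mat_coords n B'" by blast
    moreover have "B \<in> carrier_mat n n" "B' \<in> carrier_mat n n"
      using B \<open>B' \<in> S\<close> S by (auto simp: mat_ball_def open_mats_def)
    ultimately show "B \<in> S" using mat_coords_inject by metis
  qed
  show ?thesis
    by (rule that[of "mat_ball n C q", OF _ mat_ball_commute[OF Ac C(1)] sub])
       (use rat Cc q in \<open>auto simp: rational_balls_def\<close>)
qed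

text \<open>Meeting a set commutes with unions, and \<open>S\<close> is a union of balls with
  rational data; so arbitrary open sets of matrices may take the place of the balls in the
  sub-basis.\<close>

lemma openin_Sigma_classes_meeting:
  fixes S :: "'a::{real_normed_field, euclidean_space} mat set"
  assumes S: "open_mats n S" and n: "0 < n"
  shows "openin Sigma_topology (classes_meeting S)"
proof -
  have "classes_meeting S = \<Union> (classes_meeting ` {B \<in> rational_balls n. B \<subseteq> S})"
  proof (intro equalityI subsetI)
    fix X assume X: "X \<in> classes_meeting S"
    then obtain A where A: "A \<in> X" "A \<in> S" by (auto simp: classes_meeting_def)
    obtain B where B: "B \<in> rational_balls n" "A \<in> B" "B \<subseteq> S" by (rule rational_ball_between[OF S A(2) n])
    then show "X \<in> \<Union> (classes_meeting ` {B \<in> rational_balls n. B \<subseteq> S})"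
      using X A by (auto simp: classes_meeting_def intro!: bexI[of _ B])
  qed (auto simp: classes_meeting_def)
  moreover have "openin Sigma_topology (\<Union> (classes_meeting ` {B \<in> rational_balls n. B \<subseteq> S}))"
    unfolding Sigma_topology_def
    by (intro openin_Union) (use n in \<open>auto intro!: topology_generated_by_Basis bexI[of _ n]\<close>)
  ultimately show ?thesis by simp
qed

text \<open>All matrices equivalent to an irreducible one are its lifts, so the only representative
  of size \<open>m\<close> that can lie in \<open>S\<close> is \<open>lift_mat m A\<close>.\<close>

lemma irreducible_class_meets:
  assumes A: "A \<in> carrier_mat n n" "0 < n" "irreducible_mat A" and S: "S \<subseteq> carrier_mat m m" and m: "0 < m"
  shows "mat_class A \<in> classes_meeting S \<longleftrightarrow> n dvd m \<and> lift_mat m A \<in> S"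
proof
  assume "mat_class A \<in> classes_meeting S"
  then obtain B where B: "B \<in> mat_class A" "B \<in> S" by (auto simp: classes_meeting_def)
  have "(A, B) \<in> mat_sim" using B by (simp add: mem_mat_class_iff)
  then have "(B, A) \<in> mat_sim" using equiv_mat_sim by (auto simp: equiv_def sym_def)
  then have "n dvd m \<and> B = lift_mat m A" using irreducible_mat_sim[OF A, of B m] B(2) S by blast
  then show "n dvd m \<and> lift_mat m A \<in> S" using B by simp
next
  assume h: "n dvd m \<and> lift_mat m A \<in> S"
  then have c: "lift_mat m A \<in> carrier_mat m m" using S by blast
  then have "lift_mat m A \<in> mat_class (lift_mat m A)" by (intro mat_class_memI square_matsI[OF _ m])
  then have "lift_mat m A \<in> mat_class A" using mat_class_lift_mat[OF A(1), of m] h m by simp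
  then show "mat_class A \<in> classes_meeting S"
    using h mat_class_in_Sigma[OF square_matsI[OF A(1,2)]] by (auto simp: classes_meeting_def)
qed

text \<open>Induction over the generation of the topology. The trace of a generator of size
  \<open>m\<close> is empty unless \<open>n\<close> divides \<open>m\<close>, and then it is the
  irreducible part of the preimage of a ball under lifting. Without irreducibility, a generator
  whose size is a proper divisor of \<open>n\<close> would leave only matrices with scalar blocks,
  which form no open set.\<close>

lemma open_mats_of_openin_Sigma:
  fixes U :: "'a::{real_normed_field, euclidean_space} mat set set"
  assumes "openin Sigma_topology U" and n: "0 < n"
  shows "open_mats n {A \<in> carrier_mat n n. irreducible_mat A \<and> mat_class A \<in> U}"
  using assms(1) unfolding Sigma_topology_def openin_topology_generated_by_iff
proof (induction rule: generate_topology_on.induct)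
  case Empty then show ?case by (simp add: open_mats_empty)
next
  case (Int a b)
  have "{A \<in> carrier_mat n n. irreducible_mat A \<and> mat_class A \<in> a \<inter> b} =
      {A \<in> carrier_mat n n. irreducible_mat A \<and> mat_class A \<in> a} \<inter> {A \<in> carrier_mat n n. irreducible_mat A \<and> mat_class A \<in> b}"
    by auto
  then show ?case using Int by (simp add: open_mats_Int)
next
  case (UN K)
  have "{A \<in> carrier_mat n n. irreducible_mat A \<and> mat_class A \<in> \<Union>K} =
      \<Union> ((\<lambda>k. {A \<in> carrier_mat n n. irreducible_mat A \<and> mat_class A \<in> k}) ` K)" by auto
  then show ?case using UN by (auto intro!: open_mats_Union)
next
  case (Basis s)
  then obtain m C r where m: "0 < m" and s: "s = classes_meeting (mat_ball m C r)"
    by (auto simp: rational_balls_def Suc_le_eq)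
  have sub: "mat_ball m C r \<subseteq> carrier_mat m m" by (auto simp: mat_ball_def)
  have eq: "{A \<in> carrier_mat n n. irreducible_mat A \<and> mat_class A \<in> s} =
      (if n dvd m then {A \<in> carrier_mat n n. irreducible_mat A} \<inter> {A \<in> carrier_mat n n. lift_mat m A \<in> mat_ball m C r} else {})"
    unfolding s using irreducible_class_meets[OF _ n _ sub m] by auto
  show ?case unfolding eq
    by (auto intro: open_mats_Int open_mats_irreducible[OF n] open_mats_lift_ball[OF n] open_mats_empty)
qed

section \<open>Separation and countability\<close>

lemma topspace_Sigma_topology:
  "topspace (Sigma_topology :: 'a::{real_normed_field, euclidean_space} mat set topology) = Sigma_space"
proof (intro equalityI subsetI)
  fix X :: "'a mat set" assume "X \<in> topspace Sigma_topology"
  then show "X \<in> Sigma_space" by (auto simp: Sigma_topology_def classes_meeting_def)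
next
  fix X :: "'a mat set" assume X: "X \<in> Sigma_space"
  then obtain A n where A: "0 < n" "A \<in> carrier_mat n n" "X = mat_class A" by (elim Sigma_spaceE)
  then have "X \<in> classes_meeting (carrier_mat n n)"
    using X mat_class_memI[OF square_matsI[OF A(2,1)]] by (auto simp: classes_meeting_def)
  then show "X \<in> topspace Sigma_topology"
    using openin_subset[OF openin_Sigma_classes_meeting[OF open_mats_carrier A(1), where 'a = 'a]] by blast
qed

text \<open>Distinct classes have distinct representatives of a common size \<open>N\<close>, which
  differ in some real coordinate; a threshold between the two values separates them. The two open
  sets are disjoint because a class has at most one representative of size \<open>N\<close>.\<close>

lemma Hausdorff_Sigma_topology:
  "Hausdorff_space (Sigma_topology :: 'a::{real_normed_field, euclidean_space} mat set topology)"
  unfolding Hausdorff_space_def topspace_Sigma_topology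
proof (intro allI impI, elim conjE)
  fix X Y :: "'a mat set" assume XY: "X \<in> Sigma_space" "Y \<in> Sigma_space" "X \<noteq> Y"
  obtain N A B where N: "0 < N" and AB: "A \<in> carrier_mat N N" "B \<in> carrier_mat N N" "X = mat_class A" "Y = mat_class B"
    using Sigma_space_common_size[OF XY(1,2)] .
  have mem: "A \<in> X" "B \<in> Y" using AB N by (auto intro!: mat_class_memI square_matsI)
  have "mat_coords N A \<noteq> mat_coords N B" using XY(3) AB mat_coords_inject by metis
  then obtain k where k: "mat_coords N A k \<noteq> mat_coords N B k" by blast
  then have kp: "k < N * N * DIM('a)" by (auto simp: mat_coords_def split: if_splits)
  have cont: "continuous_on UNIV (\<lambda>x. mat_coords N (mat_of_coords N x :: 'a mat) k)"
  proof -
    have "k div DIM('a) < N * N" using kp by (rule less_mult_imp_div_less)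
    then have lt: "k div DIM('a) div N < N" "k div DIM('a) mod N < N" using N by (auto simp: less_mult_imp_div_less)
    show ?thesis using kp
      by (simp add: mat_coords_def, intro continuous_on_inner continuous_on_const continuous_on_mat_of_coords lt)
  qed
  define c where "c = (mat_coords N A k + mat_coords N B k) / 2"
  define L where "L = {M \<in> carrier_mat N N. mat_coords N (M :: 'a mat) k < c}"
  define R where "R = {M \<in> carrier_mat N N. c < mat_coords N (M :: 'a mat) k}"
  have "open_mats N L" "open_mats N R" unfolding L_def R_def
    by (intro open_matsI open_Collect_less cont continuous_on_const)+
  then have op: "openin Sigma_topology (classes_meeting L)" "openin Sigma_topology (classes_meeting R)"
    using openin_Sigma_classes_meeting N by blast+
  have disj: "classes_meeting L \<inter> classes_meeting R = {}"
  proof -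
    have False if Z: "Z \<in> Sigma_space" "P \<in> Z" "Q \<in> Z" "P \<in> L" "Q \<in> R" for Z P Q
    proof -
      have "mat_class P = mat_class Q" using Sigma_space_eq_mat_class(2) Z by metis
      then have "P = Q" using Z N by (intro mat_class_inject[of P N Q]) (auto simp: L_def R_def)
      then show False using Z by (auto simp: L_def R_def)
    qed
    then show ?thesis by (auto simp: classes_meeting_def)
  qed
  consider "A \<in> L \<and> B \<in> R" | "A \<in> R \<and> B \<in> L"
    using k AB by (cases "mat_coords N A k < mat_coords N B k") (auto simp: L_def R_def c_def)
  then show "\<exists>U V. openin Sigma_topology U \<and> openin Sigma_topology V \<and> X \<in> U \<and> Y \<in> V \<and> disjnt U V"
  proof cases
    case 1
    then have "X \<in> classes_meeting L" "Y \<in> classes_meeting R" using XY mem by (auto simp: classes_meeting_def)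
    then show ?thesis using op disj unfolding disjnt_def by blast
  next
    case 2
    then have "X \<in> classes_meeting R" "Y \<in> classes_meeting L" using XY mem by (auto simp: classes_meeting_def)
    then show ?thesis using op disj unfolding disjnt_def by blast
  qed
qed

lemma second_countable_topology_generated_by:
  assumes S: "countable S"
  shows "second_countable (topology_generated_by S)"
  unfolding second_countable_def openin_topology_generated_by_iff
\<comment> \<open>Finite intersections form the base; the empty family is left out because its
  intersection is \<open>UNIV\<close>, which may exceed the space.\<close>
proof (intro exI[of _ "Inter ` {F. finite F \<and> F \<subseteq> S \<and> F \<noteq> {}}"] conjI ballI allI impI)
  show "countable (Inter ` {F. finite F \<and> F \<subseteq> S \<and> F \<noteq> {}})"
    using countable_Collect_finite_subset[OF S] by (rule_tac countable_image, rule_tac countable_subset) auto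
next
  fix V assume "V \<in> Inter ` {F. finite F \<and> F \<subseteq> S \<and> F \<noteq> {}}"
  then obtain F where F: "finite F" "F \<subseteq> S" "F \<noteq> {}" "V = \<Inter>F" by blast
  have "openin (topology_generated_by S) (\<Inter>F)"
    using F by (intro openin_Inter) (auto intro: topology_generated_by_Basis)
  then show "generate_topology_on S V" using F by (simp add: openin_topology_generated_by_iff)
next
  fix U x assume "generate_topology_on S U \<and> x \<in> U"
  then have "generate_topology_on S U" "x \<in> U" by auto
  then have "\<exists>F. finite F \<and> F \<subseteq> S \<and> F \<noteq> {} \<and> x \<in> \<Inter>F \<and> \<Inter>F \<subseteq> U"
  proof (induction rule: generate_topology_on.induct)
    case (Int a b)
    then obtain F G where "finite F" "F \<subseteq> S" "F \<noteq> {}" "x \<in> \<Inter>F" "\<Inter>F \<subseteq> a"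
      "finite G" "G \<subseteq> S" "G \<noteq> {}" "x \<in> \<Inter>G" "\<Inter>G \<subseteq> b" by auto
    then show ?case by (intro exI[of _ "F \<union> G"]) (auto simp: Inter_Un_distrib)
  next
    case (UN K)
    then obtain k where k: "k \<in> K" "x \<in> k" by blast
    then obtain F where "finite F" "F \<subseteq> S" "F \<noteq> {}" "x \<in> \<Inter>F" "\<Inter>F \<subseteq> k" using UN.IH[OF k] by blast
    then show ?case using k by (intro exI[of _ F]) blast
  next
    case (Basis s) then show ?case by (intro exI[of _ "{s}"]) auto
  qed auto
  then show "\<exists>V\<in>Inter ` {F. finite F \<and> F \<subseteq> S \<and> F \<noteq> {}}. x \<in> V \<and> V \<subseteq> U" by blast
qed

lemma countable_rational_mats:
  "countable {C \<in> carrier_mat n n. rational_mat (C :: 'a::euclidean_space mat)}"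
proof (rule countable_subset)
  \<comment> \<open>Beyond the end of the list \<open>l ! k\<close> is unspecified; for the lists
    used below these terms are never read.\<close>
  let ?f = "\<lambda>l :: rat list. mat_of_coords n (\<lambda>k. of_rat (l ! k)) :: 'a mat"
  show "countable (range ?f)" by simp
  show "{C \<in> carrier_mat n n. rational_mat (C :: 'a mat)} \<subseteq> range ?f"
  proof
    fix C :: "'a mat" assume "C \<in> {C \<in> carrier_mat n n. rational_mat C}"
    then have C: "C \<in> carrier_mat n n" "rational_mat C" by auto
    have "mat_coords n C k \<in> \<rat>" if k: "k < n * n * DIM('a)" for k
    proof -
      have n: "0 < n" using k by (cases n) auto
      have "k div DIM('a) < n * n" using k by (rule less_mult_imp_div_less)
      then have "k div DIM('a) div n < n" "k div DIM('a) mod n < n" using n by (auto simp: less_mult_imp_div_less)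
      then show ?thesis using C k by (auto simp: mat_coords_def rational_mat_def)
    qed
    then have "\<forall>k. \<exists>q. k < n * n * DIM('a) \<longrightarrow> mat_coords n C k = of_rat q" by (auto elim: Rats_cases)
    then obtain q where q: "\<And>k. k < n * n * DIM('a) \<Longrightarrow> mat_coords n C k = of_rat (q k)" by metis
    have "?f (map q [0..<n * n * DIM('a)]) = C"
      by (rule mat_of_coords_mat_coords[OF C(1)]) (simp add: q)
    then show "C \<in> range ?f" by (metis rangeI)
  qed
qed

lemma second_countable_Sigma_topology:
  "second_countable (Sigma_topology :: 'a::{real_normed_field, euclidean_space} mat set topology)"
  unfolding Sigma_topology_def
proof (intro second_countable_topology_generated_by countable_UN countable_image)
  fix n
  have "rational_balls n \<subseteq> (\<lambda>(C, r). mat_ball n C r) ` ({C \<in> carrier_mat n n. rational_mat (C :: 'a mat)} \<times> \<rat>)"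
    by (auto simp: rational_balls_def)
  then show "countable (rational_balls n :: 'a mat set set)"
    by (rule countable_subset) (intro countable_image countable_SIGMA countable_rational_mats countable_rat)
qed simp

section \<open>Charts and atlases\<close>

lemma has_power_series_subset:
  "has_power_series p W a r N f \<Longrightarrow> V \<subseteq> W \<Longrightarrow> has_power_series p V a r N f"
  unfolding has_power_series_def by (meson subsetD)

lemma power_series_at_subset: "power_series_at p W a f \<Longrightarrow> V \<subseteq> W \<Longrightarrow> power_series_at p V a f"
  unfolding power_series_at_def using has_power_series_subset by blast

text \<open>Only a small box about \<open>a\<close> matters, and within the Euclidean space it lies
  in the open set \<open>V\<close>; hence an expansion on \<open>V\<close> carries over to
  \<open>W\<close>.\<close>

lemma power_series_at_local:
  assumes f: "power_series_at p V a f" and V: "openin (Euclidean_space p) V" "a \<in> V"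
    and W: "W \<subseteq> topspace (Euclidean_space p)" and eq: "\<And>x. x \<in> V \<Longrightarrow> f x = g x"
  shows "power_series_at p W a g"
proof -
  obtain s where s: "0 < s"
    "\<And>x. x \<in> topspace (Euclidean_space p) \<Longrightarrow> (\<And>i. i < p \<Longrightarrow> \<bar>x i - a i\<bar> < s) \<Longrightarrow> x \<in> V"
    using openin_Euclidean_space_contains_box[OF V] by blast
  obtain r N where r: "0 < r" "has_power_series p V a r N f" using f by (auto simp: power_series_at_def)
  \<comment> \<open>Half of \<open>s\<close>, since the expansion lives on a closed box while
    membership in \<open>V\<close> asks for strict inequalities.\<close>
  define t where "t = min r (s / 2)"
  have t: "0 < t" "t \<le> r" "t < s" using r s by (auto simp: t_def)
  obtain c where c: "(\<lambda>\<alpha>. norm (c \<alpha>) * t ^ mdegree p \<alpha>) summable_on multi_indices p"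
    "(\<Sum>\<^sub>\<infinity>\<alpha>\<in>multi_indices p. norm (c \<alpha>) * t ^ mdegree p \<alpha>) \<le> N"
    "\<And>x. x \<in> V \<Longrightarrow> (\<And>i. i < p \<Longrightarrow> \<bar>x i - a i\<bar> \<le> t) \<Longrightarrow>
        ((\<lambda>\<alpha>. mpower p (\<lambda>i. x i - a i) \<alpha> *\<^sub>R c \<alpha>) has_sum f x) (multi_indices p)"
    using has_power_seriesE[OF has_power_series_shrink[OF r(2) t(1,2)]] by blast
  have "((\<lambda>\<alpha>. mpower p (\<lambda>i. x i - a i) \<alpha> *\<^sub>R c \<alpha>) has_sum g x) (multi_indices p)"
    if x: "x \<in> W" "\<forall>i<p. \<bar>x i - a i\<bar> \<le> t" for x
  proof -
    have "x \<in> V" using x W t(3) by (intro s(2)) force+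
    then show ?thesis using c(3)[of x] x eq by simp
  qed
  then have "has_power_series p W a t N g" unfolding has_power_series_def using c(1,2) by blast
  then show ?thesis using t(1) unfolding power_series_at_def by blast
qed

section \<open>Simple charts and the invariance of their dimension\<close>

lemma simple_chart_inj: "simple_chart X U \<Longrightarrow> inj_on (cmap U) (cdom U)"
  unfolding simple_chart_def
  by (metis homeomorphic_imp_injective_map openin_subset topspace_subtopology_subset)

lemma simple_chart_open_image:
  assumes U: "simple_chart X U" and V: "openin X V" "V \<subseteq> cdom U"
  shows "openin (Euclidean_space (cdim U)) (cmap U ` V)"
proof -
  obtain W where W: "openin (Euclidean_space (cdim U)) W"
    "homeomorphic_map (subtopology X (cdom U)) (subtopology (Euclidean_space (cdim U)) W) (cmap U)"
    using U by (auto simp: simple_chart_def)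
  have "openin (subtopology X (cdom U)) V" using V by (auto simp: openin_subtopology intro!: exI[of _ V])
  then have "openin (subtopology (Euclidean_space (cdim U)) W) (cmap U ` V)"
    using homeomorphic_imp_open_map[OF W(2)] by (auto simp: open_map_def)
  then show ?thesis using W(1) openin_open_subtopology by blast
qed

lemma simple_chart_inv_continuous:
  assumes U: "simple_chart X U" and V: "openin X V" "V \<subseteq> cdom U"
  shows "continuous_map (subtopology (Euclidean_space (cdim U)) (cmap U ` V)) X (inv_into V (cmap U))"
proof -
  have inj: "inj_on (cmap U) V" using simple_chart_inj[OF U] V(2) inj_on_subset by blast
  have top: "topspace (subtopology (Euclidean_space (cdim U)) (cmap U ` V)) = cmap U ` V"
    using simple_chart_open_image[OF U V] openin_subset by (auto simp: topspace_subtopology)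
  show ?thesis unfolding continuous_map_alt top
  proof (intro conjI allI impI)
    show "inv_into V (cmap U) \<in> cmap U ` V \<rightarrow> topspace X"
      using openin_subset[OF V(1)] inj by auto
    fix T assume T: "openin X T"
    have "inv_into V (cmap U) -` T \<inter> cmap U ` V = cmap U ` (T \<inter> V)" using inj by auto
    moreover have "openin (Euclidean_space (cdim U)) (cmap U ` (T \<inter> V))"
      by (rule simple_chart_open_image[OF U]) (use T V in auto)
    ultimately show "openin (subtopology (Euclidean_space (cdim U)) (cmap U ` V)) (inv_into V (cmap U) -` T \<inter> cmap U ` V)"
      by (simp add: openin_subtopology) blast
  qed
qed

lemma simple_chart_continuous:
  assumes U: "simple_chart X U" and V: "V \<subseteq> cdom U"
  shows "continuous_map (subtopology X V) (Euclidean_space (cdim U)) (cmap U)"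
proof -
  obtain W where "homeomorphic_map (subtopology X (cdom U)) (subtopology (Euclidean_space (cdim U)) W) (cmap U)"
    using U by (auto simp: simple_chart_def)
  then have "continuous_map (subtopology X (cdom U)) (Euclidean_space (cdim U)) (cmap U)"
    using homeomorphic_imp_continuous_map continuous_map_in_subtopology by blast
  then show ?thesis using V by (rule continuous_map_from_subtopology_mono)
qed

text \<open>A chart of smaller dimension would, by invariance of domain, embed a nonempty open set as an open
  subset of a hyperplane.\<close>

lemma simple_chart_dim_le:
  assumes U: "simple_chart X U" and V: "simple_chart X V" and meet: "cdom U \<inter> cdom V \<noteq> {}"
  shows "cdim U \<le> cdim V"
proof (rule ccontr)
  assume "\<not> cdim U \<le> cdim V"
  then have lt: "cdim V < cdim U" by simp
  let ?n = "cdim U" and ?O = "cdom U \<inter> cdom V"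
  have O: "openin X ?O" using U V by (auto simp: simple_chart_def)
  have opU: "openin (Euclidean_space ?n) (cmap U ` ?O)" by (rule simple_chart_open_image[OF U O]) simp
  have inj: "inj_on (cmap U) ?O" "inj_on (cmap V) ?O"
    using simple_chart_inj[OF U] simple_chart_inj[OF V] by (meson inf_le1 inf_le2 inj_on_subset)+
  define h where "h = cmap V \<circ> inv_into ?O (cmap U)"
  have "continuous_map (subtopology (Euclidean_space ?n) (cmap U ` ?O)) (subtopology X ?O) (inv_into ?O (cmap U))"
    using simple_chart_inv_continuous[OF U O] inj by (auto simp: continuous_map_in_subtopology)
  then have cV: "continuous_map (subtopology (Euclidean_space ?n) (cmap U ` ?O)) (Euclidean_space (cdim V)) h"
    unfolding h_def by (rule continuous_map_compose[OF _ simple_chart_continuous[OF V]]) simp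
  \<comment> \<open>Sequences vanishing from \<open>cdim V\<close> on form a subspace of those
    vanishing from \<open>cdim U\<close> on, so \<open>h\<close> becomes a map into the Euclidean
    space that contains its domain, as invariance of domain requires.\<close>
  have EV: "Euclidean_space (cdim V) = subtopology (Euclidean_space ?n) (topspace (Euclidean_space (cdim V)))"
    using lt unfolding Euclidean_space_def subtopology_subtopology
    by (intro arg_cong[of _ _ "subtopology _"]) auto
  have "continuous_map (subtopology (Euclidean_space ?n) (cmap U ` ?O)) (Euclidean_space ?n) h"
    using cV by (subst (asm) EV) (simp add: continuous_map_in_subtopology)
  moreover have "inj_on h (cmap U ` ?O)"
    using inj unfolding h_def by (auto simp: inj_on_def)
  ultimately have op: "openin (Euclidean_space ?n) (h ` cmap U ` ?O)"
    using invariance_of_domain_Euclidean_space[OF opU] by blast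
  obtain z where z: "z \<in> h ` cmap U ` ?O" using meet by blast
  have zero: "x (cdim V) = 0" if "x \<in> h ` cmap U ` ?O" for x
  proof -
    have "h ` cmap U ` ?O \<subseteq> topspace (Euclidean_space (cdim V))"
      using cV openin_subset[OF opU] by (auto simp: continuous_map_def topspace_subtopology Pi_iff)
    then show ?thesis using that by (auto simp: topspace_Euclidean_space)
  qed
  obtain r where r: "0 < r"
    "\<And>x. x \<in> topspace (Euclidean_space ?n) \<Longrightarrow> (\<And>i. i < ?n \<Longrightarrow> \<bar>x i - z i\<bar> < r) \<Longrightarrow> x \<in> h ` cmap U ` ?O"
    using openin_Euclidean_space_contains_box[OF op z] by blast
  have zt: "z \<in> topspace (Euclidean_space ?n)" using openin_subset[OF op] z by blast
  \<comment> \<open>Coordinate \<open>cdim V\<close> is the first one that has to vanish on the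
    image; openness of the image would allow it to be moved.\<close>
  have "z(cdim V := z (cdim V) + r / 2) \<in> h ` cmap U ` ?O"
    using r(1) zt lt by (intro r(2)) (auto simp: topspace_Euclidean_space)
  from zero[OF this] zero[OF z] show False using r(1) by simp
qed

lemma simple_chart_dim_unique:
  "simple_chart X U \<Longrightarrow> simple_chart X V \<Longrightarrow> cdom U \<inter> cdom V \<noteq> {} \<Longrightarrow> cdim U = cdim V"
  using simple_chart_dim_le[of X U V] simple_chart_dim_le[of X V U] by (simp add: Int_commute)

section \<open>Analytic transitions\<close>

lemma analytic_transition_disjoint: "cdom U \<inter> cdom V = {} \<Longrightarrow> analytic_transition U V"
  by (simp add: analytic_transition_def analytic_in_coords_def analytic_map_def real_analytic_on_def)

lemma analytic_transition_commute: "analytic_transition U V \<longleftrightarrow> analytic_transition V U"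
  by (auto simp: analytic_transition_def Int_commute)

text \<open>The transition is the identity in coordinates. This covers a chart and itself, and two
  restrictions of one leaf coordinate.\<close>

lemma analytic_transition_same_map:
  assumes U: "simple_chart X U" and V: "simple_chart X V" and eq: "cdim U = cdim V" "cmap U = cmap V"
  shows "analytic_transition U V"
proof -
  let ?O = "cdom U \<inter> cdom V"
  have O: "openin X ?O" using U V by (auto simp: simple_chart_def)
  have opU: "openin (Euclidean_space (cdim U)) (cmap U ` ?O)" by (rule simple_chart_open_image[OF U O]) simp
  have inj: "inj_on (cmap U) ?O" using simple_chart_inj[OF U] by (rule inj_on_subset) simp
  have id: "(cmap U \<circ> id \<circ> inv_into ?O (cmap U)) x = x" if "x \<in> cmap U ` ?O" for x
    using that by (simp add: f_inv_into_f)
  have "analytic_map (cdim U) (cmap U ` ?O) (cdim U) (cmap U \<circ> id \<circ> inv_into ?O (cmap U))"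
    unfolding analytic_map_def
  proof (intro conjI allI impI)
    show "cmap U \<circ> id \<circ> inv_into ?O (cmap U) \<in> cmap U ` ?O \<rightarrow> topspace (Euclidean_space (cdim U))"
      by (rule Pi_I, subst id) (use openin_subset[OF opU] in blast)+
    fix j assume "j < cdim U"
    then have "real_analytic_on (cdim U) (cmap U ` ?O) (\<lambda>x. x j)"
      by (intro real_analytic_onI[OF opU] power_series_at_coordinate)
    then show "real_analytic_on (cdim U) (cmap U ` ?O) (\<lambda>x. (cmap U \<circ> id \<circ> inv_into ?O (cmap U)) x j)"
      by (rule real_analytic_on_cong) (simp only: id)
  qed
  then show ?thesis using inj eq by (simp add: analytic_transition_def analytic_in_coords_def)
qed

text \<open>Near each point of the overlap the map factors through an atlas chart \<open>S\<close>
  around that point. As \<open>S\<close> varies with the point, the composition is formed for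
  expansions at a point and then moved back to the whole overlap.\<close>

lemma analytic_in_coords_chart_trans:
  assumes U: "simple_chart X U" and V: "simple_chart X V"
    and A: "\<And>S. S \<in> A \<Longrightarrow> simple_chart X S \<and> analytic_transition U S \<and> analytic_transition S V"
    and cover: "cdom U \<inter> cdom V \<subseteq> (\<Union>S\<in>A. cdom S)"
  shows "analytic_in_coords (cdim U) (cmap U) (cdom U \<inter> cdom V) (cdim V) (cmap V) id"
proof -
  let ?O = "cdom U \<inter> cdom V" and ?p = "cdim U" and ?q = "cdim V"
  let ?F = "cmap V \<circ> id \<circ> inv_into ?O (cmap U)"
  have O: "openin X ?O" using U V by (auto simp: simple_chart_def)
  have opU: "openin (Euclidean_space ?p) (cmap U ` ?O)" by (rule simple_chart_open_image[OF U O]) simp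
  have injU: "inj_on (cmap U) T" if "T \<subseteq> cdom U" for T using simple_chart_inj[OF U] that by (rule inj_on_subset)
  have "openin (Euclidean_space ?q) (cmap V ` ?O)" by (rule simple_chart_open_image[OF V O]) simp
  then have maps: "?F \<in> cmap U ` ?O \<rightarrow> topspace (Euclidean_space ?q)"
    using injU[of ?O] openin_subset by fastforce
  have "power_series_at ?p (cmap U ` ?O) a (\<lambda>x. ?F x j)" if a: "a \<in> cmap U ` ?O" and j: "j < ?q" for a j
  proof -
    obtain z where z: "z \<in> ?O" "a = cmap U z" using a by blast
    obtain S where S: "S \<in> A" "z \<in> cdom S" using cover z by blast
    have S1: "simple_chart X S" "analytic_transition U S" "analytic_transition S V" using A[OF S(1)] by auto
    \<comment> \<open>The set on which all three coordinate maps are available.\<close>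
    let ?T = "?O \<inter> cdom S"
    have T: "openin X ?T" using O S1 by (auto simp: simple_chart_def)
    have opT: "openin (Euclidean_space ?p) (cmap U ` ?T)" by (rule simple_chart_open_image[OF U T]) auto
    have aT: "a \<in> cmap U ` ?T" using z S by blast
    let ?G = "cmap S \<circ> id \<circ> inv_into (cdom U \<inter> cdom S) (cmap U)"
    let ?H = "cmap V \<circ> id \<circ> inv_into (cdom S \<inter> cdom V) (cmap S)"
    have G: "analytic_map ?p (cmap U ` (cdom U \<inter> cdom S)) (cdim S) ?G"
      using S1(2) by (simp add: analytic_transition_def analytic_in_coords_def)
    have H: "analytic_map (cdim S) (cmap S ` (cdom S \<inter> cdom V)) ?q ?H"
      using S1(3) by (simp add: analytic_transition_def analytic_in_coords_def)
    have Geq: "?G (cmap U y) = cmap S y" if "y \<in> ?T" for y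
      using inv_into_f_f[OF injU[of "cdom U \<inter> cdom S"], of y] that by auto
    have injS: "inj_on (cmap S) (cdom S \<inter> cdom V)" using simple_chart_inj[OF S1(1)] by (rule inj_on_subset) simp
    have Heq: "?H (cmap S y) = cmap V y" if "y \<in> ?T" for y
      using inv_into_f_f[OF injS, of y] that by auto
    have Feq: "?F (cmap U y) = cmap V y" if "y \<in> ?T" for y
      using inv_into_f_f[OF injU[of ?O], of y] that by auto
    have "power_series_at ?p (cmap U ` ?T) a (\<lambda>x. ?H (?G x) j)"
    proof (rule power_series_at_compose[where q = "cdim S" and F = ?G and V = "cmap S ` (cdom S \<inter> cdom V)" and g = "\<lambda>y. ?H y j"])
      fix i assume i: "i < cdim S"
      have "real_analytic_on ?p (cmap U ` (cdom U \<inter> cdom S)) (\<lambda>x. ?G x i)"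
        using G i by (simp add: analytic_map_def)
      then have "power_series_at ?p (cmap U ` (cdom U \<inter> cdom S)) a (\<lambda>x. ?G x i)"
        by (rule real_analytic_on_imp_power_series_at) (use aT in blast)
      then show "power_series_at ?p (cmap U ` ?T) a (\<lambda>x. ?G x i)"
        by (rule power_series_at_subset) blast
    next
      show "real_analytic_on (cdim S) (cmap S ` (cdom S \<inter> cdom V)) (\<lambda>y. ?H y j)"
        using H j by (simp add: analytic_map_def)
    next
      fix x assume "x \<in> cmap U ` ?T"
      then obtain y where y: "y \<in> ?T" "x = cmap U y" by blast
      show "?G x \<in> cmap S ` (cdom S \<inter> cdom V)" unfolding y(2) Geq[OF y(1)] using y(1) by blast
    qed (rule aT)
    then show ?thesis
    proof (rule power_series_at_local[OF _ opT aT openin_subset[OF opU]])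
      fix x assume "x \<in> cmap U ` ?T"
      then obtain y where y: "y \<in> ?T" "x = cmap U y" by blast
      show "?H (?G x) j = ?F x j" unfolding y(2) Geq[OF y(1)] Heq[OF y(1)] Feq[OF y(1)] ..
    qed
  qed
  then have "analytic_map ?p (cmap U ` ?O) ?q ?F"
    unfolding analytic_map_def using maps by (auto intro: real_analytic_onI[OF opU])
  then show ?thesis unfolding analytic_in_coords_def using injU[of ?O] by simp
qed

text \<open>Compatibility is tested against the atlas alone and without regard to dimension, so that
  it is a condition on each simple chart separately.\<close>

definition atlas_structure :: "'p topology \<Rightarrow> 'p coords set \<Rightarrow> 'p coords set set" where
  "atlas_structure X A = {b. bundled_chart X b \<and> (\<forall>U\<in>b. \<forall>S\<in>A. analytic_transition U S)}"

text \<open>Comparability constrains only charts of equal dimension; charts of different dimensions never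
  meet, so every chart comparable with the atlas has analytic transitions to all of it.\<close>

lemma bundled_analytic_manifold_atlas_structure:
  assumes X: "second_countable X" "Hausdorff_space X"
    and A: "\<And>S. S \<in> A \<Longrightarrow> simple_chart X S" and cover: "(\<Union>S\<in>A. cdom S) = topspace X"
    and trans: "\<And>S T. S \<in> A \<Longrightarrow> T \<in> A \<Longrightarrow> analytic_transition S T"
  shows "bundled_analytic_manifold X (atlas_structure X A)"
  unfolding bundled_analytic_manifold_def
proof (intro conjI X ballI allI impI)
  show "bundled_chart X b" if "b \<in> atlas_structure X A" for b
    using that by (simp add: atlas_structure_def)
  \<comment> \<open>Atlas charts enter as one-element bundles; they give the cover and are the test
    objects for maximality.\<close>
  have single: "{S} \<in> atlas_structure X A" if "S \<in> A" for S
    using A[OF that] trans that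
    by (auto simp: atlas_structure_def bundled_chart_def bundle_dom_def simple_chart_def)
  show "(\<Union>b\<in>atlas_structure X A. bundle_dom b) = topspace X"
  proof
    show "(\<Union>b\<in>atlas_structure X A. bundle_dom b) \<subseteq> topspace X"
    proof (intro UN_least)
      fix b assume "b \<in> atlas_structure X A"
      then obtain U where "U \<in> b" "openin X (cdom U)"
        by (auto simp: atlas_structure_def bundled_chart_def simple_chart_def)
      then show "bundle_dom b \<subseteq> topspace X" using openin_subset by (fastforce simp: bundle_dom_def)
    qed
    show "topspace X \<subseteq> (\<Union>b\<in>atlas_structure X A. bundle_dom b)"
    proof
      fix x assume "x \<in> topspace X"
      then obtain S where "S \<in> A" "x \<in> cdom S" unfolding cover[symmetric] by blast
      then show "x \<in> (\<Union>b\<in>atlas_structure X A. bundle_dom b)"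
        by (intro UN_I[OF single]) (simp_all add: bundle_dom_def)
    qed
  qed
  show "analytically_comparable b c" if bc: "b \<in> atlas_structure X A" "c \<in> atlas_structure X A" for b c
    unfolding analytically_comparable_def
  proof (intro ballI impI)
    fix U V assume UV: "U \<in> b" "V \<in> c" "cdim U = cdim V"
    have charts: "simple_chart X U" "simple_chart X V"
      using bc UV by (auto simp: atlas_structure_def bundled_chart_def)
    have tr: "analytic_transition U S" "analytic_transition V S" if "S \<in> A" for S
      using bc UV that by (auto simp: atlas_structure_def)
    have "cdom U \<subseteq> topspace X" using charts(1) openin_subset by (auto simp: simple_chart_def)
    then have cov: "cdom U \<inter> cdom V \<subseteq> (\<Union>S\<in>A. cdom S)" unfolding cover by blast
    show "analytic_transition U V" unfolding analytic_transition_def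
    proof
      show "analytic_in_coords (cdim U) (cmap U) (cdom U \<inter> cdom V) (cdim V) (cmap V) id"
        by (rule analytic_in_coords_chart_trans[OF charts _ cov]) (use A tr in \<open>auto simp: analytic_transition_commute[of _ V]\<close>)
      show "analytic_in_coords (cdim V) (cmap V) (cdom U \<inter> cdom V) (cdim U) (cmap U) id"
        unfolding Int_commute[of "cdom U"]
        by (rule analytic_in_coords_chart_trans[OF charts(2,1) _ cov[unfolded Int_commute[of "cdom U"]]])
           (use A tr in \<open>auto simp: analytic_transition_commute[of _ U]\<close>)
    qed
  qed
  fix b assume b: "bundled_chart X b \<and> (\<forall>c\<in>atlas_structure X A. analytically_comparable b c)"
  have "analytic_transition U S" if "U \<in> b" "S \<in> A" for U S
  proof (cases "cdom U \<inter> cdom S = {}")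
    case True then show ?thesis by (rule analytic_transition_disjoint)
  next
    case False
    have "simple_chart X U" using b that by (auto simp: bundled_chart_def)
    then have "cdim U = cdim S" using simple_chart_dim_unique A that False by blast
    moreover have "analytically_comparable b {S}" using b single that by blast
    ultimately show ?thesis using that by (simp add: analytically_comparable_def)
  qed
  then show "b \<in> atlas_structure X A" using b by (simp add: atlas_structure_def)
qed

section \<open>The general linear group\<close>

lemma classes_meeting_eq:
  assumes "S \<subseteq> carrier_mat n n" "0 < n"
  shows "classes_meeting S = mat_class ` S"
proof (intro equalityI subsetI)
  fix X assume "X \<in> classes_meeting S"
  then obtain A where "X \<in> Sigma_space" "A \<in> X" "A \<in> S" by (auto simp: classes_meeting_def)
  then show "X \<in> mat_class ` S" using Sigma_space_eq_mat_class(2) by blast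
next
  fix X assume "X \<in> mat_class ` S"
  then obtain A where A: "A \<in> S" "X = mat_class A" by blast
  then have "A \<in> square_mats" using assms by (auto intro: square_matsI)
  then show "X \<in> classes_meeting S"
    using A mat_class_memI mat_class_in_Sigma by (auto simp: classes_meeting_def)
qed

definition GL_mats :: "nat \<Rightarrow> 'a::field mat set" where
  "GL_mats n = {A \<in> carrier_mat n n. Determinant.det A \<noteq> 0}"

definition irreducible_GL_mats :: "nat \<Rightarrow> 'a::field mat set" where
  "irreducible_GL_mats n = {A \<in> GL_mats n. irreducible_mat A}"

lemma GL_classes_eq:
  "(GL_classes :: 'a::real_normed_field mat set set) = (\<Union>n\<in>{0<..}. mat_class ` GL_mats n)"
proof (intro equalityI subsetI)
  fix X :: "'a mat set" assume "X \<in> GL_classes"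
  then obtain A n where "0 < n" "A \<in> carrier_mat n n" "Determinant.det A \<noteq> 0" "X = mat_class A"
    by (elim GL_classesE)
  then show "X \<in> (\<Union>n\<in>{0<..}. mat_class ` GL_mats n)" by (auto simp: GL_mats_def)
qed (auto simp: GL_mats_def mat_class_in_GL_iff)

lemma open_mats_GL: "open_mats n (GL_mats n :: 'a::{real_normed_field, euclidean_space} mat set)"
  unfolding GL_mats_def by (rule open_mats_det)

lemma openin_Sigma_mat_class_image:
  fixes S :: "'a::{real_normed_field, euclidean_space} mat set"
  assumes "open_mats n S" "0 < n"
  shows "openin Sigma_topology (mat_class ` S)"
  using openin_Sigma_classes_meeting[OF assms] classes_meeting_eq[of S n] assms by (simp add: open_mats_def)

lemma openin_Sigma_GL:
  "openin Sigma_topology (GL_classes :: 'a::{real_normed_field, euclidean_space} mat set set)"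
  unfolding GL_classes_eq by (intro openin_Union) (auto intro: openin_Sigma_mat_class_image open_mats_GL)

lemma openin_GL_topology:
  "openin GL_topology (U :: 'a::{real_normed_field, euclidean_space} mat set set) \<longleftrightarrow>
    openin Sigma_topology U \<and> U \<subseteq> GL_classes"
  unfolding GL_topology_def by (rule openin_open_subtopology[OF openin_Sigma_GL])

lemma topspace_GL_topology:
  "topspace (GL_topology :: 'a::{real_normed_field, euclidean_space} mat set topology) = GL_classes"
  unfolding GL_topology_def by (rule topspace_subtopology_subset[OF openin_subset[OF openin_Sigma_GL]])

text \<open>The map is that of \<open>GL_leaf n\<close>; only the domain is cut down to the classes
  of minimal size \<open>n\<close>.\<close>

definition stratum_chart :: "nat \<Rightarrow> 'a::{real_normed_field, euclidean_space} mat set coords" where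
  "stratum_chart n = Coords (mat_class ` irreducible_GL_mats n) (n * n * DIM('a))
     (\<lambda>X. mat_coords n (representative n X))"

lemma mat_coords_representative:
  "A \<in> carrier_mat n n \<Longrightarrow> 0 < n \<Longrightarrow> mat_coords n (representative n (mat_class A)) = mat_coords n A"
  by (simp add: representative_mat_class)

lemma open_mats_irreducible_GL:
  "0 < n \<Longrightarrow> open_mats n (irreducible_GL_mats n :: 'a::{real_normed_field, euclidean_space} mat set)"
proof -
  assume n: "0 < n"
  have "irreducible_GL_mats n = GL_mats n \<inter> {A \<in> carrier_mat n n. irreducible_mat (A :: 'a mat)}"
    by (auto simp: irreducible_GL_mats_def GL_mats_def)
  then show ?thesis using open_mats_Int[OF open_mats_GL open_mats_irreducible[OF n]] by simp
qed

text \<open>Continuity holds because the classes of an open set of matrices form an open set; that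
  the map is open comes from \<open>open_mats_of_openin_Sigma\<close>. On the stratum the
  coordinates are those of the unique representative of size \<open>n\<close>.\<close>

lemma simple_chart_stratum_chart:
  fixes n :: nat
  assumes n: "0 < n" and ne: "irreducible_GL_mats n \<noteq> ({} :: 'a::{real_normed_field, euclidean_space} mat set)"
  shows "simple_chart GL_topology (stratum_chart n :: 'a mat set coords)"
proof -
  let ?I = "irreducible_GL_mats n :: 'a mat set" and ?E = "Euclidean_space (n * n * DIM('a))"
  let ?S = "mat_class ` ?I" and ?W = "mat_coords n ` ?I"
  let ?\<phi> = "\<lambda>X :: 'a mat set. mat_coords n (representative n X)"
  have Ic: "?I \<subseteq> carrier_mat n n" by (auto simp: irreducible_GL_mats_def GL_mats_def)
  have SGL: "mat_class ` T \<subseteq> GL_classes" if "T \<subseteq> ?I" for T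
    using that n by (auto simp: irreducible_GL_mats_def GL_mats_def mat_class_in_GL_iff)
  have phi: "?\<phi> (mat_class A) = mat_coords n A" if "A \<in> ?I" for A
    using that Ic n by (intro mat_coords_representative) auto
  have open_image: "openin GL_topology (mat_class ` T)" if "open_mats n T" "T \<subseteq> ?I" for T
    using that n SGL unfolding openin_GL_topology by (auto intro: openin_Sigma_mat_class_image)
  have S: "openin GL_topology ?S" by (intro open_image open_mats_irreducible_GL n) auto
  have W: "openin ?E ?W" using open_mats_irreducible_GL[OF n, where 'a = 'a] by (simp add: open_mats_def)
  have topS: "topspace (subtopology GL_topology ?S) = ?S"
    by (rule topspace_subtopology_subset[OF openin_subset[OF S]])
  have "homeomorphic_map (subtopology GL_topology ?S) (subtopology ?E ?W) ?\<phi>"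
  proof (rule bijective_open_imp_homeomorphic_map)
    show "continuous_map (subtopology GL_topology ?S) (subtopology ?E ?W) ?\<phi>"
      unfolding continuous_map_in_subtopology topS
    proof
      show "?\<phi> \<in> ?S \<rightarrow> ?W" using phi by auto
      show "continuous_map (subtopology GL_topology ?S) ?E ?\<phi>"
        unfolding continuous_map_alt topS
      proof (intro conjI allI impI)
        show "?\<phi> \<in> ?S \<rightarrow> topspace ?E" by simp
        fix T assume T: "openin ?E T"
        let ?P = "{A \<in> ?I. mat_coords n A \<in> T}"
        have "mat_coords n ` ?P = ?W \<inter> T" by auto
        then have "open_mats n ?P" using W T Ic by (auto simp: open_mats_def)
        then have "openin GL_topology (mat_class ` ?P)" by (rule open_image) auto
        moreover have "?\<phi> -` T \<inter> ?S = mat_class ` ?P" using phi by auto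
        ultimately show "openin (subtopology GL_topology ?S) (?\<phi> -` T \<inter> ?S)"
          by (auto simp: openin_open_subtopology[OF S])
      qed
    qed
    show "open_map (subtopology GL_topology ?S) (subtopology ?E ?W) ?\<phi>"
      unfolding open_map_def
    proof (intro allI impI)
      fix V assume "openin (subtopology GL_topology ?S) V"
      then have V: "openin Sigma_topology V" "V \<subseteq> ?S"
        by (auto simp: openin_open_subtopology[OF S] openin_GL_topology)
      \<comment> \<open>\<open>?P\<close> is cut out of all irreducible matrices; since
        \<open>V\<close> lies in the stratum, its members are nonsingular.\<close>
      let ?P = "{A \<in> carrier_mat n n. irreducible_mat A \<and> mat_class A \<in> V}"
      have P: "open_mats n ?P" by (rule open_mats_of_openin_Sigma[OF V(1) n])
      have PI: "?P \<subseteq> ?I"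
      proof
        fix A assume A: "A \<in> ?P"
        then obtain B where "B \<in> ?I" "mat_class A = mat_class B" using V(2) by blast
        moreover have "A = B" using calculation A Ic n by (intro mat_class_inject[of A n B]) auto
        ultimately show "A \<in> ?I" by simp
      qed
      have "?\<phi> ` V = mat_coords n ` ?P"
      proof (intro equalityI subsetI)
        fix x assume "x \<in> ?\<phi> ` V"
        then obtain A where A: "A \<in> ?I" "mat_class A \<in> V" "x = ?\<phi> (mat_class A)" using V(2) by blast
        then have "A \<in> ?P" by (auto simp: irreducible_GL_mats_def GL_mats_def)
        then show "x \<in> mat_coords n ` ?P" using phi A by auto
      next
        fix x assume "x \<in> mat_coords n ` ?P"
        then obtain A where A: "A \<in> ?P" "x = mat_coords n A" by blast
        then have "x = ?\<phi> (mat_class A)" using phi[of A] PI by auto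
        then show "x \<in> ?\<phi> ` V" by (rule image_eqI) (use A in blast)
      qed
      then show "openin (subtopology ?E ?W) (?\<phi> ` V)"
        using P PI by (auto simp: openin_open_subtopology[OF W] open_mats_def)
    qed
    show "?\<phi> ` topspace (subtopology GL_topology ?S) = topspace (subtopology ?E ?W)"
      unfolding topS topspace_subtopology_subset[OF openin_subset[OF W]] image_image
      by (intro image_cong phi) simp
    show "inj_on ?\<phi> (topspace (subtopology GL_topology ?S))"
      unfolding topS
    proof (rule inj_onI)
      fix X Y assume "X \<in> ?S" "Y \<in> ?S" "?\<phi> X = ?\<phi> Y"
      then obtain A B where AB: "A \<in> ?I" "B \<in> ?I" "X = mat_class A" "Y = mat_class B" "mat_coords n A = mat_coords n B"
        using phi by auto
      then have "A = B" using Ic by (intro mat_coords_inject[of A n B]) auto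
      then show "X = Y" using AB by simp
    qed
  qed
  then show ?thesis using S W ne by (auto simp: simple_chart_def stratum_chart_def)
qed

text \<open>Filtering out empty strata meets the nonemptiness of charts without exhibiting an
  irreducible nonsingular matrix of each size.\<close>

definition GL_atlas :: "'a::{real_normed_field, euclidean_space} mat set coords set" where
  "GL_atlas = stratum_chart ` {n. 0 < n \<and> irreducible_GL_mats n \<noteq> ({} :: 'a mat set)}"

lemma GL_class_in_stratum:
  fixes X :: "'a::{real_normed_field, euclidean_space} mat set"
  assumes "X \<in> GL_classes"
  obtains n where "0 < n" "X \<in> mat_class ` irreducible_GL_mats n"
proof -
  obtain A n where A: "0 < n" "A \<in> carrier_mat n n" "X = mat_class A"
    using assms by (elim GL_classesE)
  obtain d B where B: "0 < d" "B \<in> carrier_mat d d" "irreducible_mat B" "mat_class B = mat_class A"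
    using mat_class_irreducible[OF A(2,1)] .
  then have "B \<in> irreducible_GL_mats d"
    using mat_class_in_GL_iff[OF B(2,1)] assms A(3) by (simp add: irreducible_GL_mats_def GL_mats_def)
  then show ?thesis using that[OF B(1)] B(4) A(3) by (metis imageI)
qed

lemma square_mult_inject: "0 < d \<Longrightarrow> m * m * d = n * n * d \<Longrightarrow> m = (n::nat)"
  using power2_eq_iff_nonneg[of m n] by (simp add: power2_eq_square)

text \<open>Two strata with a common class have charts of equal dimension, and the dimension
  determines \<open>n\<close>; so among overlapping pairs only the transition of a chart with itself
  remains.\<close>

lemma bundled_manifold_GL:
  "bundled_analytic_manifold (GL_topology :: 'a::{real_normed_field, euclidean_space} mat set topology)
     (atlas_structure GL_topology GL_atlas)"
proof (rule bundled_analytic_manifold_atlas_structure)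
  show "second_countable (GL_topology :: 'a mat set topology)"
    unfolding GL_topology_def by (intro second_countable_subtopology second_countable_Sigma_topology)
  show "Hausdorff_space (GL_topology :: 'a mat set topology)"
    unfolding GL_topology_def by (intro Hausdorff_space_subtopology Hausdorff_Sigma_topology)
  show chart: "simple_chart GL_topology S" if "S \<in> GL_atlas" for S :: "'a mat set coords"
    using that by (auto simp: GL_atlas_def intro: simple_chart_stratum_chart)
  show "(\<Union>S\<in>GL_atlas. cdom S) = topspace (GL_topology :: 'a mat set topology)"
  proof (intro equalityI subsetI)
    fix X :: "'a mat set" assume "X \<in> (\<Union>S\<in>GL_atlas. cdom S)"
    then show "X \<in> topspace GL_topology" using chart openin_subset by (fastforce simp: simple_chart_def)
  next
    fix X :: "'a mat set" assume "X \<in> topspace GL_topology"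
    then obtain n where "0 < n" "X \<in> mat_class ` irreducible_GL_mats n"
      unfolding topspace_GL_topology by (elim GL_class_in_stratum)
    then show "X \<in> (\<Union>S\<in>GL_atlas. cdom S)"
      by (intro UN_I[of "stratum_chart n"]) (auto simp: GL_atlas_def stratum_chart_def)
  qed
  fix S T :: "'a mat set coords" assume ST: "S \<in> GL_atlas" "T \<in> GL_atlas"
  show "analytic_transition S T"
  proof (cases "cdom S \<inter> cdom T = {}")
    case True then show ?thesis by (rule analytic_transition_disjoint)
  next
    case False
    have "cdim S = cdim T" by (rule simple_chart_dim_unique[OF chart[OF ST(1)] chart[OF ST(2)] False])
    moreover obtain a b where ab: "S = stratum_chart a" "T = stratum_chart b" using ST unfolding GL_atlas_def by blast
    ultimately have "a = b" using square_mult_inject[of "DIM('a)" a b] by (simp add: stratum_chart_def)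
    then have "S = T" using ab by simp
    then show ?thesis using analytic_transition_same_map[OF chart[OF ST(1)] chart[OF ST(1)]] by simp
  qed
qed

section \<open>Leaf coordinates\<close>

lemma cdom_GL_leaf:
  assumes n: "0 < n"
  shows "cdom (GL_leaf n :: 'a::{real_normed_field, euclidean_space} mat set coords) = mat_class ` GL_mats n"
proof (intro equalityI subsetI)
  fix X :: "'a mat set" assume "X \<in> cdom (GL_leaf n)"
  then obtain A where A: "X \<in> GL_classes" "A \<in> X" "A \<in> carrier_mat n n" by (auto simp: GL_leaf_def)
  then have "X = mat_class A" using Sigma_space_eq_mat_class(2) by (auto simp: GL_classes_def)
  then show "X \<in> mat_class ` GL_mats n" using A mat_class_in_GL_iff[OF A(3) n] by (auto simp: GL_mats_def)
next
  fix X :: "'a mat set" assume "X \<in> mat_class ` GL_mats n"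
  then obtain A where A: "A \<in> carrier_mat n n" "Determinant.det A \<noteq> 0" "X = mat_class A" by (auto simp: GL_mats_def)
  then show "X \<in> cdom (GL_leaf n)"
    using mat_class_in_GL_iff[OF A(1) n] mat_class_memI[OF square_matsI[OF A(1) n]] by (auto simp: GL_leaf_def)
qed

lemma cdim_GL_leaf: "cdim (GL_leaf n :: 'a::{real_normed_field, euclidean_space} mat set coords) = n * n * DIM('a)"
  by (simp add: GL_leaf_def)

lemma cmap_GL_leaf: "cmap (GL_leaf n) X = mat_coords n (representative n X)"
  by (simp add: GL_leaf_def)

lemma cmap_GL_leaf_mat_class: "A \<in> carrier_mat n n \<Longrightarrow> 0 < n \<Longrightarrow> cmap (GL_leaf n) (mat_class A) = mat_coords n A"
  by (simp add: cmap_GL_leaf representative_mat_class)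

text \<open>A restricted leaf coordinate that is a simple chart can, by dimension, meet only the
  stratum of its own size, and there the two maps coincide. The stratum charts are themselves such
  restrictions and cover the group.\<close>

lemma natural_coords_GL:
  "natural_coords (GL_topology :: 'a::{real_normed_field, euclidean_space} mat set topology)
     (atlas_structure GL_topology GL_atlas) GL_leaf"
  unfolding natural_coords_def
proof (intro conjI allI impI ballI)
  fix n U assume n: "1 \<le> n" and
    U: "U \<subseteq> cdom (GL_leaf n :: 'a mat set coords) \<and>
      simple_chart GL_topology (Coords U (cdim (GL_leaf n :: 'a mat set coords)) (cmap (GL_leaf n)))"
  let ?C = "Coords U (cdim (GL_leaf n :: 'a mat set coords)) (cmap (GL_leaf n))"
  have "analytic_transition ?C S" if S: "S \<in> GL_atlas" for S :: "'a mat set coords"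
  proof (cases "cdom ?C \<inter> cdom S = {}")
    case True then show ?thesis by (rule analytic_transition_disjoint)
  next
    case False
    have chart: "simple_chart GL_topology S" using S by (auto simp: GL_atlas_def intro: simple_chart_stratum_chart)
    have dim: "cdim ?C = cdim S" using simple_chart_dim_unique[OF _ chart False] U by blast
    obtain k where k: "S = stratum_chart k" using S by (auto simp: GL_atlas_def)
    have "n = k" using dim square_mult_inject[of "DIM('a)" n k] by (simp add: k stratum_chart_def cdim_GL_leaf)
    then have "cmap ?C = cmap S" by (auto simp: k stratum_chart_def cmap_GL_leaf)
    then show ?thesis using analytic_transition_same_map[OF _ chart dim] U by blast
  qed
  then show "{?C} \<in> atlas_structure GL_topology GL_atlas"
    using U by (auto simp: atlas_structure_def bundled_chart_def bundle_dom_def simple_chart_def)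
next
  fix X :: "'a mat set" assume "X \<in> topspace GL_topology"
  then obtain n where n: "0 < n" "X \<in> mat_class ` irreducible_GL_mats n"
    unfolding topspace_GL_topology by (elim GL_class_in_stratum)
  have "Coords (mat_class ` irreducible_GL_mats n) (cdim (GL_leaf n :: 'a mat set coords)) (cmap (GL_leaf n)) =
      (stratum_chart n :: 'a mat set coords)"
    by (simp add: stratum_chart_def GL_leaf_def)
  then have "simple_chart GL_topology (Coords (mat_class ` irreducible_GL_mats n :: 'a mat set set) (cdim (GL_leaf n :: 'a mat set coords)) (cmap (GL_leaf n)))"
    using simple_chart_stratum_chart[OF n(1), where 'a = 'a] n(2) by auto
  moreover have "mat_class ` irreducible_GL_mats n \<subseteq> cdom (GL_leaf n :: 'a mat set coords)"
    unfolding cdom_GL_leaf[OF n(1)] by (auto simp: irreducible_GL_mats_def)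
  ultimately show "\<exists>n\<ge>1. \<exists>U. X \<in> U \<and> U \<subseteq> cdom (GL_leaf n) \<and>
        simple_chart GL_topology (Coords U (cdim (GL_leaf n :: 'a mat set coords)) (cmap (GL_leaf n)))"
    using n by (intro exI[of _ n] conjI exI[of _ "mat_class ` irreducible_GL_mats n"]) auto
qed

section \<open>Analyticity of matrix expressions\<close>

lemma power_series_at_mat_coords:
  fixes M :: "_ \<Rightarrow> 'a::euclidean_space mat"
  assumes entries: "\<And>i j. i < n \<Longrightarrow> j < n \<Longrightarrow> power_series_at p W a (\<lambda>x. M x $$ (i, j))"
  shows "power_series_at p W a (\<lambda>x. mat_coords n (M x) k)"
proof (cases "k < n * n * DIM('a)")
  case True
  then have n: "0 < n" by (cases n) auto
  have "k div DIM('a) < n * n" using True by (rule less_mult_imp_div_less)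
  then have lt: "k div DIM('a) div n < n" "k div DIM('a) mod n < n" using n by (auto simp: less_mult_imp_div_less)
  show ?thesis using True
    by (simp add: mat_coords_def power_series_at_bounded_linear[OF entries[OF lt] bounded_linear_inner_left])
qed (simp add: mat_coords_def power_series_at_const)

lemma power_series_at_mat_of_coords:
  assumes "i < n" "j < n" and s: "\<And>k. k < n * n * DIM('a) \<Longrightarrow> power_series_at p W a (\<lambda>x. s x k)"
  shows "power_series_at p W a (\<lambda>x. (mat_of_coords n (s x) :: 'a::euclidean_space mat) $$ (i, j))"
  unfolding mat_of_coords_index[OF assms(1,2)]
proof (rule power_series_at_sum)
  fix d assume "d \<in> {..<DIM('a)}"
  then have "(i * n + j) * DIM('a) + d < n * n * DIM('a)" using assms(1,2) by (intro mat_index_less) auto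
  from power_series_at_bounded_linear[OF s[OF this] bounded_linear_scaleR_left]
  show "power_series_at p W a (\<lambda>x. s x ((i * n + j) * DIM('a) + d) *\<^sub>R (from_nat_into Basis d :: 'a))" .
qed

lemma power_series_at_lift_mat:
  fixes A :: "_ \<Rightarrow> 'a::{banach, real_normed_field} mat"
  assumes A: "\<And>x. A x \<in> carrier_mat n n" and N: "n dvd N" and ij: "i < N" "j < N"
    and entries: "\<And>i j. i < n \<Longrightarrow> j < n \<Longrightarrow> power_series_at p W a (\<lambda>x. A x $$ (i, j))"
  shows "power_series_at p W a (\<lambda>x. lift_mat N (A x) $$ (i, j))"
proof -
  obtain k where k: "N = n * k" using N by blast
  have n: "0 < n" using ij k by (cases n) auto
  have ij': "i < n * k" "j < n * k" using ij k by auto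
  have "lift_mat N (A x) = A x \<otimes>\<^sub>K 1\<^sub>m k" for x using A[of x] n k by (simp add: lift_mat_def)
  then show ?thesis using ij'
    by (cases "i mod k = j mod k")
      (simp_all add: kronecker_one_index[OF A] power_series_at_const entries less_mult_imp_div_less)
qed

lemma power_series_at_mat_mult:
  fixes A B :: "_ \<Rightarrow> 'a::{banach, real_normed_field} mat"
  assumes "\<And>x. A x \<in> carrier_mat n n" "\<And>x. B x \<in> carrier_mat n n" "i < n" "j < n"
    and A: "\<And>i j. i < n \<Longrightarrow> j < n \<Longrightarrow> power_series_at p W a (\<lambda>x. A x $$ (i, j))"
    and B: "\<And>i j. i < n \<Longrightarrow> j < n \<Longrightarrow> power_series_at p W a (\<lambda>x. B x $$ (i, j))"
  shows "power_series_at p W a (\<lambda>x. (A x * B x) $$ (i, j))"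
proof -
  have "(A x * B x) $$ (i, j) = (\<Sum>l<n. A x $$ (i, l) * B x $$ (l, j))" for x
    using assms(1,2)[of x] assms(3,4) by (simp add: scalar_prod_def lessThan_atLeast0)
  then show ?thesis using assms(3,4)
    by (simp only:) (intro power_series_at_sum power_series_at_mult A B; simp)
qed

text \<open>Cofactors are determinants in the entries, and the determinant is inverted at a point
  where it does not vanish. As \<open>mat_inverse_adj\<close> is a total formula, the expression for
  its entries holds at every \<open>x\<close>, singular values included.\<close>

lemma power_series_at_mat_inverse_adj:
  fixes A :: "_ \<Rightarrow> 'a::{banach, real_normed_field} mat"
  assumes A: "\<And>x. A x \<in> carrier_mat n n" and a: "a \<in> W" "Determinant.det (A a) \<noteq> 0" and ij: "i < n" "j < n"
    and entries: "\<And>i j. i < n \<Longrightarrow> j < n \<Longrightarrow> power_series_at p W a (\<lambda>x. A x $$ (i, j))"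
  shows "power_series_at p W a (\<lambda>x. mat_inverse_adj (A x) $$ (i, j))"
proof -
  have "power_series_at p W a (\<lambda>x. Determinant.det (mat_delete (A x) j i))"
  proof (rule power_series_at_det)
    show "mat_delete (A x) j i \<in> carrier_mat (n - 1) (n - 1)" for x
      using A[of x] by (simp add: mat_delete_def)
    fix i' j' assume "i' < n - 1" "j' < n - 1"
    then show "power_series_at p W a (\<lambda>x. mat_delete (A x) j i $$ (i', j'))"
      using A by (auto simp: mat_delete_def carrier_matD[OF A] intro!: entries)
  qed
  then have "power_series_at p W a (\<lambda>x. inverse (Determinant.det (A x)) * ((-1) ^ (j + i) * Determinant.det (mat_delete (A x) j i)))"
    by (intro power_series_at_mult power_series_at_inverse power_series_at_const power_series_at_det[OF A] entries a)
  moreover have "mat_inverse_adj (A x) $$ (i, j) =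
      inverse (Determinant.det (A x)) * ((-1) ^ (j + i) * Determinant.det (mat_delete (A x) j i))" for x
    using ij by (simp add: mat_inverse_adj_def adj_mat_def cofactor_def carrier_matD[OF A])
  ultimately show ?thesis by simp
qed

text \<open>Replaces \<open>inv_into\<close> by an explicit inverse \<open>s\<close> of the
  coordinates and the composite by a formula \<open>G\<close>, so that the closure rules for
  expansions can be applied to \<open>G\<close>.\<close>

lemma analytic_in_coordsI:
  assumes W: "openin (Euclidean_space p) W" and s: "\<And>x. x \<in> W \<Longrightarrow> s x \<in> A"
    and left: "\<And>y. y \<in> A \<Longrightarrow> \<phi> y \<in> W \<and> s (\<phi> y) = y" and right: "\<And>x. x \<in> W \<Longrightarrow> \<phi> (s x) = x"
    and val: "\<And>x. x \<in> W \<Longrightarrow> \<psi> (f (s x)) \<in> topspace (Euclidean_space q)"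
    and G: "\<And>x k. x \<in> W \<Longrightarrow> k < q \<Longrightarrow> \<psi> (f (s x)) k = G x k"
    and analytic: "\<And>a k. a \<in> W \<Longrightarrow> k < q \<Longrightarrow> power_series_at p W a (\<lambda>x. G x k)"
  shows "analytic_in_coords p \<phi> A q \<psi> f"
proof -
  have inj: "inj_on \<phi> A" using left by (metis inj_onI)
  have img: "\<phi> ` A = W" using left right s by (auto simp: image_iff) metis
  have inv: "inv_into A \<phi> x = s x" if "x \<in> W" for x
    using inj s[OF that] right[OF that] by (rule inv_into_f_eq)
  show ?thesis unfolding analytic_in_coords_def img
  proof (intro conjI inj, unfold analytic_map_def, intro conjI allI impI)
    show "\<psi> \<circ> f \<circ> inv_into A \<phi> \<in> W \<rightarrow> topspace (Euclidean_space q)" using val by (simp add: inv)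
    fix k assume k: "k < q"
    have "real_analytic_on p W (\<lambda>x. G x k)" using real_analytic_onI[OF W analytic] k by blast
    then show "real_analytic_on p W (\<lambda>x. (\<psi> \<circ> f \<circ> inv_into A \<phi>) x k)"
      by (rule real_analytic_on_cong) (simp add: inv G k)
  qed
qed

lemma analytic_inverse_GL:
  "analytic_inverse (GL_group :: 'a::{real_normed_field, euclidean_space} mat set monoid) GL_leaf"
  unfolding analytic_inverse_def
proof (intro allI impI conjI)
  fix m :: nat assume "1 \<le> m"
  then have m: "0 < m" by simp
  let ?L = "GL_leaf m :: 'a mat set coords"
  let ?inv = "\<lambda>X :: 'a mat set. inv\<^bsub>GL_group\<^esub> X"
  have inv: "?inv (mat_class A) = mat_class (mat_inverse_adj A) \<and> mat_inverse_adj A \<in> GL_mats m"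
    if "A \<in> GL_mats m" for A
    using that m GL_group_inverse[of A m] mat_inverse_adj[of A m] by (auto simp: GL_mats_def)
  then show "?inv \<in> cdom ?L \<rightarrow> cdom ?L" unfolding cdom_GL_leaf[OF m] by auto
  let ?W = "mat_coords m ` (GL_mats m :: 'a mat set)"
  have W: "openin (Euclidean_space (m * m * DIM('a))) ?W" using open_mats_GL[of m, where 'a = 'a] by (simp add: open_mats_def)
  have moc: "mat_of_coords m (mat_coords m A) = A" if "A \<in> GL_mats m" for A :: "'a mat"
    using that by (intro mat_of_coords_mat_coords) (auto simp: GL_mats_def)
  have inGL: "(mat_of_coords m x :: 'a mat) \<in> GL_mats m" if "x \<in> ?W" for x using that moc by auto
  show "analytic_in_coords (cdim ?L) (cmap ?L) (cdom ?L) (cdim ?L) (cmap ?L) ?inv"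
    unfolding cdom_GL_leaf[OF m] cdim_GL_leaf
  proof (rule analytic_in_coordsI[OF W, where s = "\<lambda>x. mat_class (mat_of_coords m x :: 'a mat)"
        and G = "\<lambda>x. mat_coords m (mat_inverse_adj (mat_of_coords m x :: 'a mat))"])
    show "mat_class (mat_of_coords m x :: 'a mat) \<in> mat_class ` GL_mats m" if "x \<in> ?W" for x
      by (rule imageI[OF inGL[OF that]])
    show "cmap ?L X \<in> ?W \<and> mat_class (mat_of_coords m (cmap ?L X)) = X" if "X \<in> mat_class ` GL_mats m" for X
      using that m moc by (auto simp: GL_mats_def cmap_GL_leaf_mat_class)
    show "cmap ?L (mat_class (mat_of_coords m x)) = x" if "x \<in> ?W" for x
      using that m moc by (auto simp: cmap_GL_leaf_mat_class GL_mats_def)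
    show "cmap ?L (?inv (mat_class (mat_of_coords m x))) \<in> topspace (Euclidean_space (m * m * DIM('a)))" for x
      by (simp add: cmap_GL_leaf)
    show "cmap ?L (?inv (mat_class (mat_of_coords m x))) k =
        mat_coords m (mat_inverse_adj (mat_of_coords m x :: 'a mat)) k"
      if "x \<in> ?W" for x k
      using inv[OF inGL[OF that]] m by (auto simp: cmap_GL_leaf_mat_class GL_mats_def)
    fix a k assume a: "a \<in> ?W"
    show "power_series_at (m * m * DIM('a)) ?W a (\<lambda>x. mat_coords m (mat_inverse_adj (mat_of_coords m x :: 'a mat)) k)"
      using inGL[OF a] a
      by (intro power_series_at_mat_coords power_series_at_mat_inverse_adj[of _ m] power_series_at_mat_of_coords
          power_series_at_coordinate) (auto simp: GL_mats_def)
  qed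
qed

lemma analytic_product_GL:
  "analytic_product (GL_group :: 'a::{real_normed_field, euclidean_space} mat set monoid) GL_leaf"
  unfolding analytic_product_def
proof (intro allI impI conjI)
  fix m n :: nat assume "1 \<le> m" "1 \<le> n"
  then have m: "0 < m" and n: "0 < n" by auto
  let ?t = "lcm m n"
  have t: "0 < ?t" using m n by (simp add: lcm_pos_nat)
  let ?L = "GL_leaf :: nat \<Rightarrow> 'a mat set coords"
  let ?mult = "\<lambda>(X, Y :: 'a mat set). X \<otimes>\<^bsub>GL_group\<^esub> Y"
  let ?P = "\<lambda>A B :: 'a mat. lift_mat ?t A * lift_mat ?t B"
  have prod: "?mult (mat_class A, mat_class B) = mat_class (?P A B) \<and> ?P A B \<in> GL_mats ?t"
    if "A \<in> GL_mats m" "B \<in> GL_mats n" for A B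
  proof -
    have AB: "A \<in> carrier_mat m m" "B \<in> carrier_mat n n" "Determinant.det A \<noteq> 0" "Determinant.det B \<noteq> 0"
      using that by (auto simp: GL_mats_def)
    have c: "lift_mat ?t A \<in> carrier_mat ?t ?t" "lift_mat ?t B \<in> carrier_mat ?t ?t"
      using AB by (auto intro: lift_mat_carrier)
    have "mat_class A \<ltimes> mat_class B = mat_class (?P A B)"
      using class_stp_mat_class[OF c t] mat_class_lift_mat[OF AB(1) _ t] mat_class_lift_mat[OF AB(2) _ t] by simp
    moreover have "?P A B \<in> GL_mats ?t"
      using c AB by (auto simp: GL_mats_def det_mult[OF c] det_lift_mat)
    ultimately show ?thesis by simp
  qed
  show "?mult \<in> cdom (?L m) \<times> cdom (?L n) \<rightarrow> cdom (?L ?t)"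
    unfolding cdom_GL_leaf[OF m] cdom_GL_leaf[OF n] cdom_GL_leaf[OF t]
  proof
    fix Z :: "'a mat set \<times> 'a mat set" assume "Z \<in> mat_class ` GL_mats m \<times> mat_class ` GL_mats n"
    then obtain A B where "A \<in> GL_mats m" "B \<in> GL_mats n" "Z = (mat_class A, mat_class B)" by blast
    then show "?mult Z \<in> mat_class ` GL_mats ?t" using prod by blast
  qed
  let ?p = "m * m * DIM('a)" and ?q = "n * n * DIM('a)"
  \<comment> \<open>The first \<open>?p\<close> coordinates belong to the left factor and the
    following \<open>?q\<close> to the right one, hence the shift.\<close>
  let ?A = "\<lambda>x. mat_of_coords m x :: 'a mat" and ?B = "\<lambda>x. mat_of_coords n (\<lambda>i. x (?p + i)) :: 'a mat"
  \<comment> \<open>This will be the image of the two leaves under the joint coordinates, described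
    by matrices so that its openness follows from continuity of the determinants.\<close>
  let ?W = "{x \<in> topspace (Euclidean_space (?p + ?q)). ?A x \<in> GL_mats m \<and> ?B x \<in> GL_mats n}"
  let ?j = "join_coords (?L m) (?L n)"
  have cont: "continuous_on UNIV (\<lambda>x. ?A x $$ (i, j))" if "i < m" "j < m" for i j
    using that by (rule continuous_on_mat_of_coords)
  have contB: "continuous_on UNIV (\<lambda>x. ?B x $$ (i, j))" if "i < n" "j < n" for i j
    unfolding mat_of_coords_index[OF that]
    by (intro continuous_on_sum continuous_on_scaleR continuous_on_const continuous_on_product_coordinates)
  have contdet: "continuous_on UNIV (\<lambda>x. Determinant.det (?A x))" "continuous_on UNIV (\<lambda>x. Determinant.det (?B x))"
    unfolding det_def'[OF mat_of_coords_carrier]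
    by (intro continuous_on_sum continuous_on_mult continuous_on_const continuous_on_prod cont contB;
        auto simp: permutes_in_image)+
  have "open {x. Determinant.det (?A x) \<noteq> 0 \<and> Determinant.det (?B x) \<noteq> 0}"
    by (intro open_Collect_conj open_Collect_neq contdet continuous_on_const)
  moreover have "?W = {x. Determinant.det (?A x) \<noteq> 0 \<and> Determinant.det (?B x) \<noteq> 0} \<inter> topspace (Euclidean_space (?p + ?q))"
    by (auto simp: GL_mats_def)
  ultimately have W: "openin (Euclidean_space (?p + ?q)) ?W" unfolding openin_Euclidean_space_iff by blast
  have join: "?j (mat_class A, mat_class B) = (\<lambda>i. if i < ?p then mat_coords m A i else mat_coords n B (i - ?p))"
    if "A \<in> GL_mats m" "B \<in> GL_mats n" for A B
    using that m n by (auto simp: join_coords_def cdim_GL_leaf cmap_GL_leaf_mat_class GL_mats_def fun_eq_iff)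
  have recover: "?A (?j (mat_class A, mat_class B)) = A \<and> ?B (?j (mat_class A, mat_class B)) = B"
    if "A \<in> GL_mats m" "B \<in> GL_mats n" for A B
    using that unfolding join[OF that] by (auto simp: GL_mats_def intro!: mat_of_coords_mat_coords)
  show "analytic_in_coords (cdim (?L m) + cdim (?L n)) ?j (cdom (?L m) \<times> cdom (?L n))
      (cdim (?L ?t)) (cmap (?L ?t)) ?mult"
    unfolding cdom_GL_leaf[OF m] cdom_GL_leaf[OF n] cdim_GL_leaf
  proof (rule analytic_in_coordsI[OF W, where s = "\<lambda>x. (mat_class (?A x), mat_class (?B x))"
        and G = "\<lambda>x. mat_coords ?t (?P (?A x) (?B x))"])
    show "(mat_class (?A x), mat_class (?B x)) \<in> mat_class ` GL_mats m \<times> mat_class ` GL_mats n" if "x \<in> ?W" for x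
      using that by blast
    show "?j Z \<in> ?W \<and> (mat_class (?A (?j Z)), mat_class (?B (?j Z))) = Z"
      if Z: "Z \<in> mat_class ` GL_mats m \<times> mat_class ` GL_mats n" for Z
    proof -
      obtain A B where AB: "A \<in> GL_mats m" "B \<in> GL_mats n" "Z = (mat_class A, mat_class B)" using Z by blast
      have "?j Z \<in> topspace (Euclidean_space (?p + ?q))"
        unfolding AB(3) join[OF AB(1,2)] by (auto simp: topspace_Euclidean_space mat_coords_def)
      then show ?thesis using recover[OF AB(1,2)] AB by simp
    qed
    show "?j (mat_class (?A x), mat_class (?B x)) = x" if x: "x \<in> ?W" for x
    proof
      fix i
      have "mat_coords m (?A x) i = x i" if i: "i < ?p"
      proof -
        \<comment> \<open>From \<open>?p\<close> on, \<open>x\<close> carries the coordinates of the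
          right factor; cutting it off there gives a point of the Euclidean space to which
          \<open>mat_coords_mat_of_coords\<close> applies.\<close>
        let ?y = "\<lambda>i. if i < ?p then x i else 0"
        have "mat_coords m (mat_of_coords m ?y :: 'a mat) = ?y"
          by (rule mat_coords_mat_of_coords) (simp add: topspace_Euclidean_space)
        moreover have "(mat_of_coords m ?y :: 'a mat) = ?A x"
          unfolding mat_of_coords_def by (rule cong_mat) (auto intro!: sum.cong simp: mat_index_less)
        ultimately show ?thesis using i by (metis (no_types, lifting))
      qed
      moreover have "mat_coords n (?B x) (i - ?p) = x i" if i: "\<not> i < ?p"
      proof -
        have "mat_coords n (?B x) = (\<lambda>i. x (?p + i))"
          by (rule mat_coords_mat_of_coords) (use x in \<open>simp add: topspace_Euclidean_space\<close>)
        then show ?thesis using i by simp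
      qed
      ultimately show "?j (mat_class (?A x), mat_class (?B x)) i = x i" using x by (simp add: join)
    qed
    show "cmap (?L ?t) (?mult (mat_class (?A x), mat_class (?B x))) \<in> topspace (Euclidean_space (?t * ?t * DIM('a)))" for x
      by (simp add: cmap_GL_leaf)
    show "cmap (?L ?t) (?mult (mat_class (?A x), mat_class (?B x))) k = mat_coords ?t (?P (?A x) (?B x)) k"
      if x: "x \<in> ?W" for x k
    proof -
      have "?P (?A x) (?B x) \<in> carrier_mat ?t ?t"
        "?mult (mat_class (?A x), mat_class (?B x)) = mat_class (?P (?A x) (?B x))"
        using prod[of "?A x" "?B x"] x by (auto simp: GL_mats_def)
      then show ?thesis using cmap_GL_leaf_mat_class[OF _ t] by metis
    qed
    fix a k assume a: "a \<in> ?W"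
    show "power_series_at (?p + ?q) ?W a (\<lambda>x. mat_coords ?t (?P (?A x) (?B x)) k)"
      by (intro power_series_at_mat_coords power_series_at_mat_mult[of _ ?t] power_series_at_lift_mat[of _ m]
          power_series_at_lift_mat[of _ n] power_series_at_mat_of_coords power_series_at_coordinate lift_mat_carrier)
        auto
  qed
qed

text \<open>The argument is uniform in the scalars; the real and the complex case are its two
  instances.\<close>

lemma bundled_Lie_group_GL:
  "bundled_Lie_group (GL_topology :: 'a::{real_normed_field, euclidean_space} mat set topology) GL_group GL_leaf"
  unfolding bundled_Lie_group_def
  using bundled_manifold_GL natural_coords_GL group_GL_group analytic_product_GL analytic_inverse_GL
  by (auto simp: topspace_GL_topology)

theorem theorem181:
  shows "bundled_Lie_group (GL_topology :: real mat set topology) GL_group GL_leaf \<and>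
         bundled_Lie_group (GL_topology :: complex mat set topology) GL_group GL_leaf"
  by (intro conjI bundled_Lie_group_GL)

end
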